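(* Let $\mathcal{X}$ and $\mathcal{Y}$ be infinite dimensional complex Banach spaces, let $A\in B(\mathcal{X})$, $B\in B(\mathcal{Y})$, and consider $A\otimes B\in B(\mathcal{X}\overline{\otimes}\mathcal{Y})$ and $\tau_{AB}\in B(B(\mathcal{Y},\mathcal{X}))$. Suppose that $0\in \mathrm{iso}\,\sigma(A\otimes B)=\mathrm{iso}\,\sigma(\tau_{AB})$. Then the following hold. (i) If $\sigma(A)=\Pi(A)=\{0\}$ or $\sigma(B)=\Pi(B)=\{0\}$, then $\sigma(A\otimes B)=\Pi(A\otimes B)=\{0\}=\Pi(\tau_{AB})=\sigma(\tau_{AB})$. (ii) If either $\sigma(A)=I(A)=\{0\}$ and $B$ is not nilpotent, or $\sigma(B)=I(B)=\{0\}$ and $A$ is not nilpotent, then $\sigma(A\otimes B)=I(A\otimes B)=\{0\}=I(\tau_{AB})=\sigma(\tau_{AB})$. (iii) If either $0\in\Pi(A)$ and $0\notin\sigma(B)$, or $0\notin\sigma(A)$ and $0\in\Pi(B)$, then $0\in\Pi(A\otimes B)\cap\Pi(\tau_{AB})$. (iv) If either $0\in I(A)$, $\sigma(A)\neq\{0\}$ and $0\notin\sigma(B)$, or $0\notin\sigma(A)$, $0\in I(B)$ and $\sigma(B)\neq\{0\}$, then $0\in I(A\otimes B)\cap I(\tau_{AB})$. (v) If $0\in\Pi(A)\cap\Pi(B)$, then $0\in\Pi(A\otimes B)\cap\Pi(\tau_{AB})$. (vi) If one of the following holds: $0\in I(A)\cap\Pi(B)$ and $B$ is not nilpotent; or $0\in\Pi(A)\cap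 I(B)$ and $A$ is not nilpotent; or $0\in I(A)\cap I(B)$; then $0\in I(A\otimes B)\cap I(\tau_{AB})$.
   Context: $B(\mathcal{Y},\mathcal{X})$ is the space of bounded linear maps from $\mathcal{Y}$ to $\mathcal{X}$, and $B(\mathcal{X})=B(\mathcal{X},\mathcal{X})$. $\mathcal{X}\overline{\otimes}\mathcal{Y}$ is the completion of the algebraic tensor product $\mathcal{X}\otimes\mathcal{Y}$ with respect to a reasonable uniform cross-norm (in particular $\|x\otimes y\|=\|x\|\,\|y\|$, and $A\otimes B$ extends to a bounded operator on the completion with $\|A\otimes B\|\le\|A\|\,\|B\|$, for all bounded $A$ on $\mathcal{X}$ and $B$ on $\mathcal{Y}$). $A\otimes B$ denotes this tensor product operator. $\tau_{AB}\in B(B(\mathcal{Y},\mathcal{X}))$ is the multiplication operator $\tau_{AB}(U)=AUB$. It is known that $\sigma(A\otimes B)=\sigma(\tau_{AB})=\sigma(A)\sigma(B)$. For a bounded operator $T$: $\sigma(T)$ is the spectrum and $\mathrm{iso}\,\sigma(T)$ the set of its isolated points. The ascent (descent) of $T$ is the smallest integer $n\ge 0$ with $N(T^n)=N(T^{n+1})$ (respectively $R(T^n)=R(T^{n+1})$), or $\infty$ if there is none, where $N$ and $R$ denote null space and range. $\Pi(T)$ is the set of poles of $T$: those $\lambda\in\sigma(T)$ such that the ascent and the descent of $T-\lambda$ are finite. $I(T)=\mathrm{iso}\,\sigma(T)\setminus\Pi(T)$. *)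

theory Defs
  imports "HOL-Analysis.Analysis" "HOL-Library.Poly_Mapping"
begin

section \<open>Complex Banach spaces\<close>

class scaleC =
  fixes scaleC :: "complex \<Rightarrow> 'a \<Rightarrow> 'a" (infixr \<open>*\<^sub>C\<close> 75)

class complex_vector = scaleC + ab_group_add +
  assumes scaleC_add_right: "c *\<^sub>C (x + y) = c *\<^sub>C x + c *\<^sub>C y"
    and scaleC_add_left: "(c + d) *\<^sub>C x = c *\<^sub>C x + d *\<^sub>C x"
    and scaleC_scaleC: "c *\<^sub>C d *\<^sub>C x = (c * d) *\<^sub>C x"
    and scaleC_one: "1 *\<^sub>C x = x"

class complex_normed_vector = complex_vector + real_normed_vector +
  assumes scaleR_scaleC: "r *\<^sub>R x = complex_of_real r *\<^sub>C x"
    and norm_scaleC: "norm (c *\<^sub>C x) = cmod c * norm x"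

class complex_banach = complex_normed_vector + complete_space

subclass (in complex_banach) banach ..

global_interpretation cvs: vector_space "scaleC :: complex \<Rightarrow> 'a \<Rightarrow> 'a::complex_vector"
  by unfold_locales
    (rule scaleC_add_right scaleC_add_left scaleC_scaleC scaleC_one)+

abbreviation clinear :: "('a::complex_vector \<Rightarrow> 'b::complex_vector) \<Rightarrow> bool"
  where "clinear \<equiv> Vector_Spaces.linear scaleC scaleC"

lemma clinearI:
  assumes "\<And>x y. f (x + y) = f x + f y" "\<And>c x. f (c *\<^sub>C x) = c *\<^sub>C f x"
  shows "clinear f"
  using assms by unfold_locales

lemma clinear_add: "clinear f \<Longrightarrow> f (x + y) = f x + f y"
  and clinear_scaleC: "clinear f \<Longrightarrow> f (c *\<^sub>C x) = c *\<^sub>C f x"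
  by (auto simp: linear_iff_module_hom module_hom.add module_hom.scale)

instantiation complex :: complex_banach
begin
definition "scaleC_complex = ((*) :: complex \<Rightarrow> complex \<Rightarrow> complex)"
instance
  by standard (auto simp: scaleC_complex_def algebra_simps norm_mult scaleR_conv_of_real)
end

lemma tendsto_scaleC:
  fixes f :: "'b \<Rightarrow> 'a::complex_normed_vector"
  assumes "(f \<longlongrightarrow> l) F"
  shows "((\<lambda>x. c *\<^sub>C f x) \<longlongrightarrow> c *\<^sub>C l) F"
proof -
  have "((\<lambda>x. norm (f x - l)) \<longlongrightarrow> 0) F"
    using assms by (simp add: LIM_zero_iff tendsto_norm_zero)
  then have "((\<lambda>x. cmod c * norm (f x - l)) \<longlongrightarrow> 0) F"
    by (rule tendsto_mult_right_zero)
  then have "((\<lambda>x. norm (c *\<^sub>C f x - c *\<^sub>C l)) \<longlongrightarrow> 0) F"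
    by (simp add: norm_scaleC flip: cvs.scale_right_diff_distrib)
  then show ?thesis
    by (simp add: LIM_zero_iff tendsto_norm_zero_iff)
qed


section \<open>Bounded complex-linear operators\<close>

typedef (overloaded) ('a, 'b) cblinfun (\<open>(_ \<Rightarrow>\<^sub>B /_)\<close> [22, 21] 21) =
  "{f :: 'a::complex_normed_vector \<Rightarrow>\<^sub>L 'b::complex_normed_vector.
     \<forall>c x. blinfun_apply f (c *\<^sub>C x) = c *\<^sub>C blinfun_apply f x}"
  morphisms blinfun_of_cblinfun CBlinfun
  by (rule exI[of _ 0]) simp

setup_lifting type_definition_cblinfun

definition capply :: "('a::complex_normed_vector \<Rightarrow>\<^sub>B 'b::complex_normed_vector) \<Rightarrow> 'a \<Rightarrow> 'b"
  where "capply T = blinfun_apply (blinfun_of_cblinfun T)"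

lemma bounded_linear_capply: "bounded_linear (capply T)"
  by (simp add: capply_def blinfun.bounded_linear_right)

lemma clinear_capply: "clinear (capply T)"
  using blinfun_of_cblinfun[of T]
  by (intro clinearI) (auto simp: capply_def blinfun.add_right)

lemma capply_eqI: "(\<And>x. capply S x = capply T x) \<Longrightarrow> S = T"
  by (metis blinfun_eqI blinfun_of_cblinfun_inject capply_def)

lemma blinfun_scaleC_right:
  fixes f :: "'a::real_normed_vector \<Rightarrow>\<^sub>L 'b::complex_normed_vector"
  shows "bounded_linear (\<lambda>x. c *\<^sub>C f x)"
proof (rule bounded_linear_intro)
  fix x y r
  show "c *\<^sub>C f (x + y) = c *\<^sub>C f x + c *\<^sub>C f y"
    by (simp add: blinfun.add_right scaleC_add_right)
  show "c *\<^sub>C f (r *\<^sub>R x) = r *\<^sub>R c *\<^sub>C f x"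
    by (simp add: blinfun.scaleR_right scaleR_scaleC mult.commute)
  show "norm (c *\<^sub>C f x) \<le> norm x * (cmod c * norm f)"
    using mult_left_mono[OF norm_blinfun[of f x], of "cmod c"]
    by (simp add: norm_scaleC mult_ac)
qed

instantiation cblinfun :: (complex_normed_vector, complex_normed_vector) complex_normed_vector
begin

lift_definition zero_cblinfun :: "'a \<Rightarrow>\<^sub>B 'b" is 0
  by simp
lift_definition plus_cblinfun :: "('a \<Rightarrow>\<^sub>B 'b) \<Rightarrow> ('a \<Rightarrow>\<^sub>B 'b) \<Rightarrow> 'a \<Rightarrow>\<^sub>B 'b" is "(+)"
  by (simp add: blinfun.add_left scaleC_add_right)
lift_definition minus_cblinfun :: "('a \<Rightarrow>\<^sub>B 'b) \<Rightarrow> ('a \<Rightarrow>\<^sub>B 'b) \<Rightarrow> 'a \<Rightarrow>\<^sub>B 'b" is "(-)"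
  by (simp add: blinfun.diff_left cvs.scale_right_diff_distrib)
lift_definition uminus_cblinfun :: "('a \<Rightarrow>\<^sub>B 'b) \<Rightarrow> 'a \<Rightarrow>\<^sub>B 'b" is uminus
  by (simp add: blinfun.minus_left)
lift_definition scaleR_cblinfun :: "real \<Rightarrow> ('a \<Rightarrow>\<^sub>B 'b) \<Rightarrow> 'a \<Rightarrow>\<^sub>B 'b" is "(*\<^sub>R)"
  by (simp add: blinfun.scaleR_left scaleR_scaleC mult.commute)
lift_definition scaleC_cblinfun :: "complex \<Rightarrow> ('a \<Rightarrow>\<^sub>B 'b) \<Rightarrow> 'a \<Rightarrow>\<^sub>B 'b"
  is "\<lambda>c f. Blinfun (\<lambda>x. c *\<^sub>C blinfun_apply f x)"
  by (simp add: bounded_linear_Blinfun_apply[OF blinfun_scaleC_right] mult.commute)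
lift_definition norm_cblinfun :: "('a \<Rightarrow>\<^sub>B 'b) \<Rightarrow> real" is norm .

definition "sgn_cblinfun (x :: 'a \<Rightarrow>\<^sub>B 'b) = inverse (norm x) *\<^sub>R x"
definition "dist_cblinfun (x :: 'a \<Rightarrow>\<^sub>B 'b) y = norm (x - y)"
definition "uniformity_cblinfun =
  (INF e\<in>{0<..}. principal {(x :: 'a \<Rightarrow>\<^sub>B 'b, y). dist x y < e})"
definition "open_cblinfun (U :: ('a \<Rightarrow>\<^sub>B 'b) set) =
  (\<forall>x\<in>U. \<forall>\<^sub>F (x', y) in uniformity. x' = x \<longrightarrow> y \<in> U)"

lemma capply_zero: "capply 0 x = 0"
  and capply_plus: "capply (S + T) x = capply S x + capply T x"
  and capply_minus: "capply (S - T) x = capply S x - capply T x"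
  and capply_scaleC: "capply (c *\<^sub>C T) x = c *\<^sub>C capply T x"
  by (simp_all add: capply_def zero_cblinfun.rep_eq plus_cblinfun.rep_eq minus_cblinfun.rep_eq
      scaleC_cblinfun.rep_eq blinfun.add_left blinfun.diff_left
      bounded_linear_Blinfun_apply[OF blinfun_scaleC_right])

instance
proof
  fix x y z :: "'a \<Rightarrow>\<^sub>B 'b" and c d :: complex and r s :: real and U :: "('a \<Rightarrow>\<^sub>B 'b) set"
  show "x + y + z = x + (y + z)" "x + y = y + x" "0 + x = x" "- x + x = 0" "x - y = x + - y"
    by (transfer; simp)+
  show "c *\<^sub>C (x + y) = c *\<^sub>C x + c *\<^sub>C y" "(c + d) *\<^sub>C x = c *\<^sub>C x + d *\<^sub>C x"
    "c *\<^sub>C d *\<^sub>C x = (c * d) *\<^sub>C x" "1 *\<^sub>C x = x"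
    by (rule capply_eqI; simp add: capply_plus capply_scaleC scaleC_add_right scaleC_add_left)+
  show "r *\<^sub>R (x + y) = r *\<^sub>R x + r *\<^sub>R y" "(r + s) *\<^sub>R x = r *\<^sub>R x + s *\<^sub>R x"
    "r *\<^sub>R s *\<^sub>R x = (r * s) *\<^sub>R x" "1 *\<^sub>R x = x"
    by (transfer; simp add: algebra_simps)+
  show "dist x y = norm (x - y)" by (rule dist_cblinfun_def)
  show "sgn x = inverse (norm x) *\<^sub>R x" by (rule sgn_cblinfun_def)
  show "uniformity = (INF e\<in>{0<..}. principal {(x :: 'a \<Rightarrow>\<^sub>B 'b, y). dist x y < e})"
    by (rule uniformity_cblinfun_def)
  show "open U \<longleftrightarrow> (\<forall>x\<in>U. \<forall>\<^sub>F (x', y) in uniformity. x' = x \<longrightarrow> y \<in> U)"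
    by (rule open_cblinfun_def)
  show "norm x = 0 \<longleftrightarrow> x = 0" by transfer simp
  show "norm (x + y) \<le> norm x + norm y" by transfer (rule norm_triangle_ineq)
  show "norm (r *\<^sub>R x) = \<bar>r\<bar> * norm x" by transfer simp
  show "r *\<^sub>R x = complex_of_real r *\<^sub>C x"
    by transfer
      (auto intro!: blinfun_eqI
        simp: blinfun.scaleR_left scaleR_scaleC bounded_linear_Blinfun_apply[OF blinfun_scaleC_right])
  show "norm (c *\<^sub>C x) = cmod c * norm x"
  proof transfer
    fix c and f :: "'a \<Rightarrow>\<^sub>L 'b"
    have le: "norm (Blinfun (\<lambda>x. c *\<^sub>C g x)) \<le> cmod c * norm g" for c and g :: "'a \<Rightarrow>\<^sub>L 'b"
    proof (rule norm_blinfun_bound)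
      fix x show "norm (blinfun_apply (Blinfun (\<lambda>x. c *\<^sub>C g x)) x) \<le> cmod c * norm g * norm x"
        using mult_left_mono[OF norm_blinfun[of g x], of "cmod c"]
        by (simp add: norm_scaleC mult.assoc bounded_linear_Blinfun_apply[OF blinfun_scaleC_right])
    qed simp
    show "norm (Blinfun (\<lambda>x. c *\<^sub>C f x)) = cmod c * norm f"
    proof (cases "c = 0")
      case True
      then show ?thesis using le[of 0 f] by simp
    next
      case False
      have "f = Blinfun (\<lambda>x. inverse c *\<^sub>C Blinfun (\<lambda>x. c *\<^sub>C f x) x)"
        using False
        by (auto simp: blinfun_apply_inverse bounded_linear_Blinfun_apply[OF blinfun_scaleC_right])
      then have "norm f \<le> cmod (inverse c) * norm (Blinfun (\<lambda>x. c *\<^sub>C f x))"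
        using le by metis
      then have "cmod c * norm f \<le> norm (Blinfun (\<lambda>x. c *\<^sub>C f x))"
        using False by (simp add: norm_inverse norm_divide field_simps)
      then show ?thesis using le[of c f] by simp
    qed
  qed
qed

end

lemma norm_cblinfun_onorm: "norm T = onorm (capply T)"
  by (simp add: capply_def norm_cblinfun.rep_eq norm_blinfun.rep_eq)

lemma norm_capply: "norm (capply T x) \<le> norm T * norm x"
  by (simp add: capply_def norm_cblinfun.rep_eq norm_blinfun)

instance cblinfun :: (complex_normed_vector, complex_banach) complex_banach
proof
  fix X :: "nat \<Rightarrow> 'a \<Rightarrow>\<^sub>B 'b"
  assume "Cauchy X"
  then have "Cauchy (\<lambda>n. blinfun_of_cblinfun (X n))"
    by (simp add: Cauchy_def dist_norm norm_cblinfun.rep_eq minus_cblinfun.rep_eq)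
  then obtain L where L: "(\<lambda>n. blinfun_of_cblinfun (X n)) \<longlonglongrightarrow> L"
    using Cauchy_convergent_iff convergent_def by blast
  have "L (c *\<^sub>C x) = c *\<^sub>C L x" for c x
  proof (rule LIMSEQ_unique)
    have lim: "(\<lambda>n. capply (X n) y) \<longlonglongrightarrow> L y" for y
      unfolding capply_def by (intro blinfun.tendsto L tendsto_const)
    show "(\<lambda>n. capply (X n) (c *\<^sub>C x)) \<longlonglongrightarrow> L (c *\<^sub>C x)" by (rule lim)
    show "(\<lambda>n. capply (X n) (c *\<^sub>C x)) \<longlonglongrightarrow> c *\<^sub>C L x"
      using tendsto_scaleC[OF lim] by (simp add: clinear_scaleC[OF clinear_capply])
  qed
  then have "blinfun_of_cblinfun (CBlinfun L) = L"
    by (simp add: CBlinfun_inverse)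
  then have "X \<longlonglongrightarrow> CBlinfun L"
    using L by (simp add: tendsto_iff dist_norm norm_cblinfun.rep_eq minus_cblinfun.rep_eq)
  then show "convergent X" by (rule convergentI)
qed

lift_definition cid :: "'a::complex_normed_vector \<Rightarrow>\<^sub>B 'a" is id_blinfun
  by simp

lift_definition ccompose :: "('b::complex_normed_vector \<Rightarrow>\<^sub>B 'c::complex_normed_vector) \<Rightarrow>
    ('a::complex_normed_vector \<Rightarrow>\<^sub>B 'b) \<Rightarrow> 'a \<Rightarrow>\<^sub>B 'c" (infixl \<open>o\<^sub>C\<close> 55)
  is "(o\<^sub>L)"
  by simp

lemma capply_cid: "capply cid x = x"
  and capply_ccompose: "capply (S o\<^sub>C T) x = capply S (capply T x)"
  by (simp_all add: capply_def cid.rep_eq ccompose.rep_eq)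

lemma norm_ccompose: "norm (S o\<^sub>C T) \<le> norm S * norm T"
  by transfer (rule norm_blinfun_compose)

lemma capply_CBlinfun_Blinfun:
  assumes "clinear f" "\<And>x. norm (f x) \<le> K * norm x"
  shows "capply (CBlinfun (Blinfun f)) = f"
proof -
  have "bounded_linear f"
    using assms
    by (intro bounded_linear_intro[of f K])
      (auto simp: clinear_add clinear_scaleC scaleR_scaleC mult.commute)
  then show ?thesis
    using assms(1)
    by (simp add: capply_def CBlinfun_inverse bounded_linear_Blinfun_apply clinear_scaleC)
qed

definition mult_operator :: "('x::complex_normed_vector \<Rightarrow>\<^sub>B 'x) \<Rightarrow>
    ('y::complex_normed_vector \<Rightarrow>\<^sub>B 'y) \<Rightarrow> ('y \<Rightarrow>\<^sub>B 'x) \<Rightarrow>\<^sub>B ('y \<Rightarrow>\<^sub>B 'x)"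
  where "mult_operator A B = CBlinfun (Blinfun (\<lambda>U. A o\<^sub>C U o\<^sub>C B))"

lemma capply_mult_operator: "capply (mult_operator A B) U = A o\<^sub>C U o\<^sub>C B"
proof -
  have "clinear (\<lambda>U. A o\<^sub>C U o\<^sub>C B)"
    by (intro clinearI capply_eqI)
      (simp_all add: capply_plus capply_scaleC capply_ccompose clinear_add[OF clinear_capply]
        clinear_scaleC[OF clinear_capply])
  moreover have "norm (A o\<^sub>C U o\<^sub>C B) \<le> (norm A * norm B) * norm U" for U
  proof -
    have "norm (A o\<^sub>C U o\<^sub>C B) \<le> norm (A o\<^sub>C U) * norm B"
      by (rule norm_ccompose)
    also have "\<dots> \<le> (norm A * norm U) * norm B"
      by (intro mult_right_mono norm_ccompose) simp
    finally show ?thesis by (simp add: mult_ac)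
  qed
  ultimately show ?thesis
    unfolding mult_operator_def by (subst capply_CBlinfun_Blinfun) auto
qed


section \<open>Spectrum, ascent, descent and poles\<close>

definition invertible_op :: "('a::complex_normed_vector \<Rightarrow>\<^sub>B 'a) \<Rightarrow> bool"
  where "invertible_op T \<longleftrightarrow> (\<exists>S. S o\<^sub>C T = cid \<and> T o\<^sub>C S = cid)"

definition spectrum :: "('a::complex_normed_vector \<Rightarrow>\<^sub>B 'a) \<Rightarrow> complex set"
  where "spectrum T = {z. \<not> invertible_op (T - z *\<^sub>C cid)}"

definition iso_spectrum :: "('a::complex_normed_vector \<Rightarrow>\<^sub>B 'a) \<Rightarrow> complex set"
  where "iso_spectrum T = {z. z isolated_in spectrum T}"

definition null_space :: "('a \<Rightarrow> 'b::zero) \<Rightarrow> 'a set"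
  where "null_space f = {x. f x = 0}"

definition ascent :: "('a::complex_normed_vector \<Rightarrow>\<^sub>B 'a) \<Rightarrow> enat"
  where "ascent T = Inf {enat n | n. null_space (capply T ^^ n) = null_space (capply T ^^ Suc n)}"

definition descent :: "('a::complex_normed_vector \<Rightarrow>\<^sub>B 'a) \<Rightarrow> enat"
  where "descent T = Inf {enat n | n. range (capply T ^^ n) = range (capply T ^^ Suc n)}"

definition poles :: "('a::complex_normed_vector \<Rightarrow>\<^sub>B 'a) \<Rightarrow> complex set"
  where "poles T = {z \<in> spectrum T. ascent (T - z *\<^sub>C cid) < \<infinity> \<and> descent (T - z *\<^sub>C cid) < \<infinity>}"

definition iso_nonpoles :: "('a::complex_normed_vector \<Rightarrow>\<^sub>B 'a) \<Rightarrow> complex set"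
  where "iso_nonpoles T = iso_spectrum T - poles T"

definition nilpotent_op :: "('a::complex_normed_vector \<Rightarrow>\<^sub>B 'a) \<Rightarrow> bool"
  where "nilpotent_op T \<longleftrightarrow> (\<exists>n. \<forall>x. (capply T ^^ n) x = 0)"


section \<open>The algebraic tensor product\<close>

instantiation poly_mapping :: (type, complex_vector) complex_vector
begin

lift_definition scaleC_poly_mapping :: "complex \<Rightarrow> ('a \<Rightarrow>\<^sub>0 'b) \<Rightarrow> 'a \<Rightarrow>\<^sub>0 'b"
  is "\<lambda>c f k. c *\<^sub>C f k"
  by (erule finite_subset[rotated]) auto

instance
  by standard (transfer; simp add: fun_eq_iff scaleC_add_right scaleC_add_left)+

end

lemma lookup_scaleC: "Poly_Mapping.lookup (c *\<^sub>C p) k = c *\<^sub>C Poly_Mapping.lookup p k"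
  by (simp add: scaleC_poly_mapping.rep_eq)

text \<open>The vector space of finitely supported functions \<open>'a \<times> 'b \<Rightarrow>\<^sub>0 complex\<close> is the free complex
  vector space on \<open>'a \<times> 'b\<close>; the tensor product is its quotient by the bilinearity relations.\<close>

definition bilinear_relations ::
    "(('a::complex_vector \<times> 'b::complex_vector) \<Rightarrow>\<^sub>0 complex) set"
  where "bilinear_relations =
    {Poly_Mapping.single (x + x', y) 1 - Poly_Mapping.single (x, y) 1 - Poly_Mapping.single (x', y) 1
      | x x' y. True} \<union>
    {Poly_Mapping.single (x, y + y') 1 - Poly_Mapping.single (x, y) 1 - Poly_Mapping.single (x, y') 1
      | x y y'. True} \<union>
    {Poly_Mapping.single (c *\<^sub>C x, y) 1 - c *\<^sub>C Poly_Mapping.single (x, y) 1 | c x y. True} \<union>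
    {Poly_Mapping.single (x, c *\<^sub>C y) 1 - c *\<^sub>C Poly_Mapping.single (x, y) 1 | c x y. True}"

lemma bilinear_relationsI:
  "Poly_Mapping.single (x + x', y) 1 - Poly_Mapping.single (x, y) 1 - Poly_Mapping.single (x', y) 1
    \<in> bilinear_relations"
  "Poly_Mapping.single (x, y + y') 1 - Poly_Mapping.single (x, y) 1 - Poly_Mapping.single (x, y') 1
    \<in> bilinear_relations"
  "Poly_Mapping.single (c *\<^sub>C x, y) 1 - c *\<^sub>C Poly_Mapping.single (x, y) 1 \<in> bilinear_relations"
  "Poly_Mapping.single (x, c *\<^sub>C y) 1 - c *\<^sub>C Poly_Mapping.single (x, y) 1 \<in> bilinear_relations"
  unfolding bilinear_relations_def by blast+

quotient_type (overloaded) ('a, 'b) tensor =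
    "('a::complex_vector \<times> 'b::complex_vector) \<Rightarrow>\<^sub>0 complex" /
    "\<lambda>p q. p - q \<in> cvs.span bilinear_relations"
proof (rule equivpI)
  show "reflp (\<lambda>p q. p - q \<in> cvs.span (bilinear_relations :: (('a \<times> 'b) \<Rightarrow>\<^sub>0 complex) set))"
    by (rule reflpI) (simp add: cvs.span_zero)
  show "symp (\<lambda>p q. p - q \<in> cvs.span (bilinear_relations :: (('a \<times> 'b) \<Rightarrow>\<^sub>0 complex) set))"
    by (rule sympI) (drule cvs.span_neg, simp)
  show "transp (\<lambda>p q. p - q \<in> cvs.span (bilinear_relations :: (('a \<times> 'b) \<Rightarrow>\<^sub>0 complex) set))"
    by (rule transpI) (drule (1) cvs.span_add, simp)
qed

instantiation tensor :: (complex_vector, complex_vector) complex_vector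
begin

lift_definition zero_tensor :: "('a, 'b) tensor" is 0 .
lift_definition plus_tensor :: "('a, 'b) tensor \<Rightarrow> ('a, 'b) tensor \<Rightarrow> ('a, 'b) tensor" is "(+)"
  by (drule (1) cvs.span_add) (simp add: algebra_simps)
lift_definition minus_tensor :: "('a, 'b) tensor \<Rightarrow> ('a, 'b) tensor \<Rightarrow> ('a, 'b) tensor" is "(-)"
proof -
  fix p p' q q' :: "('a \<times> 'b) \<Rightarrow>\<^sub>0 complex"
  assume "p - p' \<in> cvs.span bilinear_relations" "q - q' \<in> cvs.span bilinear_relations"
  then have "(p - p') - (q - q') \<in> cvs.span bilinear_relations" by (rule cvs.span_diff)
  then show "p - q - (p' - q') \<in> cvs.span bilinear_relations" by (simp add: algebra_simps)
qed
lift_definition uminus_tensor :: "('a, 'b) tensor \<Rightarrow> ('a, 'b) tensor" is uminus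
  by (drule cvs.span_neg) (simp add: algebra_simps)
lift_definition scaleC_tensor :: "complex \<Rightarrow> ('a, 'b) tensor \<Rightarrow> ('a, 'b) tensor" is "(*\<^sub>C)"
  by (simp add: cvs.span_scale flip: cvs.scale_right_diff_distrib)

instance
  by standard
    (transfer; simp add: cvs.span_zero algebra_simps scaleC_add_right scaleC_add_left scaleC_scaleC scaleC_one)+

end

lift_definition tensor_prod :: "'a::complex_vector \<Rightarrow> 'b::complex_vector \<Rightarrow> ('a, 'b) tensor"
  (infixl \<open>\<otimes>\<close> 70) is "\<lambda>x y. Poly_Mapping.single (x, y) 1" .

definition cbilinear :: "('a::complex_vector \<Rightarrow> 'b::complex_vector \<Rightarrow> 'c::complex_vector) \<Rightarrow> bool"
  where "cbilinear h \<longleftrightarrow> (\<forall>y. clinear (\<lambda>x. h x y)) \<and> (\<forall>x. clinear (h x))"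

lemma cbilinear_tensor_prod: "cbilinear (\<otimes>)"
proof -
  have "(x + x') \<otimes> y = x \<otimes> y + x' \<otimes> y" for x x' :: 'a and y :: 'b
    by (transfer, rule cvs.span_base) (simp only: bilinear_relationsI flip: diff_diff_eq)
  moreover have "x \<otimes> (y + y') = x \<otimes> y + x \<otimes> y'" for x :: 'a and y y' :: 'b
    by (transfer, rule cvs.span_base) (simp only: bilinear_relationsI flip: diff_diff_eq)
  moreover have "(c *\<^sub>C x) \<otimes> y = c *\<^sub>C (x \<otimes> y)" for c and x :: 'a and y :: 'b
    by (transfer, rule cvs.span_base) (rule bilinear_relationsI)
  moreover have "x \<otimes> (c *\<^sub>C y) = c *\<^sub>C (x \<otimes> y)" for c and x :: 'a and y :: 'b
    by (transfer, rule cvs.span_base) (rule bilinear_relationsI)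
  ultimately show ?thesis
    unfolding cbilinear_def by (auto intro!: clinearI)
qed

definition free_extend :: "('k \<Rightarrow> 'c::complex_vector) \<Rightarrow> ('k \<Rightarrow>\<^sub>0 complex) \<Rightarrow> 'c"
  where "free_extend h p = (\<Sum>k\<in>Poly_Mapping.keys p. Poly_Mapping.lookup p k *\<^sub>C h k)"

lemma free_extend_superset:
  assumes "finite K" "Poly_Mapping.keys p \<subseteq> K"
  shows "free_extend h p = (\<Sum>k\<in>K. Poly_Mapping.lookup p k *\<^sub>C h k)"
  unfolding free_extend_def using assms
  by (intro sum.mono_neutral_left) (auto simp: in_keys_iff)

lemma clinear_free_extend: "clinear (free_extend h)"
proof (rule clinearI)
  fix p q :: "'a \<Rightarrow>\<^sub>0 complex" and c :: complex
  have "Poly_Mapping.keys (p + q) \<subseteq> Poly_Mapping.keys p \<union> Poly_Mapping.keys q" by (rule keys_add)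
  then show "free_extend h (p + q) = free_extend h p + free_extend h q"
    by (simp add: free_extend_superset[of "Poly_Mapping.keys p \<union> Poly_Mapping.keys q"] lookup_add scaleC_add_left sum.distrib)
  have "Poly_Mapping.keys (c *\<^sub>C p) \<subseteq> Poly_Mapping.keys p" by (auto simp: in_keys_iff lookup_scaleC)
  then show "free_extend h (c *\<^sub>C p) = c *\<^sub>C free_extend h p"
    by (simp add: free_extend_superset[of "Poly_Mapping.keys p"] lookup_scaleC cvs.scale_sum_right scaleC_complex_def)
qed

lemma free_extend_single: "free_extend h (Poly_Mapping.single k 1) = h k"
  by (simp add: free_extend_def)

lemma free_extend_relations:
  assumes "cbilinear h" "p \<in> cvs.span bilinear_relations"
  shows "free_extend (case_prod h) p = 0"
proof -
  have l: "clinear (\<lambda>x. h x y)" and r: "clinear (h x)" for x y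
    using assms(1) by (auto simp: cbilinear_def)
  note diff = module_hom.diff[OF clinear_free_extend[unfolded linear_iff_module_hom]]
  have "free_extend (case_prod h) r = 0" if "r \<in> bilinear_relations" for r
    using that unfolding bilinear_relations_def
    by (elim UnE CollectE exE conjE)
      (simp_all only: diff free_extend_single clinear_scaleC[OF clinear_free_extend] prod.case
        clinear_add[OF l] clinear_add[OF r] clinear_scaleC[OF l] clinear_scaleC[OF r]
        add_diff_cancel_left' diff_self)
  then show ?thesis
    by (rule module_hom.eq_0_on_span[OF clinear_free_extend[unfolded linear_iff_module_hom] _ assms(2)])
qed

text \<open>The linear map \<open>x \<otimes> y \<mapsto> h x y\<close> induced by a bilinear \<open>h\<close>
  (the value does not depend on the representative, as \<open>tensor_lift_prod\<close> and
  \<open>clinear_tensor_lift\<close> confirm).\<close>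

definition tensor_lift :: "('a::complex_vector \<Rightarrow> 'b::complex_vector \<Rightarrow> 'c::complex_vector) \<Rightarrow>
    ('a, 'b) tensor \<Rightarrow> 'c"
  where "tensor_lift h u = free_extend (case_prod h) (rep_tensor u)"

lemma tensor_lift_abs:
  assumes "cbilinear h"
  shows "tensor_lift h (abs_tensor p) = free_extend (case_prod h) p"
proof -
  have "rep_tensor (abs_tensor p) - p \<in> cvs.span bilinear_relations"
    using Quotient_rep_abs[OF Quotient_tensor, of p] by (simp add: cvs.span_zero)
  then have "free_extend (case_prod h) (rep_tensor (abs_tensor p) - p) = 0"
    by (rule free_extend_relations[OF assms])
  then show ?thesis
    by (simp add: tensor_lift_def
        module_hom.diff[OF clinear_free_extend[unfolded linear_iff_module_hom]])
qed

lemma clinear_tensor_lift: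
  fixes h :: "'a::complex_vector \<Rightarrow> 'b::complex_vector \<Rightarrow> 'c::complex_vector"
  assumes "cbilinear h"
  shows "clinear (tensor_lift h)"
proof (rule clinearI)
  fix u v :: "('a, 'b) tensor" and c :: complex
  obtain p q where "u = abs_tensor p" "v = abs_tensor q"
    using Quotient_abs_rep[OF Quotient_tensor] by metis
  then show "tensor_lift h (u + v) = tensor_lift h u + tensor_lift h v"
    and "tensor_lift h (c *\<^sub>C u) = c *\<^sub>C tensor_lift h u"
    by (simp_all add: plus_tensor.abs_eq scaleC_tensor.abs_eq tensor_lift_abs[OF assms]
        clinear_add[OF clinear_free_extend] clinear_scaleC[OF clinear_free_extend])
qed

lemma tensor_lift_prod: "cbilinear h \<Longrightarrow> tensor_lift h (x \<otimes> y) = h x y"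
  by (simp add: tensor_prod.abs_eq tensor_lift_abs free_extend_single)

definition tensor_map :: "('a::complex_vector \<Rightarrow> 'c::complex_vector) \<Rightarrow>
    ('b::complex_vector \<Rightarrow> 'd::complex_vector) \<Rightarrow> ('a, 'b) tensor \<Rightarrow> ('c, 'd) tensor"
  where "tensor_map f g = tensor_lift (\<lambda>x y. f x \<otimes> g y)"


section \<open>Completions for reasonable uniform cross-norms\<close>

definition is_norm :: "('a::complex_vector \<Rightarrow> real) \<Rightarrow> bool"
  where "is_norm \<nu> \<longleftrightarrow> (\<forall>u. \<nu> u = 0 \<longleftrightarrow> u = 0) \<and> (\<forall>u v. \<nu> (u + v) \<le> \<nu> u + \<nu> v) \<and>
    (\<forall>c u. \<nu> (c *\<^sub>C u) = cmod c * \<nu> u)"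

definition cross_norm ::
    "(('x::complex_normed_vector, 'y::complex_normed_vector) tensor \<Rightarrow> real) \<Rightarrow> bool"
  where "cross_norm \<nu> \<longleftrightarrow> is_norm \<nu> \<and> (\<forall>x y. \<nu> (x \<otimes> y) = norm x * norm y)"

text \<open>A cross-norm is reasonable if \<open>f \<otimes> g\<close> is bounded with norm at most \<open>\<parallel>f\<parallel> \<parallel>g\<parallel>\<close> for all bounded
  functionals \<open>f\<close> and \<open>g\<close>, and uniform if the same holds for bounded operators.\<close>

definition reasonable_uniform_cross_norm ::
    "(('x::complex_normed_vector, 'y::complex_normed_vector) tensor \<Rightarrow> real) \<Rightarrow> bool"
  where "reasonable_uniform_cross_norm \<nu> \<longleftrightarrow> cross_norm \<nu> \<and>
    (\<forall>(f :: 'x \<Rightarrow>\<^sub>B complex) (g :: 'y \<Rightarrow>\<^sub>B complex) u.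
       cmod (tensor_lift (\<lambda>x y. capply f x * capply g y) u) \<le> norm f * norm g * \<nu> u) \<and>
    (\<forall>(A :: 'x \<Rightarrow>\<^sub>B 'x) (B :: 'y \<Rightarrow>\<^sub>B 'y) u.
       \<nu> (tensor_map (capply A) (capply B) u) \<le> norm A * norm B * \<nu> u)"

text \<open>As the completion depends on the norm \<open>\<nu>\<close>, it cannot be a type constructor. It is represented
  by an arbitrary complex Banach space together with an isometric embedding \<open>J\<close> of the
  algebraic tensor product onto a dense subspace.\<close>

definition is_completion :: "('v::complex_vector \<Rightarrow> real) \<Rightarrow> ('v \<Rightarrow> 'z::complex_banach) \<Rightarrow> bool"
  where "is_completion \<nu> J \<longleftrightarrow> clinear J \<and> (\<forall>u. norm (J u) = \<nu> u) \<and> closure (range J) = UNIV"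

definition tensor_op :: "(('x::complex_normed_vector, 'y::complex_normed_vector) tensor \<Rightarrow> 'z::complex_banach) \<Rightarrow>
    ('x \<Rightarrow>\<^sub>B 'x) \<Rightarrow> ('y \<Rightarrow>\<^sub>B 'y) \<Rightarrow> 'z \<Rightarrow>\<^sub>B 'z"
  where "tensor_op J A B = (THE T. \<forall>u. capply T (J u) = J (tensor_map (capply A) (capply B) u))"

lemma dense_agree:
  fixes f g :: "'a::topological_space \<Rightarrow> 'b::t2_space"
  assumes "continuous_on UNIV f" "continuous_on UNIV g" "closure S = UNIV" "\<And>x. x \<in> S \<Longrightarrow> f x = g x"
  shows "f x = g x"
proof -
  have "closed {x. f x = g x}" by (rule closed_Collect_eq[OF assms(1,2)])
  then have "closure S \<subseteq> {x. f x = g x}" using assms(4) by (intro closure_minimal) auto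
  then show ?thesis using assms(3) by auto
qed

lemma cbilinear_map:
  fixes f :: "'a::complex_vector \<Rightarrow> 'c::complex_vector" and g :: "'b::complex_vector \<Rightarrow> 'd::complex_vector"
  assumes "clinear f" "clinear g"
  shows "cbilinear (\<lambda>x y. f x \<otimes> g y)"
proof -
  have 1: "clinear (\<lambda>x. x \<otimes> y)" "clinear ((\<otimes>) x)" for x :: 'c and y :: 'd
    using cbilinear_tensor_prod by (auto simp: cbilinear_def)
  show ?thesis
    unfolding cbilinear_def
    by (intro conjI allI clinearI)
      (simp_all add: clinear_add[OF assms(1)] clinear_add[OF assms(2)]
        clinear_scaleC[OF assms(1)] clinear_scaleC[OF assms(2)]
        clinear_add[OF 1(1)] clinear_add[OF 1(2)] clinear_scaleC[OF 1(1)] clinear_scaleC[OF 1(2)])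
qed

lemma tensor_op_unique_exists:
  fixes J :: "('x::complex_normed_vector, 'y::complex_normed_vector) tensor \<Rightarrow> 'z::complex_banach"
  assumes \<nu>: "reasonable_uniform_cross_norm \<nu>" and J: "is_completion \<nu> J"
  shows "\<exists>!T. \<forall>u. capply T (J u) = J (tensor_map (capply A) (capply B) u)"
proof -
  have J_lin: "clinear J" and J_norm: "\<And>u. norm (J u) = \<nu> u" and J_dense: "closure (range J) = UNIV"
    using J by (auto simp: is_completion_def)
  note J_diff = module_hom.diff[OF J_lin[unfolded linear_iff_module_hom]]
  let ?M = "tensor_map (capply A) (capply B)"
  have M_lin: "clinear ?M"
    unfolding tensor_map_def
    by (intro clinear_tensor_lift cbilinear_map clinear_capply)
  have M_norm: "\<nu> (?M u) \<le> norm A * norm B * \<nu> u" for u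
    using \<nu> by (auto simp: reasonable_uniform_cross_norm_def)
  have J_inj: "u = v" if "J u = J v" for u v
  proof -
    have "\<nu> (u - v) = 0" using that J_norm[of "u - v"] by (simp add: J_diff)
    then have "u - v = 0" using \<nu>
      by (simp add: reasonable_uniform_cross_norm_def cross_norm_def is_norm_def)
    then show ?thesis by simp
  qed
  have inv: "inv J (J u) = u" for u
    using J_inj by (simp add: inj_on_def)
  define f where "f z = J (?M (inv J z))" for z
  have f_J: "f (J u) = J (?M u)" for u by (simp add: f_def inv)
  define K where "K = norm A * norm B"
  have f_norm: "norm (f (J u)) \<le> K * norm (J u)" for u
    by (simp add: f_J J_norm M_norm K_def)
  have f_diff: "f (J u) - f (J v) = f (J (u - v))" for u v
    unfolding f_J by (simp add: J_diff module_hom.diff[OF M_lin[unfolded linear_iff_module_hom]])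
  have "K-lipschitz_on (range J) f"
  proof (rule lipschitz_onI)
    fix z w assume "z \<in> range J" "w \<in> range J"
    then show "dist (f z) (f w) \<le> K * dist z w"
      using f_norm by (auto simp: dist_norm f_diff simp flip: J_diff)
  qed (simp add: K_def)
  then have "uniformly_continuous_on (range J) f"
    by (rule lipschitz_on_uniformly_continuous)
  then obtain g where g: "uniformly_continuous_on (closure (range J)) g"
    and g_eq: "\<And>z. z \<in> range J \<Longrightarrow> f z = g z"
    by (rule uniformly_continuous_on_extension_on_closure) blast
  have g_cont: "continuous_on UNIV g"
    using uniformly_continuous_imp_continuous[OF g] by (simp add: J_dense)
  have g_J: "g (J u) = J (?M u)" for u
    using g_eq[of "J u"] by (simp add: f_J)
  have "g (fst p + snd p) = g (fst p) + g (snd p)" for p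
  proof (rule dense_agree[where S = "range J \<times> range J"])
    show "continuous_on UNIV (\<lambda>p. g (fst p + snd p))"
      by (intro continuous_on_compose2[OF g_cont] continuous_intros) simp
    show "continuous_on UNIV (\<lambda>p. g (fst p) + g (snd p))"
      by (intro continuous_on_add continuous_on_compose2[OF g_cont] continuous_intros) simp_all
    show "closure (range J \<times> range J) = UNIV" by (simp add: closure_Times J_dense)
  qed (auto simp: g_J clinear_add[OF M_lin] clinear_add[OF J_lin] simp flip: clinear_add[OF J_lin])
  then have g_add: "g (z + w) = g z + g w" for z w
    by (metis fst_conv snd_conv)
  have scale_cont: "continuous_on UNIV (\<lambda>z::'z. c *\<^sub>C z)" for c
    by (auto simp: continuous_on_def intro!: tendsto_scaleC)
  have g_scale: "g (c *\<^sub>C z) = c *\<^sub>C g z" for c z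
  proof (rule dense_agree[where S = "range J" and f = "\<lambda>z. g (c *\<^sub>C z)"])
    show "continuous_on UNIV (\<lambda>z. g (c *\<^sub>C z))" "continuous_on UNIV (\<lambda>z. c *\<^sub>C g z)"
      using continuous_on_compose2[OF g_cont scale_cont] continuous_on_compose2[OF scale_cont g_cont]
      by auto
  qed (auto simp: J_dense g_J clinear_scaleC[OF M_lin] clinear_scaleC[OF J_lin]
      simp flip: clinear_scaleC[OF J_lin])
  have g_norm: "norm (g z) \<le> K * norm z" for z
  proof -
    have "closed {z. norm (g z) \<le> K * norm z}"
      by (intro closed_Collect_le continuous_intros g_cont)
    then have "closure (range J) \<subseteq> {z. norm (g z) \<le> K * norm z}"
      by (intro closure_minimal) (auto simp: g_J J_norm M_norm K_def)
    then show ?thesis by (auto simp: J_dense)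
  qed
  have "capply (CBlinfun (Blinfun g)) = g"
    by (rule capply_CBlinfun_Blinfun[OF clinearI g_norm]) (simp_all add: g_add g_scale)
  then have "\<forall>u. capply (CBlinfun (Blinfun g)) (J u) = J (?M u)"
    by (simp add: g_J)
  moreover have "S = T"
    if "\<forall>u. capply S (J u) = J (?M u)" "\<forall>u. capply T (J u) = J (?M u)" for S T
  proof (rule capply_eqI)
    fix z
    have cont: "continuous_on UNIV (capply R)" for R :: "'z \<Rightarrow>\<^sub>B 'z"
      by (simp add: bounded_linear_capply linear_continuous_on)
    show "capply S z = capply T z"
      by (rule dense_agree[OF cont cont J_dense]) (use that in auto)
  qed
  ultimately show ?thesis by blast
qed

lemma tensor_op_apply:
  assumes "reasonable_uniform_cross_norm \<nu>" "is_completion \<nu> J"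
  shows "capply (tensor_op J A B) (J (x \<otimes> y)) = J (capply A x \<otimes> capply B y)"
proof -
  have "\<forall>u. capply (tensor_op J A B) (J u) = J (tensor_map (capply A) (capply B) u)"
    unfolding tensor_op_def by (rule theI'[OF tensor_op_unique_exists[OF assms]])
  then show ?thesis
    by (simp add: tensor_map_def tensor_lift_prod cbilinear_map clinear_capply)
qed

end

theory Submission
  imports Defs "HOL-Complex_Analysis.Complex_Analysis"
begin

text \<open>
  Call \<open>d\<close> a Drazin inverse of \<open>x\<close> if it commutes with \<open>x\<close>, \<open>d x d = d\<close>, and \<open>x ^ n (1 - x d)\<close>
  vanishes for large \<open>n\<close>; it is a generalised Drazin inverse if the latter only decays faster than every
  geometric sequence. For a singular \<open>T\<close>, \<open>0\<close> is a pole iff \<open>T\<close> has a Drazin inverse (by the open mapping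
  theorem), and an isolated point of the spectrum iff \<open>T\<close> has a generalised one (by the Riesz projection).
  If \<open>d\<close> and \<open>f\<close> are (generalised) Drazin inverses of \<open>A\<close> and \<open>B\<close>, then \<open>d \<otimes> f\<close> is one of
  \<open>x = A \<otimes> B\<close>, because
  \<open>1 - x (d \<otimes> f) = (1 - A d) \<otimes> 1 + A d \<otimes> (1 - B f)\<close>.
  Multiplying \<open>x ^ n (1 - x (d \<otimes> f))\<close> by \<open>(1 - A d) \<otimes> 1\<close> gives \<open>A ^ n (1 - A d) \<otimes> B ^ n\<close>, so it can only
  vanish if \<open>0\<close> is at most a pole of \<open>A\<close> or \<open>B\<close> is nilpotent. The same computation applies to \<open>\<tau>\<close>, whose
  nondegeneracy \<open>\<tau> = 0 \<Longrightarrow> A = 0 \<or> B = 0\<close> comes from the Hahn--Banach theorem.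
\<close>

section \<open>Functional analysis\<close>

subsection \<open>The Hahn--Banach theorem\<close>

text \<open>Null spaces and ranges of powers are awkward on a completion or on a space of operators,
  whereas the equations and norm estimates for an inverse pass through any bounded bilinear map that
  respects commuting products. This is why poles and isolated points are first turned into
  statements about inverses, and why both operators can be values of one abstract map
  \<open>\<Theta>\<close>. To show that \<open>0\<close> is not a pole, every Drazin inverse of the
  product must be excluded, although only \<open>\<Theta> d f\<close> is known explicitly. The
  bridge is \<open>gdrazin_drazin\<close>: if any Drazin inverse exists, then the given generalised
  one is already a Drazin inverse. In the first two claims the spectrum of the second factor near
  \<open>0\<close> is arbitrary, so no \<open>f\<close> is available. There the quasinilpotent
  factor has inverse \<open>0\<close>, and \<open>0\<close> also serves for the product: powers of
  the other factor grow at most geometrically, and decay faster than every geometric sequence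
  absorbs this.\<close>

definition sublinear :: "('a::real_vector \<Rightarrow> real) \<Rightarrow> bool"
  where "sublinear p \<longleftrightarrow> (\<forall>x y. p (x + y) \<le> p x + p y) \<and> (\<forall>c x. 0 \<le> c \<longrightarrow> p (c *\<^sub>R x) = c * p x)"

lemma sublinear_add: "sublinear p \<Longrightarrow> p (x + y) \<le> p x + p y"
  and sublinear_scale: "sublinear p \<Longrightarrow> 0 \<le> c \<Longrightarrow> p (c *\<^sub>R x) = c * p x"
  by (auto simp: sublinear_def)

lemma sublinear_zero: "sublinear p \<Longrightarrow> p 0 = 0"
  using sublinear_scale[of p 0 0] by simp

lemma sublinear_minus: "sublinear p \<Longrightarrow> - p (- x) \<le> p x"
  using sublinear_add[of p x "- x"] sublinear_zero[of p] by simp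

lemma sublinear_norm: "sublinear (norm :: 'a::real_normed_vector \<Rightarrow> real)"
  by (simp add: sublinear_def norm_triangle_ineq)

text \<open>\<open>t = 0\<close> places it below \<open>p\<close>, and \<open>t = 1\<close> makes
  its value at \<open>- y\<close> at most \<open>- p y\<close>. A linear functional below it
  therefore attains \<open>p y\<close> at \<open>y\<close>.\<close>

definition sublinear_shift :: "('a::real_vector \<Rightarrow> real) \<Rightarrow> 'a \<Rightarrow> 'a \<Rightarrow> real"
  where "sublinear_shift p y x = (INF t\<in>{0..}. p (x + t *\<^sub>R y) - t * p y)"

text \<open>The infimum is meaningful because
  \<open>t * p y = p (t y) \<le> p (x + t y) + p (- x)\<close>.\<close>

lemma sublinear_shift_bdd:
  assumes "sublinear p"
  shows "bdd_below ((\<lambda>t. p (x + t *\<^sub>R y) - t * p y) ` {0..})"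
proof (rule bdd_belowI2)
  fix t :: real assume "t \<in> {0..}"
  then show "- p (- x) \<le> p (x + t *\<^sub>R y) - t * p y"
    using sublinear_add[OF assms, of "x + t *\<^sub>R y" "- x"] sublinear_scale[OF assms, of t y] by simp
qed

lemma sublinear_shift_le:
  assumes "sublinear p" "0 \<le> t"
  shows "sublinear_shift p y x \<le> p (x + t *\<^sub>R y) - t * p y"
  unfolding sublinear_shift_def
  by (rule cINF_lower[OF sublinear_shift_bdd[OF assms(1)]]) (use assms in auto)

lemma sublinear_shift_ge:
  assumes "\<And>t. 0 \<le> t \<Longrightarrow> m \<le> p (x + t *\<^sub>R y) - t * p y"
  shows "m \<le> sublinear_shift p y x"
  unfolding sublinear_shift_def by (rule cINF_greatest) (use assms in auto)

lemma sublinear_sublinear_shift: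
  assumes p: "sublinear p"
  shows "sublinear (sublinear_shift p y)"
  unfolding sublinear_def
proof (intro conjI allI impI)
  fix x1 x2
  \<comment> \<open>Parameters \<open>s\<close> and \<open>t\<close> for the two summands give the
    parameter \<open>s + t\<close> for the sum; the infimum is then taken over \<open>s\<close> and
    \<open>t\<close> one after the other.\<close>
  have le: "sublinear_shift p y (x1 + x2) - (p (x2 + t *\<^sub>R y) - t * p y)
      \<le> p (x1 + s *\<^sub>R y) - s * p y" if "0 \<le> s" "0 \<le> t" for s t
  proof -
    have "sublinear_shift p y (x1 + x2) \<le> p ((x1 + x2) + (s + t) *\<^sub>R y) - (s + t) * p y"
      using p that by (intro sublinear_shift_le) auto
    also have "(x1 + x2) + (s + t) *\<^sub>R y = (x1 + s *\<^sub>R y) + (x2 + t *\<^sub>R y)"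
      by (simp add: algebra_simps)
    also have "p \<dots> \<le> p (x1 + s *\<^sub>R y) + p (x2 + t *\<^sub>R y)"
      by (rule sublinear_add[OF p])
    finally show ?thesis by (simp add: algebra_simps)
  qed
  have "sublinear_shift p y (x1 + x2) - sublinear_shift p y x1 \<le> p (x2 + t *\<^sub>R y) - t * p y"
    if "0 \<le> t" for t
    using sublinear_shift_ge[where x=x1, OF le[OF _ that]] by linarith
  then show "sublinear_shift p y (x1 + x2) \<le> sublinear_shift p y x1 + sublinear_shift p y x2"
    using sublinear_shift_ge[where x=x2 and p=p and y=y] by (metis add.commute diff_le_eq)
next
  fix c :: real and x assume "0 \<le> c"
  \<comment> \<open>Substitution of \<open>c * t\<close> for the parameter. The opposite inequality
    is this one for \<open>inverse c\<close>.\<close>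
  have le: "sublinear_shift p y (c *\<^sub>R x) \<le> c * sublinear_shift p y x" if "0 < c" for c x
  proof -
    have "inverse c * sublinear_shift p y (c *\<^sub>R x) \<le> p (x + t *\<^sub>R y) - t * p y" if "0 \<le> t" for t
    proof -
      have "sublinear_shift p y (c *\<^sub>R x) \<le> p (c *\<^sub>R x + (c * t) *\<^sub>R y) - (c * t) * p y"
        using p that \<open>0 < c\<close> by (intro sublinear_shift_le) auto
      also have "c *\<^sub>R x + (c * t) *\<^sub>R y = c *\<^sub>R (x + t *\<^sub>R y)"
        by (simp add: algebra_simps)
      also have "p \<dots> = c * p (x + t *\<^sub>R y)"
        using p \<open>0 < c\<close> by (simp add: sublinear_scale)
      finally show ?thesis using \<open>0 < c\<close> by (simp add: field_simps)
    qed
    then have "inverse c * sublinear_shift p y (c *\<^sub>R x) \<le> sublinear_shift p y x"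
      by (rule sublinear_shift_ge)
    then show ?thesis using that by (simp add: field_simps)
  qed
  show "sublinear_shift p y (c *\<^sub>R x) = c * sublinear_shift p y x"
  proof (cases "c = 0")
    case True
    have "0 \<le> sublinear_shift p y 0"
      by (rule sublinear_shift_ge) (simp add: sublinear_scale[OF p])
    moreover have "sublinear_shift p y 0 \<le> 0"
      using sublinear_shift_le[OF p, of 0 y 0] by (simp add: sublinear_zero[OF p])
    ultimately show ?thesis using True by simp
  next
    case False
    then have "0 < c" using \<open>0 \<le> c\<close> by simp
    moreover have "c * sublinear_shift p y x \<le> sublinear_shift p y (c *\<^sub>R x)"
      using le[of "inverse c" "c *\<^sub>R x"] \<open>0 < c\<close> by (simp add: field_simps)
    ultimately show ?thesis using le by (simp add: antisym)
  qed
qed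

text \<open>Zorn's lemma for the reversed pointwise order. A nonempty chain is bounded by its
  pointwise infimum, which is finite since
  \<open>q x \<ge> - q (- x) \<ge> - p (- x)\<close>.\<close>

lemma minimal_sublinear:
  fixes p :: "'a::real_vector \<Rightarrow> real"
  assumes p: "sublinear p"
  obtains q where "sublinear q" "\<And>x. q x \<le> p x"
    "\<And>r. sublinear r \<Longrightarrow> (\<And>x. r x \<le> q x) \<Longrightarrow> r = q"
proof -
  let ?A = "{q. sublinear q \<and> (\<forall>x. q x \<le> p x)}"
  let ?P = "\<lambda>q r :: 'a \<Rightarrow> real. \<forall>x. r x \<le> q x"
  have "\<exists>m\<in>?A. \<forall>a\<in>?A. ?P m a \<longrightarrow> a = m"
  proof (rule predicate_Zorn)
    show "partial_order_on ?A (relation_of ?P ?A)"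
    proof (rule partial_order_on_relation_ofI)
      fix a b c :: "'a \<Rightarrow> real"
      show "\<forall>x. c x \<le> a x" if "\<forall>x. b x \<le> a x" "\<forall>x. c x \<le> b x"
        using that by (blast intro: order_trans)
      show "a = b" if "\<forall>x. b x \<le> a x" "\<forall>x. a x \<le> b x"
        using that by (intro ext antisym) auto
    qed simp
  next
    fix C assume C: "C \<in> Chains (relation_of ?P ?A)"
    show "\<exists>u\<in>?A. \<forall>a\<in>C. ?P a u"
    proof (cases "C = {}")
      case True
      then show ?thesis using p by auto
    next
      case False
      have CA: "q \<in> ?A" if "q \<in> C" for q
        using C that by (auto simp: Chains_def relation_of_def)
      have total: "?P q r \<or> ?P r q" if "q \<in> C" "r \<in> C" for q r
        using C that by (auto simp: Chains_def relation_of_def)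
      define u where "u x = (INF q\<in>C. q x)" for x
      have bdd: "bdd_below ((\<lambda>q. q x) ` C)" for x
      proof (rule bdd_belowI2)
        fix q assume "q \<in> C"
        then have "- q (- x) \<le> q x" "q (- x) \<le> p (- x)"
          using CA sublinear_minus by auto
        then show "- p (- x) \<le> q x" by linarith
      qed
      have u_le: "u x \<le> q x" if "q \<in> C" for q x
        unfolding u_def by (rule cINF_lower[OF bdd that])
      have u_ge: "m \<le> u x" if "\<And>q. q \<in> C \<Longrightarrow> m \<le> q x" for m x
        unfolding u_def by (rule cINF_greatest[OF False that])
      \<comment> \<open>The smaller of \<open>q\<close> and \<open>r\<close> lies below both, so its
        own subadditivity suffices.\<close>
      have sub: "u (x + y) \<le> q x + r y" if qr: "q \<in> C" "r \<in> C" for q r x y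
      proof -
        obtain s where "s \<in> C" "?P q s" "?P r s" using total[OF qr] qr by blast
        then have "u (x + y) \<le> s x + s y"
          using u_le CA sublinear_add by (metis (mono_tags, lifting) mem_Collect_eq order_trans)
        also have "\<dots> \<le> q x + r y" using \<open>?P q s\<close> \<open>?P r s\<close> by (simp add: add_mono)
        finally show ?thesis .
      qed
      have "u (x + y) \<le> u x + u y" for x y
      proof -
        have "u (x + y) - r y \<le> u x" if "r \<in> C" for r
          by (rule u_ge) (use sub[OF _ that] in \<open>simp add: diff_le_eq\<close>)
        then have "u (x + y) - u x \<le> u y"
          by (intro u_ge) (simp add: algebra_simps)
        then show ?thesis by linarith
      qed
      moreover have "u (c *\<^sub>R x) = c * u x" if "0 \<le> c" for c x
      proof (rule antisym)
        have eq: "q (c *\<^sub>R x) = c * q x" if "q \<in> C" for q x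
          using CA[OF that] \<open>0 \<le> c\<close> by (simp add: sublinear_scale)
        show "c * u x \<le> u (c *\<^sub>R x)"
          by (rule u_ge) (simp add: eq u_le mult_left_mono[OF _ \<open>0 \<le> c\<close>])
        show "u (c *\<^sub>R x) \<le> c * u x"
        proof (cases "c = 0")
          case True
          obtain q where "q \<in> C" using \<open>C \<noteq> {}\<close> by blast
          then show ?thesis using u_le[of q 0] eq[of q 0] True by simp
        next
          case False
          then have c: "0 < c" using \<open>0 \<le> c\<close> by simp
          have "u (c *\<^sub>R x) / c \<le> u x"
            by (rule u_ge) (use u_le[of _ "c *\<^sub>R x"] eq[of _ x] c in \<open>simp add: field_simps\<close>)
          then show ?thesis using c by (simp add: field_simps)
        qed
      qed
      ultimately have "sublinear u" by (auto simp: sublinear_def)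
      moreover obtain q where "q \<in> C" using False by blast
      then have "u x \<le> p x" for x
        using u_le[of q x] CA[of q] by (auto intro: order_trans)
      ultimately show ?thesis using u_le by blast
    qed
  qed
  then obtain q where q: "q \<in> ?A" and min: "\<And>r. r \<in> ?A \<Longrightarrow> ?P q r \<Longrightarrow> r = q" by blast
  show thesis
  proof (rule that[of q])
    fix r assume r: "sublinear r" and le: "\<And>x. r x \<le> q x"
    have "r x \<le> p x" for x using le[of x] q by (auto intro: order_trans[of "r x" "q x"])
    then show "r = q" using r le by (intro min) auto
  qed (use q in auto)
qed

text \<open>A minimal sublinear functional below \<open>p\<close> coincides with all its shifts, which makes it
  superadditive and hence linear; no extension of partially defined functionals is needed.\<close>

lemma linear_below_sublinear:
  fixes p :: "'a::real_vector \<Rightarrow> real"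
  assumes p: "sublinear p"
  obtains g where "linear g" "\<And>x. g x \<le> p x"
proof -
  obtain q where q: "sublinear q" and le: "\<And>x. q x \<le> p x"
    and min: "\<And>r. sublinear r \<Longrightarrow> (\<And>x. r x \<le> q x) \<Longrightarrow> r = q"
    using minimal_sublinear[OF p] by metis
  have "sublinear_shift q y = q" for y
    by (rule min[OF sublinear_sublinear_shift[OF q]]) (use sublinear_shift_le[OF q, of 0] in simp)
  then have "q x \<le> q (x + y) - q y" for x y
    using sublinear_shift_le[OF q, of 1 y x] by simp
  then have add: "q (x + y) = q x + q y" for x y
    using sublinear_add[OF q, of x y] by (smt (verit))
  have neg: "q (- x) = - q x" for x
    using add[of x "- x"] sublinear_zero[OF q] by simp
  have "q (c *\<^sub>R x) = c * q x" for c x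
    using sublinear_scale[OF q, of c x] sublinear_scale[OF q, of "- c" x] neg[of "c *\<^sub>R x"]
    by (cases "0 \<le> c") auto
  then have "linear q" by (intro linearI) (auto simp: add)
  then show thesis using that le by blast
qed

text \<open>Every linear functional below the shift of the norm along \<open>x\<close> is norming at
  \<open>x\<close>, so no functional on the line through \<open>x\<close> has to be
  extended.\<close>

lemma hahn_banach_real:
  fixes x :: "'a::real_normed_vector"
  obtains g where "linear g" "\<And>z. \<bar>g z\<bar> \<le> norm z" "g x = norm x"
proof -
  let ?p = "sublinear_shift norm x"
  obtain g where g: "linear g" and le: "\<And>z. g z \<le> ?p z"
    using linear_below_sublinear[OF sublinear_sublinear_shift[OF sublinear_norm]] by metis
  have le': "g z \<le> norm z" for z
    using le[of z] sublinear_shift_le[OF sublinear_norm, of 0 x z] by simp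
  have "g (- x) \<le> - norm x"
    using le[of "- x"] sublinear_shift_le[OF sublinear_norm, of 1 x "- x"] by simp
  then have "g x = norm x"
    using le'[of x] by (simp add: linear_neg[OF g])
  moreover have "\<bar>g z\<bar> \<le> norm z" for z
    using le'[of z] le'[of "- z"] by (simp add: linear_neg[OF g])
  ultimately show thesis using that g by blast
qed

lemma scaleR_scaleC_commute:
  fixes x :: "'a::complex_normed_vector"
  shows "c *\<^sub>C r *\<^sub>R x = r *\<^sub>R c *\<^sub>C x"
  by (simp add: scaleR_scaleC mult.commute)

lemma capply_diff: "capply T (x - y) = capply T x - capply T y"
  by (rule linear_diff[OF bounded_linear.linear[OF bounded_linear_capply]])

text \<open>Serves to separate points: for equality of vector-valued integrals in
  \<open>coef_indep\<close> and for nondegeneracy in \<open>cross_rep_mult_operator\<close>. Hence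
  the crude bound 2 on the norm is enough.\<close>

lemma hahn_banach:
  fixes x :: "'a::complex_normed_vector"
  assumes "x \<noteq> 0"
  obtains f :: "'a \<Rightarrow>\<^sub>B complex" where "capply f x \<noteq> 0"
proof -
  obtain g where g: "linear g" and le: "\<And>z. \<bar>g z\<bar> \<le> norm z" and gx: "g x = norm x"
    using hahn_banach_real by blast
  \<comment> \<open>The complex functional whose real part is \<open>g\<close>.\<close>
  define h where "h z = Complex (g z) (- g (\<i> *\<^sub>C z))" for z
  have gC: "g (c *\<^sub>C z) = Re c * g z + Im c * g (\<i> *\<^sub>C z)" for c z
  proof -
    have "c *\<^sub>C z = Re c *\<^sub>R z + Im c *\<^sub>R \<i> *\<^sub>C z"
      unfolding scaleR_scaleC scaleC_scaleC scaleC_add_left[symmetric]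
      by (subst complex_eq[of c]) (simp add: mult.commute)
    then show ?thesis by (simp add: linear_add[OF g] linear_scale[OF g])
  qed
  have "clinear h"
  proof (rule clinearI)
    fix c z
    show "h (c *\<^sub>C z) = c *\<^sub>C h z"
      using gC[of c z] gC[of "\<i> * c" z]
      by (simp add: h_def scaleC_complex_def complex_eq_iff)
  qed (simp add: h_def linear_add[OF g] scaleC_add_right complex_eq_iff)
  moreover have "norm (h z) \<le> 2 * norm z" for z
  proof -
    have "norm (h z) \<le> \<bar>Re (h z)\<bar> + \<bar>Im (h z)\<bar>" by (rule cmod_le)
    also have "\<dots> \<le> norm z + norm (\<i> *\<^sub>C z)"
      using le[of z] le[of "\<i> *\<^sub>C z"] by (simp add: h_def)
    finally show ?thesis by (simp add: norm_scaleC)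
  qed
  ultimately have "capply (CBlinfun (Blinfun h)) = h" by (rule capply_CBlinfun_Blinfun)
  moreover have "h x \<noteq> 0" using assms gx by (simp add: h_def complex_eq_iff)
  ultimately show thesis using that[of "CBlinfun (Blinfun h)"] by simp
qed

subsection \<open>The open mapping theorem\<close>

text \<open>Baire's theorem applied to the closures of the images of balls. The subspace
  \<open>E\<close> is carried along so that the result applies to a null space times the whole space
  without a subtype.\<close>

lemma almost_open:
  fixes f :: "'a::real_normed_vector \<Rightarrow> 'b::{real_normed_vector,complete_space}"
  assumes f: "bounded_linear f" and E: "subspace E" and surj: "f ` E = UNIV"
  obtains K where "0 \<le> K"
    "\<And>z \<epsilon>. 0 < \<epsilon> \<Longrightarrow> \<exists>e\<in>E. norm e \<le> K * norm z \<and> norm (z - f e) < \<epsilon>"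
proof -
  interpret f: bounded_linear f by (rule f)
  define V where "V k = closure (f ` (E \<inter> cball 0 (real k)))" for k :: nat
  have cover: "\<Union> (range V) = UNIV"
  proof -
    have "z \<in> \<Union> (range V)" for z
    proof -
      obtain e where e: "e \<in> E" "f e = z" using surj by (metis UNIV_I imageE)
      obtain k where "norm e \<le> real k" using real_arch_simple by blast
      then have "z \<in> V k" using e closure_subset unfolding V_def by fastforce
      then show ?thesis by blast
    qed
    then show ?thesis by blast
  qed
  have "\<exists>k. interior (V k) \<noteq> {}"
  proof (rule ccontr)
    assume "\<nexists>k. interior (V k) \<noteq> {}"
    then have "(euclidean :: 'b topology) interior_of \<Union> (range V) = {}"
      by (intro Baire_category_alt) (auto simp: V_def completely_metrizable_space_euclidean)
    then show False by (simp add: cover)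
  qed
  then obtain k y where "y \<in> interior (V k)" by blast
  then obtain \<delta> where \<delta>: "0 < \<delta>" "ball y \<delta> \<subseteq> V k"
    by (meson mem_interior)
  have approx: "\<exists>e\<in>E. norm e \<le> 2 * real k \<and> norm (z - f e) < \<epsilon>" if z: "norm z < \<delta>" and \<epsilon>: "0 < \<epsilon>" for z \<epsilon>
  proof -
    have close: "\<exists>e\<in>E. norm e \<le> real k \<and> norm (f e - w) < \<epsilon> / 2" if "w \<in> V k" for w
      using that \<epsilon> unfolding V_def closure_approachable
      by (fastforce simp: dist_norm dest: spec[of _ "\<epsilon> / 2"])
    \<comment> \<open>The ball is centred at \<open>y\<close>, not at \<open>0\<close>; subtracting
      approximate preimages of \<open>y + z\<close> and \<open>y\<close> recentres it and doubles
      the radius.\<close>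
    have "y + z \<in> V k" "y \<in> V k" using \<delta> z by (auto simp: dist_norm subset_eq)
    then obtain e1 e2 where e: "e1 \<in> E" "norm e1 \<le> real k" "norm (f e1 - (y + z)) < \<epsilon> / 2"
      "e2 \<in> E" "norm e2 \<le> real k" "norm (f e2 - y) < \<epsilon> / 2"
      using close by metis
    have "norm (e1 - e2) \<le> 2 * real k" using norm_triangle_ineq4[of e1 e2] e by linarith
    moreover have "norm (z - f (e1 - e2)) < \<epsilon>"
    proof -
      have "z - f (e1 - e2) = (f e2 - y) - (f e1 - (y + z))" by (simp add: f.diff)
      then have "norm (z - f (e1 - e2)) \<le> norm (f e2 - y) + norm (f e1 - (y + z))"
        using norm_triangle_ineq4[of "f e2 - y" "f e1 - (y + z)"] by metis
      then show ?thesis using e by linarith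
    qed
    ultimately show ?thesis using subspace_diff[OF E e(1) e(4)] by blast
  qed
  \<comment> \<open>Scaling \<open>z\<close> to norm \<open>\<delta> / 2\<close> and back multiplies
    the bound \<open>2 * k\<close> by \<open>2 * norm z / \<delta>\<close>.\<close>
  define K where "K = 4 * real k / \<delta>"
  have "\<exists>e\<in>E. norm e \<le> K * norm z \<and> norm (z - f e) < \<epsilon>" if \<epsilon>: "0 < \<epsilon>" for z \<epsilon>
  proof (cases "z = 0")
    case True
    then show ?thesis using \<epsilon> subspace_0[OF E] by (intro bexI[of _ 0]) (auto simp: f.zero)
  next
    case False
    define s where "s = \<delta> / (2 * norm z)"
    have s: "0 < s" using False \<delta>(1) by (simp add: s_def)
    have "norm (s *\<^sub>R z) < \<delta>" using False \<delta>(1) by (simp add: s_def)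
    then obtain e where e: "e \<in> E" "norm e \<le> 2 * real k" "norm (s *\<^sub>R z - f e) < s * \<epsilon>"
      using approx[of "s *\<^sub>R z" "s * \<epsilon>"] s \<epsilon> by auto
    have "norm (inverse s *\<^sub>R e) \<le> inverse s * (2 * real k)"
      using e(2) s by simp
    also have "\<dots> = K * norm z" using False \<delta>(1) by (simp add: s_def K_def field_simps)
    finally have "norm (inverse s *\<^sub>R e) \<le> K * norm z" .
    moreover have "norm (z - f (inverse s *\<^sub>R e)) < \<epsilon>"
    proof -
      have "z - f (inverse s *\<^sub>R e) = inverse s *\<^sub>R (s *\<^sub>R z - f e)"
        using s by (simp add: f.scaleR algebra_simps)
      then have "norm (z - f (inverse s *\<^sub>R e)) = norm (inverse s *\<^sub>R (s *\<^sub>R z - f e))" by (rule arg_cong)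
      also have "\<dots> = inverse s * norm (s *\<^sub>R z - f e)" using s by simp
      also have "\<dots> < inverse s * (s * \<epsilon>)" using e(3) s by (intro mult_strict_left_mono) auto
      also have "inverse s * (s * \<epsilon>) = \<epsilon>" using s by simp
      finally show ?thesis .
    qed
    ultimately show ?thesis using subspace_scale[OF E e(1)] by blast
  qed
  moreover have "0 \<le> K" using \<delta>(1) by (simp add: K_def)
  ultimately show thesis by (rule that[rotated])
qed

text \<open>Approximate preimages are corrected repeatedly, each time halving the error, and
  closedness of \<open>E\<close> keeps the sum of the corrections in \<open>E\<close>. The
  conclusion is phrased as a bounded choice of preimages, the form from which boundedness of an
  inverse is read off.\<close>

lemma open_mapping:
  fixes f :: "'a::banach \<Rightarrow> 'b::{real_normed_vector,complete_space}"
  assumes f: "bounded_linear f" and E: "subspace E" "closed E" and surj: "f ` E = UNIV"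
  obtains C where "0 \<le> C" "\<And>z. \<exists>e\<in>E. f e = z \<and> norm e \<le> C * norm z"
proof -
  interpret f: bounded_linear f by (rule f)
  obtain K where K: "0 \<le> K" "\<And>z \<epsilon>. 0 < \<epsilon> \<Longrightarrow> \<exists>e\<in>E. norm e \<le> K * norm z \<and> norm (z - f e) < \<epsilon>"
    using almost_open[OF f E(1) surj] by blast
  have "\<exists>e\<in>E. norm e \<le> K * norm z \<and> norm (z - f e) \<le> norm z / 2" for z
  proof (cases "z = 0")
    case True
    then show ?thesis using subspace_0[OF E(1)] by (intro bexI[of _ 0]) (auto simp: f.zero)
  next
    case False
    then show ?thesis using K(2)[of "norm z / 2" z] by (auto intro: less_imp_le)
  qed
  then obtain h where h: "\<And>z. h z \<in> E" "\<And>z. norm (h z) \<le> K * norm z"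
    "\<And>z. norm (z - f (h z)) \<le> norm z / 2" by metis
  have "\<exists>e\<in>E. f e = z \<and> norm e \<le> (2 * K) * norm z" for z
  proof -
    \<comment> \<open>The error left after \<open>n\<close> corrections. The images of the
      corrections are differences of consecutive errors and telescope to \<open>z\<close>; their
      norms sum to at most \<open>2 * K * norm z\<close>.\<close>
    define w where "w n = ((\<lambda>z. z - f (h z)) ^^ n) z" for n
    have w_Suc: "w (Suc n) = w n - f (h (w n))" for n by (simp add: w_def)
    have w_norm: "norm (w n) \<le> norm z * (1 / 2) ^ n" for n
    proof (induction n)
      case (Suc n)
      have "norm (w (Suc n)) \<le> norm (w n) / 2" unfolding w_Suc by (rule h(3))
      also have "\<dots> \<le> (norm z * (1 / 2) ^ n) / 2" using Suc by (intro divide_right_mono) auto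
      finally show ?case by simp
    qed (simp add: w_def)
    have h_norm: "norm (h (w n)) \<le> (K * norm z) * (1 / 2) ^ n" for n
      using order_trans[OF h(2) mult_left_mono[OF w_norm K(1)]] by (simp add: mult.assoc)
    have sum: "(\<lambda>n. (K * norm z) * (1 / 2) ^ n) sums ((K * norm z) * (1 / (1 - 1 / 2)))"
      by (intro sums_mult geometric_sums) simp
    have summable: "summable (\<lambda>n. norm (h (w n)))"
      by (rule summable_comparison_test[OF _ sums_summable[OF sum]]) (use h_norm in auto)
    define e where "e = suminf (\<lambda>n. h (w n))"
    have sums: "(\<lambda>n. h (w n)) sums e"
      unfolding e_def by (rule summable_sums[OF summable_norm_cancel[OF summable]])
    have "e \<in> E"
    proof (rule closed_sequentially[OF E(2)])
      show "(\<lambda>n. \<Sum>i<n. h (w i)) \<longlonglongrightarrow> e" using sums by (simp add: sums_def)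
    qed (intro subspace_sum[OF E(1)] h(1))
    moreover have "norm e \<le> (2 * K) * norm z"
    proof -
      have "norm e \<le> suminf (\<lambda>n. norm (h (w n)))" unfolding e_def by (rule summable_norm[OF summable])
      also have "\<dots> \<le> suminf (\<lambda>n. (K * norm z) * (1 / 2) ^ n)"
        by (rule suminf_le[OF h_norm summable sums_summable[OF sum]])
      also have "\<dots> = (2 * K) * norm z" using sums_unique[OF sum] by simp
      finally show ?thesis .
    qed
    moreover have "f e = z"
    proof (rule sums_unique2)
      show "(\<lambda>n. f (h (w n))) sums f e" by (rule f.sums[OF sums])
      have "w \<longlonglongrightarrow> 0"
      proof (rule Lim_null_comparison)
        show "(\<lambda>n. norm z * (1 / 2) ^ n) \<longlonglongrightarrow> 0"
          by (intro tendsto_mult_right_zero LIMSEQ_power_zero) simp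
      qed (use w_norm in auto)
      then have "(\<lambda>n. w n - w (Suc n)) sums (w 0 - 0)" by (rule telescope_sums')
      then show "(\<lambda>n. f (h (w n))) sums z" by (simp add: w_Suc w_def)
    qed
    ultimately show ?thesis by blast
  qed
  then show thesis using that[of "2 * K"] K(1) by auto
qed

section \<open>Generalised Drazin inverses in complex Banach algebras\<close>

text \<open>The algebra of operators on the zero space is allowed, hence no \<open>0 \<noteq> 1\<close> and no
  \<open>norm 1 = 1\<close>.\<close>

class complex_banach_algebra = complex_banach + real_normed_algebra + monoid_mult +
  assumes mult_scaleC_left: "(c *\<^sub>C x) * y = c *\<^sub>C (x * y)"
    and mult_scaleC_right: "x * (c *\<^sub>C y) = c *\<^sub>C (x * y)"

lemma bounded_bilinear_scaleC:
  "bounded_bilinear (scaleC :: complex \<Rightarrow> 'a::complex_normed_vector \<Rightarrow> 'a)"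
proof
  show "\<exists>K. \<forall>a (b::'a). norm (a *\<^sub>C b) \<le> norm a * norm b * K"
    by (rule exI[of _ 1]) (simp add: norm_scaleC)
  fix r :: real and a :: complex and b :: 'a
  show "(r *\<^sub>R a) *\<^sub>C b = r *\<^sub>R a *\<^sub>C b"
    by (subst scaleR_conv_of_real) (simp add: scaleR_scaleC scaleC_scaleC)
  show "a *\<^sub>C r *\<^sub>R b = r *\<^sub>R a *\<^sub>C b"
    by (rule scaleR_scaleC_commute)
qed (simp_all add: scaleC_add_left scaleC_add_right)

lemmas continuous_on_scaleC [continuous_intros] =
  bounded_bilinear.continuous_on[OF bounded_bilinear_scaleC]

lemma norm_power_le:
  fixes x :: "'a::complex_banach_algebra"
  shows "norm (x ^ n) \<le> norm (1::'a) * norm x ^ n"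
proof (induction n)
  case (Suc n)
  have "norm (x ^ Suc n) \<le> norm x * norm (x ^ n)" by (simp add: norm_mult_ineq)
  also have "\<dots> \<le> norm x * (norm (1::'a) * norm x ^ n)" by (rule mult_left_mono[OF Suc]) simp
  finally show ?case by (simp add: mult_ac)
qed simp

lemma power_scaleC:
  fixes x :: "'a::complex_banach_algebra"
  shows "(c *\<^sub>C x) ^ n = (c ^ n) *\<^sub>C (x ^ n)"
  by (induction n) (simp_all add: mult_scaleC_left mult_scaleC_right scaleC_scaleC scaleC_one mult.commute)

definition unit_elt :: "'a::monoid_mult \<Rightarrow> bool"
  where "unit_elt x \<longleftrightarrow> (\<exists>y. x * y = 1 \<and> y * x = 1)"

lemma unit_eltI: "x * y = 1 \<Longrightarrow> z * x = 1 \<Longrightarrow> unit_elt x"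
  unfolding unit_elt_def by (metis mult.assoc mult_1_left mult_1_right)

lemma unit_elt_scaleC:
  fixes x :: "'a::complex_banach_algebra"
  assumes "unit_elt (c *\<^sub>C x)"
  shows "unit_elt x"
proof -
  obtain y where "(c *\<^sub>C x) * y = 1" "y * (c *\<^sub>C x) = 1" using assms by (auto simp: unit_elt_def)
  then show ?thesis
    by (intro unit_eltI[of x "c *\<^sub>C y" "c *\<^sub>C y"]) (simp_all add: mult_scaleC_left mult_scaleC_right)
qed

lemma unit_elt_scaleC_iff:
  fixes x :: "'a::complex_banach_algebra"
  assumes "c \<noteq> 0"
  shows "unit_elt (c *\<^sub>C x) \<longleftrightarrow> unit_elt x"
  using unit_elt_scaleC[of c x] unit_elt_scaleC[of "inverse c" "c *\<^sub>C x"] assms by auto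

text \<open>Neumann series; multiplication by \<open>1 - w\<close> from either side
  telescopes.\<close>

lemma unit_elt_one_minus:
  fixes w :: "'a::complex_banach_algebra"
  assumes "norm w < 1"
  shows "unit_elt (1 - w)"
proof -
  have summable: "summable (\<lambda>n. w ^ n)"
    by (rule summable_comparison_test[of _ "\<lambda>n. norm (1::'a) * norm w ^ n"])
      (use assms norm_power_le in \<open>auto intro!: summable_mult summable_geometric\<close>)
  have tele: "(\<lambda>n. w ^ n - w ^ Suc n) sums (w ^ 0 - 0)"
    by (rule telescope_sums'[OF summable_LIMSEQ_zero[OF summable]])
  have "(\<lambda>n. (1 - w) * w ^ n) sums ((1 - w) * suminf ((^) w))"
    using summable by (intro bounded_linear.sums[OF bounded_linear_mult_right] summable_sums)
  then have 1: "(1 - w) * suminf ((^) w) = 1"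
    using tele by (intro sums_unique2[of "\<lambda>n. w ^ n - w ^ Suc n"]) (simp_all add: left_diff_distrib)
  have "(\<lambda>n. w ^ n * (1 - w)) sums (suminf ((^) w) * (1 - w))"
    using summable by (intro bounded_linear.sums[OF bounded_linear_mult_left] summable_sums)
  then have 2: "suminf ((^) w) * (1 - w) = 1"
    using tele
    by (intro sums_unique2[of "\<lambda>n. w ^ n - w ^ Suc n"]) (simp_all add: right_diff_distrib power_commutes)
  from 1 2 show ?thesis by (rule unit_eltI)
qed

text \<open>The geometric sum divides \<open>1 - w ^ n\<close>. Thus one power of norm below 1
  suffices for invertibility, which takes the place of a spectral radius argument.\<close>

lemma unit_elt_one_minus_power:
  fixes w :: "'a::complex_banach_algebra"
  assumes "unit_elt (1 - w ^ n)"
  shows "unit_elt (1 - w)"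
proof -
  obtain u where u: "(1 - w ^ n) * u = 1" "u * (1 - w ^ n) = 1"
    using assms by (auto simp: unit_elt_def)
  have *: "(1 - w) * (\<Sum>i<n. w ^ i) = 1 - w ^ n" "(\<Sum>i<n. w ^ i) * (1 - w) = 1 - w ^ n"
  proof (induction n)
    case (Suc n)
    show "(1 - w) * (\<Sum>i<Suc n. w ^ i) = 1 - w ^ Suc n"
      using Suc(1) by (simp add: distrib_left left_diff_distrib)
    have "(\<Sum>i<Suc n. w ^ i) * (1 - w) = (\<Sum>i<n. w ^ i) * (1 - w) + w ^ n * (1 - w)"
      by (simp add: distrib_right)
    then show "(\<Sum>i<Suc n. w ^ i) * (1 - w) = 1 - w ^ Suc n"
      unfolding Suc(2) by (simp add: right_diff_distrib power_commutes)
  qed simp_all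
  show ?thesis
  proof (rule unit_eltI)
    show "(1 - w) * ((\<Sum>i<n. w ^ i) * u) = 1" by (simp only: * u flip: mult.assoc)
    show "(u * (\<Sum>i<n. w ^ i)) * (1 - w) = 1" by (simp only: * u mult.assoc)
  qed
qed

section \<open>Drazin inverses and invertibility of small shifts\<close>

definition drazin :: "'a::complex_banach_algebra \<Rightarrow> 'a \<Rightarrow> bool"
  where "drazin x d \<longleftrightarrow> x * d = d * x \<and> d * x * d = d \<and> (\<exists>k. x ^ k * (1 - x * d) = 0)"

text \<open>Equivalent to quasinilpotence of \<open>x * (1 - x * d)\<close>, since
  \<open>1 - x * d\<close> is then an idempotent commuting with \<open>x\<close>. The growth form
  can be estimated directly in products.\<close>

definition gdrazin :: "'a::complex_banach_algebra \<Rightarrow> 'a \<Rightarrow> bool"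
  where "gdrazin x d \<longleftrightarrow> x * d = d * x \<and> d * x * d = d \<and>
    (\<forall>\<epsilon>>0. \<exists>C. \<forall>n. norm (x ^ n * (1 - x * d)) \<le> C * \<epsilon> ^ n)"

lemma power_mult_mono_zero:
  fixes x :: "'a::{monoid_mult,ring}"
  assumes "x ^ k * e = 0" "k \<le> n"
  shows "x ^ n * e = 0"
proof -
  have "x ^ n * e = x ^ (n - k) * (x ^ k * e)"
    using assms(2) by (simp flip: mult.assoc power_add)
  then show ?thesis by (simp add: assms(1))
qed

lemma drazin_imp_gdrazin:
  fixes x :: "'a::complex_banach_algebra"
  assumes "drazin x d"
  shows "gdrazin x d"
  unfolding gdrazin_def
proof (intro conjI allI impI)
  obtain k where k: "x ^ k * (1 - x * d) = 0" using assms by (auto simp: drazin_def)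
  fix \<epsilon> :: real assume "\<epsilon> > 0"
  \<comment> \<open>From \<open>k\<close> on the sequence vanishes, so the sum of the finitely many
    earlier ratios is a valid constant.\<close>
  let ?f = "\<lambda>n. norm (x ^ n * (1 - x * d)) / \<epsilon> ^ n"
  have "norm (x ^ n * (1 - x * d)) \<le> (\<Sum>i<k. ?f i) * \<epsilon> ^ n" for n
  proof (cases "n < k")
    case True
    then have "?f n \<le> (\<Sum>i<k. ?f i)" using \<open>\<epsilon> > 0\<close> by (intro member_le_sum) auto
    then show ?thesis using \<open>\<epsilon> > 0\<close> by (simp add: field_simps)
  next
    case False
    then have "x ^ n * (1 - x * d) = 0" using power_mult_mono_zero[OF k, of n] by simp
    moreover have "0 \<le> (\<Sum>i<k. ?f i)" using \<open>\<epsilon> > 0\<close> by (intro sum_nonneg) auto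
    ultimately show ?thesis using \<open>\<epsilon> > 0\<close> by simp
  qed
  then show "\<exists>C. \<forall>n. norm (x ^ n * (1 - x * d)) \<le> C * \<epsilon> ^ n" by blast
qed (use assms in \<open>auto simp: drazin_def\<close>)

lemma unit_elt_drazin:
  assumes "unit_elt x"
  obtains d where "drazin x d" "x * d = 1"
proof -
  obtain d where "x * d = 1" "d * x = 1" using assms by (auto simp: unit_elt_def)
  then show thesis by (intro that[of d]) (auto simp: drazin_def)
qed

lemma drazin_zero_iff: "drazin x 0 \<longleftrightarrow> (\<exists>k. x ^ k = 0)"
  by (simp add: drazin_def)

text \<open>With a Drazin inverse \<open>d'\<close>, \<open>x ^ k = x ^ (k + n) * d' ^ n\<close>; on the quasinilpotent part this
  tends to \<open>0\<close> as \<open>n\<close> grows.\<close>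

lemma gdrazin_power_eq_0:
  fixes x :: "'a::complex_banach_algebra"
  assumes "gdrazin x d" "x * d' = d' * x" "x ^ k * (1 - x * d') = 0"
  shows "x ^ k * (1 - x * d) = 0"
proof -
  let ?e = "1 - x * d"
  have comm: "?e * x ^ m = x ^ m * ?e" for m
  proof -
    have "x * (x * d) = (x * d) * x" using assms(1) by (metis gdrazin_def mult.assoc)
    then have "(x * d) * x ^ m = x ^ m * (x * d)" by (metis power_commuting_commutes)
    then show ?thesis by (simp add: algebra_simps)
  qed
  have pow: "x ^ k = x ^ (k + n) * d' ^ n" for n
  proof (induction n)
    case (Suc n)
    have "x ^ (k + Suc n) = x ^ n * (x ^ k * x)"
      by (simp only: add_Suc_right add.commute[of k n] power_Suc2 power_add mult.assoc)
    then have "x ^ (k + Suc n) * d' ^ Suc n = x ^ n * (x ^ k * (x * d')) * d' ^ n"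
      by (simp add: mult.assoc)
    also have "x ^ k * (x * d') = x ^ k" using assms(3) by (simp add: algebra_simps)
    finally show ?case using Suc by (metis power_add add.commute)
  qed simp
  \<comment> \<open>Chosen so that each further factor \<open>d'\<close> is outweighed by a factor
    1/2; the \<open>+ 1\<close> covers \<open>d' = 0\<close>.\<close>
  define \<epsilon> where "\<epsilon> = 1 / (2 * (norm d' + 1))"
  have \<epsilon>: "\<epsilon> > 0" "\<epsilon> * norm d' \<le> 1 / 2" by (auto simp: \<epsilon>_def field_simps add_pos_nonneg)
  obtain C where C: "\<And>n. norm (x ^ n * ?e) \<le> C * \<epsilon> ^ n"
    using assms(1) \<epsilon>(1) unfolding gdrazin_def by blast
  have "0 \<le> C" using order_trans[OF norm_ge_zero C[of 0]] by simp
  have bound: "norm (x ^ k * ?e) \<le> (C * \<epsilon> ^ k * norm (1::'a)) * (1 / 2) ^ n" for n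
  proof -
    have "x ^ k * ?e = ?e * x ^ k" by (simp add: comm)
    also have "\<dots> = ?e * (x ^ (k + n) * d' ^ n)" using pow[of n] by simp
    also have "\<dots> = x ^ (k + n) * ?e * d' ^ n" by (metis comm mult.assoc)
    finally have "norm (x ^ k * ?e) \<le> norm (x ^ (k + n) * ?e) * norm (d' ^ n)"
      by (metis norm_mult_ineq)
    also have "\<dots> \<le> (C * \<epsilon> ^ (k + n)) * (norm (1::'a) * norm d' ^ n)"
      using C norm_power_le \<open>0 \<le> C\<close> \<epsilon> by (intro mult_mono) auto
    also have "\<dots> = (C * \<epsilon> ^ k * norm (1::'a)) * (\<epsilon> * norm d') ^ n"
      by (simp add: power_add power_mult_distrib)
    also have "\<dots> \<le> (C * \<epsilon> ^ k * norm (1::'a)) * (1 / 2) ^ n"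
      using \<epsilon> \<open>0 \<le> C\<close> by (intro mult_left_mono power_mono) auto
    finally show ?thesis .
  qed
  have "(\<lambda>n. (C * \<epsilon> ^ k * norm (1::'a)) * (1 / 2) ^ n) \<longlonglongrightarrow> 0"
    by (intro tendsto_mult_right_zero LIMSEQ_power_zero) simp
  then have "norm (x ^ k * ?e) \<le> 0"
    by (rule LIMSEQ_le_const) (use bound in auto)
  then show ?thesis by simp
qed

text \<open>Allows the existence of a Drazin inverse to be tested on whichever generalised inverse
  is at hand.\<close>

lemma gdrazin_drazin:
  assumes "gdrazin x d" "drazin x d'"
  shows "drazin x d"
proof -
  obtain k where "x * d' = d' * x" "x ^ k * (1 - x * d') = 0" using assms(2) by (auto simp: drazin_def)
  then have "x ^ k * (1 - x * d) = 0" by (rule gdrazin_power_eq_0[OF assms(1)])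
  then show ?thesis using assms(1) unfolding gdrazin_def drazin_def by blast
qed

text \<open>The case \<open>k = 0\<close> of \<open>gdrazin_power_eq_0\<close>: an invertible
  element has no quasinilpotent part.\<close>

lemma gdrazin_unit:
  assumes "gdrazin x d" "unit_elt x"
  shows "x * d = 1"
proof -
  obtain d' where "x * d' = 1" "d' * x = 1" using assms(2) by (auto simp: unit_elt_def)
  then have "x ^ 0 * (1 - x * d) = 0" by (intro gdrazin_power_eq_0[OF assms(1), of d']) auto
  then show ?thesis by simp
qed

text \<open>The idempotents \<open>x * d\<close> and \<open>e = 1 - x * d\<close> split the problem.
  On the first block \<open>x - z\<close> is governed by \<open>1 - z d\<close>, invertible by the
  Neumann series; on the second it is \<open>- z (1 - w)\<close> with \<open>w = x e / z\<close>
  quasinilpotent.\<close>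

lemma gdrazin_unit_shift:
  fixes x :: "'a::complex_banach_algebra"
  assumes x: "gdrazin x d" and z: "z \<noteq> 0" "cmod z * norm d < 1"
  shows "unit_elt (x - z *\<^sub>C 1)"
proof -
  define e where "e = 1 - x * d"
  have xd: "x * d = d * x" "d * x * d = d" using x by (auto simp: gdrazin_def)
  have idem: "(x * d) * (x * d) = x * d" using xd by (metis mult.assoc)
  have ee: "e * e = e" by (simp add: e_def left_diff_distrib right_diff_distrib idem)
  have xe: "x * e = e * x"
    by (simp add: e_def left_diff_distrib right_diff_distrib mult.assoc flip: xd(1))
  have de: "x * d * d = d" "d * (x * d) = d" using xd by (simp_all add: mult.assoc)
  obtain u where u: "(1 - z *\<^sub>C d) * u = 1" "u * (1 - z *\<^sub>C d) = 1"
    using unit_elt_one_minus[of "z *\<^sub>C d"] z by (auto simp: unit_elt_def norm_scaleC)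
  define w where "w = inverse z *\<^sub>C (x * e)"
  have "unit_elt (1 - w)"
  proof -
    \<comment> \<open>The rate \<open>cmod z / 2\<close> leaves a factor 1/2 per power after
      division by \<open>z\<close>.\<close>
    obtain C where C: "\<And>n. norm (x ^ n * e) \<le> C * (cmod z / 2) ^ n"
      using x z(1) unfolding gdrazin_def e_def by (metis half_gt_zero zero_less_norm_iff)
    have "(x * e) ^ Suc n = x ^ Suc n * e" for n
    proof (induction n)
      case (Suc n)
      have "(x * e) ^ Suc (Suc n) = (x * e) * (x ^ Suc n * e)" using Suc by simp
      also have "\<dots> = x * (e * x ^ Suc n) * e" by (simp add: mult.assoc)
      also have "e * x ^ Suc n = x ^ Suc n * e" using xe by (metis power_commuting_commutes)
      finally show ?case by (simp add: mult.assoc ee)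
    qed simp
    then have w_pow: "w ^ Suc n = inverse z ^ Suc n *\<^sub>C (x ^ Suc n * e)" for n
      by (simp add: w_def power_scaleC del: power_Suc)
    have w_le: "norm (w ^ Suc n) \<le> C * (1 / 2) ^ Suc n" for n
    proof -
      have "norm (w ^ Suc n) \<le> inverse (cmod z) ^ Suc n * (C * (cmod z / 2) ^ Suc n)"
        unfolding w_pow norm_scaleC norm_power norm_inverse
        by (rule mult_left_mono[OF C]) simp
      also have "\<dots> = C * (inverse (cmod z) * (cmod z / 2)) ^ Suc n"
        by (simp only: power_mult_distrib mult_ac)
      finally show ?thesis using z(1) by simp
    qed
    have "(\<lambda>n. C * (1 / 2) ^ Suc n) \<longlonglongrightarrow> 0"
      by (intro tendsto_mult_right_zero LIMSEQ_Suc[OF LIMSEQ_power_zero]) simp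
    then have "\<forall>\<^sub>F n in sequentially. C * (1 / 2) ^ Suc n < 1"
      by (rule order_tendstoD) simp
    then obtain n where "C * (1 / 2) ^ Suc n < 1"
      using eventually_happens' sequentially_bot by blast
    then have "norm (w ^ Suc n) < 1" using w_le le_less_trans by blast
    then show ?thesis by (intro unit_elt_one_minus_power[of w "Suc n"] unit_elt_one_minus)
  qed
  then obtain v where v: "(1 - w) * v = 1" "v * (1 - w) = 1" by (auto simp: unit_elt_def)
  have d1: "(x - z *\<^sub>C 1) * d = x * d * (1 - z *\<^sub>C d)" "d * (x - z *\<^sub>C 1) = (1 - z *\<^sub>C d) * (x * d)"
    by (simp_all add: right_diff_distrib left_diff_distrib mult_scaleC_left mult_scaleC_right de xd(1)[symmetric])
  have "(x * e) * e = x * e" by (simp add: mult.assoc ee)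
  moreover have "e * (x * e) = x * e" unfolding xe by (simp add: ee flip: mult.assoc)
  ultimately
  have ew: "e * w = w * e" "e * (1 - w) = e - w"
    by (simp_all add: w_def mult_scaleC_left mult_scaleC_right right_diff_distrib)
  have e1: "(x - z *\<^sub>C 1) * e = (- z) *\<^sub>C (e * (1 - w))" "e * (x - z *\<^sub>C 1) = (- z) *\<^sub>C ((1 - w) * e)"
  proof -
    have "(- z) *\<^sub>C (e - w) = (x - z *\<^sub>C 1) * e"
      using z(1) by (simp add: w_def algebra_simps mult_scaleC_left cvs.scale_right_diff_distrib)
    moreover have "(1 - w) * e = e * (1 - w)" by (simp add: algebra_simps ew)
    moreover have "(x - z *\<^sub>C 1) * e = e * (x - z *\<^sub>C 1)"
      by (simp add: algebra_simps xe mult_scaleC_left mult_scaleC_right)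
    ultimately show "(x - z *\<^sub>C 1) * e = (- z) *\<^sub>C (e * (1 - w))"
      "e * (x - z *\<^sub>C 1) = (- z) *\<^sub>C ((1 - w) * e)" by (simp_all add: ew)
  qed
  show ?thesis
  \<comment> \<open>A right and a left inverse are assembled separately from the two blocks, so
    \<open>u\<close> and \<open>v\<close> need not be commuted past \<open>d\<close> and
    \<open>e\<close>.\<close>
  proof (rule unit_eltI)
    have "(x - z *\<^sub>C 1) * (d * u) = x * d * ((1 - z *\<^sub>C d) * u)"
      "(x - z *\<^sub>C 1) * (e * v) = (- z) *\<^sub>C (e * ((1 - w) * v))"
      by (simp_all only: d1 e1 mult_scaleC_left flip: mult.assoc)
    then have "(x - z *\<^sub>C 1) * (d * u) = x * d" "(x - z *\<^sub>C 1) * (e * v) = (- z) *\<^sub>C e"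
      by (simp_all only: u v mult_1_right)
    then show "(x - z *\<^sub>C 1) * (d * u - inverse z *\<^sub>C (e * v)) = 1"
      using z(1) by (simp add: right_diff_distrib mult_scaleC_right e_def)
    have "(u * d) * (x - z *\<^sub>C 1) = (u * (1 - z *\<^sub>C d)) * (x * d)"
      "(v * e) * (x - z *\<^sub>C 1) = (- z) *\<^sub>C ((v * (1 - w)) * e)"
      by (simp_all only: d1 e1 mult_scaleC_right mult.assoc)
    then have "(u * d) * (x - z *\<^sub>C 1) = x * d" "(v * e) * (x - z *\<^sub>C 1) = (- z) *\<^sub>C e"
      by (simp_all only: u v mult_1_left)
    then show "(u * d - inverse z *\<^sub>C (v * e)) * (x - z *\<^sub>C 1) = 1"
      using z(1) by (simp add: left_diff_distrib mult_scaleC_left e_def)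
  qed
qed

subsection \<open>The Riesz decomposition at an isolated spectral point\<close>

text \<open>The sign convention makes the residue at \<open>0\<close> the Riesz projection itself.
  Where \<open>z - x\<close> is not invertible the value is arbitrary.\<close>

definition resolvent :: "'a::complex_banach_algebra \<Rightarrow> complex \<Rightarrow> 'a"
  where "resolvent x z = (SOME y. (z *\<^sub>C 1 - x) * y = 1 \<and> y * (z *\<^sub>C 1 - x) = 1)"

lemma resolvent_inverse:
  fixes x :: "'a::complex_banach_algebra"
  assumes "unit_elt (x - z *\<^sub>C 1)"
  shows "(z *\<^sub>C 1 - x) * resolvent x z = 1" "resolvent x z * (z *\<^sub>C 1 - x) = 1"
proof -
  have "z *\<^sub>C 1 - x = (- 1) *\<^sub>C (x - z *\<^sub>C 1)" by (simp add: scaleC_one)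
  then have "unit_elt (z *\<^sub>C 1 - x)" using assms unit_elt_scaleC_iff[of "- 1" "x - z *\<^sub>C 1"] by simp
  then have "\<exists>y. (z *\<^sub>C 1 - x) * y = 1 \<and> y * (z *\<^sub>C 1 - x) = 1" by (simp add: unit_elt_def)
  from someI_ex[OF this]
  show "(z *\<^sub>C 1 - x) * resolvent x z = 1" "resolvent x z * (z *\<^sub>C 1 - x) = 1"
    by (simp_all add: resolvent_def)
qed

lemma mult_resolvent:
  fixes x :: "'a::complex_banach_algebra"
  assumes "unit_elt (x - z *\<^sub>C 1)"
  shows "x * resolvent x z = z *\<^sub>C resolvent x z - 1" "resolvent x z * x = z *\<^sub>C resolvent x z - 1"
  using resolvent_inverse[OF assms]
  by (simp_all add: left_diff_distrib right_diff_distrib mult_scaleC_left mult_scaleC_right algebra_simps)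

lemma resolvent_identity:
  fixes x :: "'a::complex_banach_algebra"
  assumes "unit_elt (x - z *\<^sub>C 1)" "unit_elt (x - w *\<^sub>C 1)"
  shows "resolvent x z - resolvent x w = (w - z) *\<^sub>C (resolvent x z * resolvent x w)"
proof -
  have "resolvent x z - resolvent x w
      = resolvent x z * ((w *\<^sub>C 1 - x) * resolvent x w) - (resolvent x z * (z *\<^sub>C 1 - x)) * resolvent x w"
    by (simp add: resolvent_inverse assms)
  also have "\<dots> = resolvent x z * ((w *\<^sub>C 1 - x) - (z *\<^sub>C 1 - x)) * resolvent x w"
    by (simp only: mult.assoc left_diff_distrib right_diff_distrib)
  also have "(w *\<^sub>C 1 - x) - (z *\<^sub>C 1 - x) = (w - z) *\<^sub>C 1"
    by (simp add: cvs.scale_left_diff_distrib)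
  finally show ?thesis by (simp add: mult_scaleC_left mult_scaleC_right)
qed

text \<open>Parametrises the circle over the unit interval, which turns contour integrals of
  algebra-valued functions into ordinary integrals.\<close>

definition circ :: "real \<Rightarrow> real \<Rightarrow> complex"
  where "circ \<rho> t = of_real \<rho> * exp (2 * of_real pi * \<i> * of_real t)"

lemma norm_circ: "0 \<le> \<rho> \<Longrightarrow> cmod (circ \<rho> t) = \<rho>"
  by (simp add: circ_def norm_mult)

lemma circ_nonzero: "0 < \<rho> \<Longrightarrow> circ \<rho> t \<noteq> 0"
  by (simp add: circ_def)

lemma continuous_on_circ: "continuous_on S (circ \<rho>)"
  unfolding circ_def by (intro continuous_intros)

text \<open>The extra factor \<open>circ \<rho> t\<close> is the derivative of the parametrisation
  divided by \<open>2 * pi * \<i>\<close>, so this is Cauchy's theorem in the punctured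
  disc.\<close>

lemma circle_mean_eq:
  assumes "g holomorphic_on ball 0 r - {0}" "0 < a" "a \<le> b" "b < r"
  shows "integral {0..1} (\<lambda>t. g (circ a t) * circ a t) = integral {0..1} (\<lambda>t. g (circ b t) * circ b t)"
proof -
  have ci: "contour_integral (circlepath 0 \<rho>) g
      = (2 * pi * \<i>) * integral {0..1} (\<lambda>t. g (circ \<rho> t) * circ \<rho> t)" for \<rho>
  proof -
    have "contour_integral (circlepath 0 \<rho>) g
        = integral {0..1} (\<lambda>t. (2 * pi * \<i>) * (g (circ \<rho> t) * circ \<rho> t))"
      unfolding contour_integral_integral
      by (intro integral_cong, simp only: vector_derivative_circlepath)
        (simp add: circlepath circ_def mult_ac)
    then show ?thesis by simp
  qed
  have "contour_integral (circlepath 0 b) g = contour_integral (circlepath 0 a) g"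
    by (rule contour_integral_circlepath_eq(3)[OF _ assms(1-3)]) (use assms(4) in auto)
  then show ?thesis by (simp add: ci)
qed

text \<open>Orthogonality of exponentials; the source of the exceptional index \<open>- 1\<close> in
  \<open>mult_coef\<close>.\<close>

lemma circ_powi_mean:
  assumes "0 < \<rho>"
  shows "integral {0..1} (\<lambda>t. circ \<rho> t powi j) = (if j = 0 then 1 else 0)"
proof (cases "j = 0")
  case False
  define c where "c = 2 * of_real pi * \<i> * of_int j"
  have c: "c \<noteq> 0" using False by (simp add: c_def)
  have eq: "circ \<rho> t powi j = of_real \<rho> powi j * exp (c * of_real t)" for t
    unfolding circ_def power_int_mult_distrib exp_power_int c_def by (simp add: mult_ac)
  have "((\<lambda>t. circ \<rho> t powi j) has_integral
      of_real \<rho> powi j * exp (c * of_real 1) / c - of_real \<rho> powi j * exp (c * of_real 0) / c) {0..1}"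
  proof (rule fundamental_theorem_of_calculus)
    fix t :: real
    have "((\<lambda>z. of_real \<rho> powi j * exp (c * z) / c) has_field_derivative of_real \<rho> powi j * exp (c * of_real t))
        (at (of_real t))"
      using c by (auto intro!: derivative_eq_intros)
    then show "((\<lambda>t. of_real \<rho> powi j * exp (c * of_real t) / c) has_vector_derivative circ \<rho> t powi j)
        (at t within {0..1})"
      unfolding eq by (rule has_vector_derivative_real_field)
  qed simp
  moreover have "exp c = 1"
    using exp_integer_2pi[of "of_int j"] by (simp add: c_def mult_ac)
  ultimately show ?thesis using False by (simp add: integral_unique)
qed simp

text \<open>Nothing is said about \<open>z = 0\<close>, so invertible elements are included and
  isolation can be separated from membership in the spectrum.\<close>

locale isolated_zero =
  fixes x :: "'a::complex_banach_algebra" and r :: real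
  assumes r_pos: "0 < r"
    and unit: "\<And>z. z \<noteq> 0 \<Longrightarrow> cmod z < r \<Longrightarrow> unit_elt (x - z *\<^sub>C 1)"
begin

abbreviation R where "R \<equiv> resolvent x"

text \<open>The resolvent identity bounds \<open>R z\<close> in terms of itself with factor at most
  1/2, which is absorbed on the left.\<close>

lemma norm_resolvent_near:
  assumes "w \<noteq> 0" "cmod w < r" "z \<noteq> 0" "cmod z < r" "cmod (z - w) * norm (R w) \<le> 1 / 2"
  shows "norm (R z) \<le> 2 * norm (R w)"
proof -
  have "norm (R z) \<le> norm (R w) + norm (R z - R w)"
    by (metis add.commute diff_add_cancel norm_triangle_ineq)
  also have "norm (R z - R w) = cmod (z - w) * norm (R z * R w)"
    using assms by (simp add: resolvent_identity unit norm_scaleC norm_minus_commute)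
  also have "\<dots> \<le> cmod (z - w) * (norm (R z) * norm (R w))"
    by (intro mult_left_mono norm_mult_ineq) simp
  also have "\<dots> = (cmod (z - w) * norm (R w)) * norm (R z)" by simp
  also have "\<dots> \<le> 1 / 2 * norm (R z)" by (rule mult_right_mono[OF assms(5)]) simp
  finally show ?thesis by simp
qed

lemma tendsto_resolvent:
  assumes w: "w \<noteq> 0" "cmod w < r"
  shows "(R \<longlongrightarrow> R w) (at w)"
proof -
  have near: "\<forall>\<^sub>F z in at w. z \<in> ball 0 r - {0}"
    by (rule eventually_at_in_open') (use w in auto)
  have "((\<lambda>z. cmod (z - w) * norm (R w)) \<longlongrightarrow> cmod (w - w) * norm (R w)) (at w)"
    by (intro tendsto_intros)
  then have "\<forall>\<^sub>F z in at w. cmod (z - w) * norm (R w) < 1 / 2"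
    by (rule order_tendstoD) simp
  with near have le: "\<forall>\<^sub>F z in at w. norm (R z - R w) \<le> cmod (z - w) * (2 * norm (R w) * norm (R w))"
  proof eventually_elim
    case (elim z)
    have "norm (R z - R w) = cmod (z - w) * norm (R z * R w)"
      using elim w by (simp add: resolvent_identity unit norm_scaleC norm_minus_commute)
    also have "norm (R z * R w) \<le> norm (R z) * norm (R w)" by (rule norm_mult_ineq)
    also have "norm (R z) \<le> 2 * norm (R w)"
      using elim w by (intro norm_resolvent_near) auto
    finally show ?case by (simp add: mult_left_mono mult_right_mono)
  qed
  have "((\<lambda>z. cmod (z - w) * (2 * norm (R w) * norm (R w))) \<longlongrightarrow>
      cmod (w - w) * (2 * norm (R w) * norm (R w))) (at w)"
    by (intro tendsto_intros)
  then have "((\<lambda>z. cmod (z - w) * (2 * norm (R w) * norm (R w))) \<longlongrightarrow> 0) (at w)"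
    by (simp only: diff_self norm_zero mult_zero_left)
  with le have "((\<lambda>z. R z - R w) \<longlongrightarrow> 0) (at w)"
    by (rule Lim_null_comparison)
  then show ?thesis by (simp add: LIM_zero_iff)
qed

lemma continuous_on_resolvent: "continuous_on (ball 0 r - {0}) R"
proof (intro continuous_at_imp_continuous_on ballI)
  fix w :: complex assume "w \<in> ball 0 r - {0}"
  then show "isCont R w" unfolding isCont_def by (intro tendsto_resolvent) auto
qed

text \<open>By the resolvent identity the difference quotient at \<open>w\<close> is minus the
  functional applied to \<open>R z * R w\<close>, so continuity of \<open>R\<close> already gives
  the derivative.\<close>

lemma holomorphic_resolvent: "(\<lambda>z. capply \<phi> (R z)) holomorphic_on ball 0 r - {0}"
proof -
  have "((\<lambda>z. capply \<phi> (R z)) has_field_derivative - capply \<phi> (R w * R w)) (at w)"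
    if w: "w \<noteq> 0" "cmod w < r" for w
    unfolding has_field_derivative_iff
  proof (rule Lim_transform_eventually)
    have "((\<lambda>z. R z * R w) \<longlongrightarrow> R w * R w) (at w)"
      by (intro tendsto_mult tendsto_resolvent[OF w] tendsto_const)
    then show "((\<lambda>z. - capply \<phi> (R z * R w)) \<longlongrightarrow> - capply \<phi> (R w * R w)) (at w)"
      by (intro tendsto_minus bounded_linear.tendsto[OF bounded_linear_capply])
    have "\<forall>\<^sub>F z in at w. z \<in> ball 0 r - {0}"
      by (rule eventually_at_in_open') (use w in auto)
    moreover have "\<forall>\<^sub>F z in at w. z \<noteq> w" by (simp add: eventually_at_filter)
    ultimately show "\<forall>\<^sub>F z in at w. - capply \<phi> (R z * R w) = (capply \<phi> (R z) - capply \<phi> (R w)) / (z - w)"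
    proof eventually_elim
      case (elim z)
      have "capply \<phi> (R z) - capply \<phi> (R w) = capply \<phi> (R z - R w)"
        by (simp add: capply_diff)
      also have "\<dots> = (w - z) * capply \<phi> (R z * R w)"
        using elim w by (simp add: resolvent_identity unit clinear_scaleC[OF clinear_capply] scaleC_complex_def)
      finally show ?case using elim by (simp add: field_simps)
    qed
  qed
  then have "\<forall>w\<in>ball 0 r - {0}. \<exists>f'. ((\<lambda>z. capply \<phi> (R z)) has_field_derivative f') (at w)"
    by (metis DiffE insertCI mem_ball_0)
  then show ?thesis by (simp add: holomorphic_on_open open_delete)
qed

text \<open>The Laurent coefficient of the resolvent at \<open>z powi (- k - 1)\<close>.\<close>

definition coef :: "int \<Rightarrow> real \<Rightarrow> 'a"
  where "coef k \<rho> = integral {0..1} (\<lambda>t. (circ \<rho> t powi (k + 1)) *\<^sub>C R (circ \<rho> t))"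

lemma continuous_on_coef_integrand:
  assumes "0 < \<rho>" "\<rho> < r"
  shows "continuous_on {0..1} (\<lambda>t. (circ \<rho> t powi k) *\<^sub>C R (circ \<rho> t))"
proof (intro continuous_on_scaleC continuous_on_power_int continuous_on_circ)
  show "continuous_on {0..1} (\<lambda>t. R (circ \<rho> t))"
    by (rule continuous_on_compose2[OF continuous_on_resolvent continuous_on_circ])
      (use assms in \<open>auto simp: norm_circ circ_nonzero\<close>)
qed (use assms in \<open>auto simp: circ_nonzero\<close>)

lemma coef_integrable:
  assumes "0 < \<rho>" "\<rho> < r"
  shows "(\<lambda>t. (circ \<rho> t powi k) *\<^sub>C R (circ \<rho> t)) integrable_on {0..1}"
  by (rule integrable_continuous_interval[OF continuous_on_coef_integrand[OF assms]])

text \<open>A functional separating the two values would contradict the scalar Cauchy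
  theorem.\<close>

lemma coef_indep:
  assumes "0 < a" "a \<le> b" "b < r"
  shows "coef k a = coef k b"
proof (rule ccontr)
  assume "coef k a \<noteq> coef k b"
  then obtain \<phi> :: "'a \<Rightarrow>\<^sub>B complex" where \<phi>: "capply \<phi> (coef k a - coef k b) \<noteq> 0"
    using hahn_banach[of "coef k a - coef k b"] by auto
  define g where "g z = z powi k * capply \<phi> (R z)" for z
  have "(\<lambda>z::complex. z powi k) holomorphic_on ball 0 r - {0}"
    by (intro holomorphic_on_power_int holomorphic_on_ident) auto
  then have hol: "g holomorphic_on ball 0 r - {0}"
    unfolding g_def by (intro holomorphic_on_mult holomorphic_resolvent)
  have "capply \<phi> (coef k \<rho>) = integral {0..1} (\<lambda>t. g (circ \<rho> t) * circ \<rho> t)" if "0 < \<rho>" "\<rho> < r" for \<rho>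
  proof -
    have "capply \<phi> (coef k \<rho>)
        = integral {0..1} (capply \<phi> \<circ> (\<lambda>t. (circ \<rho> t powi (k + 1)) *\<^sub>C R (circ \<rho> t)))"
      unfolding coef_def by (rule integral_linear[OF coef_integrable[OF that] bounded_linear_capply, symmetric])
    also have "\<dots> = integral {0..1} (\<lambda>t. g (circ \<rho> t) * circ \<rho> t)"
      using that by (intro integral_cong)
        (simp add: g_def clinear_scaleC[OF clinear_capply] scaleC_complex_def power_int_add_1 circ_nonzero mult_ac)
    finally show ?thesis .
  qed
  then have "capply \<phi> (coef k a) = capply \<phi> (coef k b)"
    using circle_mean_eq[OF hol assms] assms by simp
  with \<phi> show False by (simp add: capply_diff)
qed

text \<open>Cauchy's estimate. The bound \<open>M\<close> stays explicit because
  \<open>gdrazin_zero\<close> inserts its decay on a large circle.\<close>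

lemma coef_norm_le:
  assumes "0 < \<rho>" "\<rho> < r" "\<And>z. cmod z = \<rho> \<Longrightarrow> norm (R z) \<le> M"
  shows "norm (coef k \<rho>) \<le> M * \<rho> powi (k + 1)"
proof -
  have "norm (coef k \<rho>) \<le> (M * \<rho> powi (k + 1)) * (1 - 0)"
    unfolding coef_def
  proof (rule integral_bound[OF _ continuous_on_coef_integrand[OF assms(1,2)]])
    fix t :: real
    have "norm ((circ \<rho> t powi (k + 1)) *\<^sub>C R (circ \<rho> t)) = \<rho> powi (k + 1) * norm (R (circ \<rho> t))"
      using assms(1) by (simp add: norm_scaleC norm_power_int norm_circ)
    also have "\<dots> \<le> \<rho> powi (k + 1) * M"
      using assms by (intro mult_left_mono) (auto simp: norm_circ)
    finally show "norm ((circ \<rho> t powi (k + 1)) *\<^sub>C R (circ \<rho> t)) \<le> M * \<rho> powi (k + 1)"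
      by (simp add: mult.commute)
  qed simp
  then show ?thesis by simp
qed

lemma coef_bound:
  assumes "0 < \<rho>" "\<rho> < r"
  obtains M where "0 \<le> M" "\<And>k. norm (coef k \<rho>) \<le> M * \<rho> powi (k + 1)"
proof -
  have "compact (R ` sphere 0 \<rho>)"
    by (rule compact_continuous_image[OF continuous_on_subset[OF continuous_on_resolvent]])
      (use assms in auto)
  then obtain M where "\<forall>y\<in>R ` sphere 0 \<rho>. norm y \<le> M"
    using compact_imp_bounded bounded_iff by blast
  then have M: "norm (R z) \<le> M" if "cmod z = \<rho>" for z using that by auto
  have "0 \<le> norm (R (of_real \<rho>))" by simp
  also have "\<dots> \<le> M" using assms by (intro M) simp
  finally show thesis by (rule that[OF _ coef_norm_le[OF assms M]])
qed

text \<open>\<open>x R = z R - 1\<close> raises the index by one, and the mean of the subtracted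
  power of \<open>z\<close> vanishes except for \<open>k = - 1\<close>.\<close>

lemma mult_coef:
  assumes "0 < \<rho>" "\<rho> < r"
  shows "x * coef k \<rho> = coef (k + 1) \<rho> - (if k = - 1 then 1 else 0)"
    and "coef k \<rho> * x = coef (k + 1) \<rho> - (if k = - 1 then 1 else 0)"
proof -
  let ?f = "\<lambda>t. (circ \<rho> t powi (k + 1)) *\<^sub>C R (circ \<rho> t)"
  have unit': "unit_elt (x - circ \<rho> t *\<^sub>C 1)" for t
    using assms by (intro unit) (auto simp: circ_nonzero norm_circ)
  have powi: "circ \<rho> t powi (k + 2) = circ \<rho> t powi (k + 1) * circ \<rho> t" for t
    using power_int_add_1[of "circ \<rho> t" "k + 1"] circ_nonzero[OF assms(1)] by (simp add: add.assoc)
  have lin: "bounded_linear (\<lambda>c. c *\<^sub>C (1::'a))"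
    by (rule bounded_bilinear.bounded_linear_left[OF bounded_bilinear_scaleC])
  have int: "(\<lambda>t. circ \<rho> t powi (k + 1)) integrable_on {0..1}"
    by (intro integrable_continuous_interval continuous_on_power_int continuous_on_circ)
      (use assms in \<open>auto simp: circ_nonzero\<close>)
  have eq: "integral {0..1} (\<lambda>t. (circ \<rho> t powi (k + 2)) *\<^sub>C R (circ \<rho> t) - (circ \<rho> t powi (k + 1)) *\<^sub>C 1)
      = coef (k + 1) \<rho> - (if k = - 1 then 1 else 0)"
  proof -
    have "integral {0..1} (\<lambda>t. (circ \<rho> t powi (k + 1)) *\<^sub>C (1::'a))
        = integral {0..1} (\<lambda>t. circ \<rho> t powi (k + 1)) *\<^sub>C 1"
      using integral_linear[OF int lin] by (simp add: o_def)
    moreover have "(\<lambda>t. (circ \<rho> t powi (k + 1)) *\<^sub>C (1::'a)) integrable_on {0..1}"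
      using integrable_linear[OF int lin] by (simp add: o_def)
    ultimately show ?thesis
      using coef_integrable[OF assms, of "k + 2"] circ_powi_mean[OF assms(1), of "k + 1"]
      by (simp add: integral_diff coef_def add.assoc scaleC_one)
  qed
  have "x * coef k \<rho> = integral {0..1} ((*) x \<circ> ?f)"
    unfolding coef_def by (rule integral_linear[OF coef_integrable[OF assms] bounded_linear_mult_right, symmetric])
  also have "(*) x \<circ> ?f = (\<lambda>t. (circ \<rho> t powi (k + 2)) *\<^sub>C R (circ \<rho> t) - (circ \<rho> t powi (k + 1)) *\<^sub>C 1)"
    by (auto simp: mult_scaleC_right mult_resolvent[OF unit'] powi cvs.scale_right_diff_distrib scaleC_scaleC)
  finally show "x * coef k \<rho> = coef (k + 1) \<rho> - (if k = - 1 then 1 else 0)" by (simp only: eq)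
  have "coef k \<rho> * x = integral {0..1} ((\<lambda>y. y * x) \<circ> ?f)"
    unfolding coef_def by (rule integral_linear[OF coef_integrable[OF assms] bounded_linear_mult_left, symmetric])
  also have "(\<lambda>y. y * x) \<circ> ?f = (\<lambda>t. (circ \<rho> t powi (k + 2)) *\<^sub>C R (circ \<rho> t) - (circ \<rho> t powi (k + 1)) *\<^sub>C 1)"
    by (auto simp: mult_scaleC_left mult_resolvent[OF unit'] powi cvs.scale_right_diff_distrib scaleC_scaleC)
  finally show "coef k \<rho> * x = coef (k + 1) \<rho> - (if k = - 1 then 1 else 0)" by (simp only: eq)
qed

text \<open>The Riesz projection is \<open>coef 0\<close>, and minus the constant Laurent coefficient \<open>coef (- 1)\<close>
  is the generalised Drazin inverse. Their product vanishes since it equals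
  \<open>coef (- 1 - n) * coef n\<close>, whose factors are estimated on circles of different radii.\<close>

theorem gdrazin_exists:
  obtains d where "gdrazin x d"
    "\<And>\<rho> M. 0 < \<rho> \<Longrightarrow> \<rho> < r \<Longrightarrow> (\<And>z. cmod z = \<rho> \<Longrightarrow> norm (R z) \<le> M) \<Longrightarrow> norm d \<le> M"
proof -
  define c where "c k = coef k (r / 2)" for k
  have c_eq: "c k = coef k \<rho>" if "0 < \<rho>" "\<rho> < r" for k \<rho>
    using coef_indep[of \<rho> "r / 2" k] coef_indep[of "r / 2" \<rho> k] that r_pos
    by (cases "\<rho> \<le> r / 2") (auto simp: c_def)
  have xc: "x * c k = c (k + 1) - (if k = - 1 then 1 else 0)"
    and cx: "c k * x = c (k + 1) - (if k = - 1 then 1 else 0)" for k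
    using mult_coef[of "r / 2" k] r_pos by (auto simp: c_def)
  have pos: "x ^ n * c 0 = c (int n)" for n
  proof (induction n)
    case (Suc n)
    have "x ^ Suc n * c 0 = x * (x ^ n * c 0)" by (simp add: mult.assoc)
    then show ?case by (simp add: Suc xc add.commute)
  qed simp
  have neg: "c (- 1 - int n) * x ^ n = c (- 1)" for n
  proof (induction n)
    case (Suc n)
    have "c (- 1 - int (Suc n)) * x ^ Suc n = (c (- 2 - int n) * x) * x ^ n"
      by (simp add: mult.assoc)
    also have "c (- 2 - int n) * x = c (- 1 - int n)"
      using cx[of "- 2 - int n"] by (simp add: algebra_simps)
    finally show ?case by (simp add: Suc)
  qed simp
  define d where "d = - c (- 1)"
  have e: "1 - x * d = c 0" using xc[of "- 1"] by (simp add: d_def)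
  have comm: "x * d = d * x" by (simp add: d_def xc cx)
  have zero: "c (- 1) * c 0 = 0"
  proof -
    have prod: "c (- 1) * c 0 = c (- 1 - int n) * c (int n)" for n
      by (metis neg pos mult.assoc)
    \<comment> \<open>The negative index is estimated on the larger circle and the nonnegative one
      on the smaller, which leaves the ratio \<open>(r / 4) ^ n / (r / 2) ^ n\<close>.\<close>
    obtain M where M: "0 \<le> M" "\<And>k. norm (coef k (r / 2)) \<le> M * (r / 2) powi (k + 1)"
      using coef_bound[of "r / 2"] r_pos by auto
    obtain M' where M': "0 \<le> M'" "\<And>k. norm (coef k (r / 4)) \<le> M' * (r / 4) powi (k + 1)"
      using coef_bound[of "r / 4"] r_pos by auto
    have "norm (c (- 1) * c 0) \<le> (M * M' * (r / 4)) * (1 / 2) ^ n" for n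
    proof -
      have "norm (c (- 1) * c 0) \<le> norm (c (- 1 - int n)) * norm (c (int n))"
        unfolding prod[of n] by (rule norm_mult_ineq)
      also have "\<dots> \<le> (M * (r / 2) powi (- int n)) * (M' * (r / 4) powi (int n + 1))"
        using M(2)[of "- 1 - int n"] M'(2)[of "int n"] M(1) r_pos c_eq[of "r / 4"] c_eq[of "r / 2"]
        by (intro mult_mono) auto
      also have "\<dots> = (M * M' * (r / 4)) * ((r / 4) ^ n / (r / 2) ^ n)"
        using r_pos by (simp add: power_int_minus power_int_add_1 divide_simps)
      also have "(r / 4) ^ n / (r / 2) ^ n = (1 / 2) ^ n"
        using r_pos by (simp add: power_divide[symmetric])
      finally show ?thesis .
    qed
    moreover have "(\<lambda>n. (M * M' * (r / 4)) * (1 / 2) ^ n) \<longlonglongrightarrow> 0"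
      by (intro tendsto_mult_right_zero LIMSEQ_power_zero) simp
    ultimately have "norm (c (- 1) * c 0) \<le> 0"
      by (intro LIMSEQ_le_const[of "\<lambda>n. (M * M' * (r / 4)) * (1 / 2) ^ n"]) auto
    then show ?thesis by simp
  qed
  have "d * (1 - x * d) = 0" unfolding e by (simp add: d_def zero)
  then have dxd: "d * x * d = d" by (simp add: right_diff_distrib mult.assoc)
  have "\<exists>C. \<forall>n. norm (x ^ n * (1 - x * d)) \<le> C * \<epsilon> ^ n" if "\<epsilon> > 0" for \<epsilon>
  proof -
    \<comment> \<open>A circle of radius at most \<open>\<epsilon>\<close> gives the rate
      \<open>\<epsilon>\<close>; the minimum keeps it inside the disc.\<close>
    define \<rho> where "\<rho> = min \<epsilon> (r / 2)"
    have \<rho>: "0 < \<rho>" "\<rho> < r" "\<rho> \<le> \<epsilon>" using that r_pos by (auto simp: \<rho>_def)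
    obtain M where M: "0 \<le> M" "\<And>k. norm (coef k \<rho>) \<le> M * \<rho> powi (k + 1)"
      using coef_bound[OF \<rho>(1,2)] by auto
    have "norm (x ^ n * (1 - x * d)) \<le> (M * \<rho>) * \<epsilon> ^ n" for n
    proof -
      have "norm (x ^ n * (1 - x * d)) = norm (coef (int n) \<rho>)"
        by (simp only: e pos c_eq[OF \<rho>(1,2), of "int n"])
      also have "\<dots> \<le> M * \<rho> powi (int n + 1)" by (rule M(2))
      also have "\<dots> = (M * \<rho>) * \<rho> ^ n" using \<rho>(1) by (simp add: power_int_add_1)
      also have "\<dots> \<le> (M * \<rho>) * \<epsilon> ^ n" using \<rho> M(1) by (intro mult_left_mono power_mono) auto
      finally show ?thesis .
    qed
    then show ?thesis by blast
  qed
  then have "gdrazin x d" unfolding gdrazin_def using comm dxd by blast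
  \<comment> \<open>At index \<open>- 1\<close> the power of the radius in Cauchy's estimate is 1,
    so \<open>M\<close> alone remains.\<close>
  moreover have "norm d \<le> M"
    if "0 < \<rho>" "\<rho> < r" "\<And>z. cmod z = \<rho> \<Longrightarrow> norm (R z) \<le> M" for \<rho> M
    using coef_norm_le[OF that, of "- 1"] c_eq[OF that(1,2), of "- 1"] by (simp add: d_def)
  ultimately show thesis by (rule that)
qed

end

section \<open>Quasinilpotent elements and isolated spectral points\<close>

lemma norm_resolvent_le:
  fixes x :: "'a::complex_banach_algebra"
  assumes "unit_elt (x - z *\<^sub>C 1)" "2 * norm x \<le> cmod z" "z \<noteq> 0"
  shows "norm (resolvent x z) \<le> 2 * norm (1::'a) / cmod z"
proof -
  have "cmod z * norm (resolvent x z) = norm (1 + x * resolvent x z)"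
    by (simp add: mult_resolvent[OF assms(1)] norm_scaleC)
  also have "\<dots> \<le> norm (1::'a) + norm (x * resolvent x z)" by (rule norm_triangle_ineq)
  also have "norm (x * resolvent x z) \<le> norm x * norm (resolvent x z)" by (rule norm_mult_ineq)
  also have "\<dots> \<le> (cmod z / 2) * norm (resolvent x z)" using assms(2) by (intro mult_right_mono) auto
  finally show ?thesis using assms(3) by (simp add: field_simps)
qed

text \<open>The disc may be taken arbitrarily large, where the resolvent is small. This makes
  \<open>x * d\<close> an idempotent of norm below 1, hence \<open>0\<close>, and then
  \<open>d = d x d\<close> vanishes too.\<close>

lemma gdrazin_zero:
  fixes x :: "'a::complex_banach_algebra"
  assumes "\<And>z. z \<noteq> 0 \<Longrightarrow> unit_elt (x - z *\<^sub>C 1)"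
  shows "gdrazin x 0"
proof -
  \<comment> \<open>The radius dominates \<open>2 * norm x\<close>, as the resolvent bound requires,
    and exceeds \<open>2 * norm x * norm 1\<close>, which pushes the norm of \<open>x * d\<close>
    below 1.\<close>
  define \<rho> where "\<rho> = 2 * (norm x * norm (1::'a)) + 2 * norm x + 1"
  have "0 \<le> norm x * norm (1::'a)" "0 \<le> norm x" by simp_all
  then have \<rho>: "0 < \<rho>" "2 * norm x \<le> \<rho>" "2 * (norm x * norm (1::'a)) < \<rho>"
    unfolding \<rho>_def by linarith+
  interpret isolated_zero x "\<rho> + 1"
    using assms \<rho>(1) by unfold_locales auto
  obtain d where d: "gdrazin x d"
    and le: "\<And>\<rho>' M. 0 < \<rho>' \<Longrightarrow> \<rho>' < \<rho> + 1 \<Longrightarrow> (\<And>z. cmod z = \<rho>' \<Longrightarrow> norm (R z) \<le> M) \<Longrightarrow> norm d \<le> M"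
    using gdrazin_exists by blast
  have "norm d \<le> 2 * norm (1::'a) / \<rho>"
  proof (rule le)
    fix z assume z: "cmod z = \<rho>"
    then have "z \<noteq> 0" using \<rho>(1) by auto
    then show "norm (R z) \<le> 2 * norm (1::'a) / \<rho>"
      using norm_resolvent_le[OF assms, of z] z \<rho>(2) by simp
  qed (use \<rho>(1) in auto)
  then have "norm x * norm d \<le> norm x * (2 * norm (1::'a) / \<rho>)" by (intro mult_left_mono) auto
  also have "\<dots> < 1" using \<rho> by (simp add: field_simps)
  finally have lt: "norm (x * d) < 1" using norm_mult_ineq[of x d] by linarith
  have dxd: "d * x * d = d" "x * d = d * x" using d by (auto simp: gdrazin_def)
  then have "(x * d) * (x * d) = x * d" by (metis mult.assoc)
  then have "norm (x * d) \<le> norm (x * d) * norm (x * d)" by (metis norm_mult_ineq)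
  with lt have "x * d = 0"
    using mult_strict_right_mono[OF lt, of "norm (x * d)"] by (cases "x * d = 0") auto
  then have "d = 0" using dxd(1) by (simp add: mult.assoc)
  with d show ?thesis by simp
qed

lemma unit_elt_shift_of_gdrazin_zero:
  assumes "gdrazin x 0" "z \<noteq> 0"
  shows "unit_elt (x - z *\<^sub>C 1)"
  using gdrazin_unit_shift[OF assms] by simp

lemma gdrazin_iff_isolated:
  fixes x :: "'a::complex_banach_algebra"
  shows "(\<exists>d. gdrazin x d) \<longleftrightarrow> (\<exists>r>0. \<forall>z. z \<noteq> 0 \<longrightarrow> cmod z < r \<longrightarrow> unit_elt (x - z *\<^sub>C 1))"
proof
  assume "\<exists>d. gdrazin x d"
  then obtain d where d: "gdrazin x d" by blast
  have "unit_elt (x - z *\<^sub>C 1)" if z: "z \<noteq> 0" "cmod z < 1 / (norm d + 1)" for z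
  proof (rule gdrazin_unit_shift[OF d z(1)])
    have "cmod z * (norm d + 1) < 1" using z(2) by (simp add: pos_less_divide_eq add_nonneg_pos)
    then have "cmod z * norm d + cmod z < 1" by (simp add: distrib_left)
    then show "cmod z * norm d < 1" using norm_ge_zero[of z] by linarith
  qed
  moreover have "0 < 1 / (norm d + 1)" by (simp add: add_nonneg_pos)
  ultimately show "\<exists>r>0. \<forall>z. z \<noteq> 0 \<longrightarrow> cmod z < r \<longrightarrow> unit_elt (x - z *\<^sub>C 1)" by blast
next
  assume "\<exists>r>0. \<forall>z. z \<noteq> 0 \<longrightarrow> cmod z < r \<longrightarrow> unit_elt (x - z *\<^sub>C 1)"
  then obtain r where "isolated_zero x r" by (auto simp: isolated_zero_def)
  then show "\<exists>d. gdrazin x d" by (meson isolated_zero.gdrazin_exists)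
qed

section \<open>Operators\<close>

subsection \<open>The Banach algebra of operators\<close>

text \<open>A one-parameter copy of the operators from a space to itself, so that composition can be
  the multiplication of a type class.\<close>

typedef (overloaded) 'a endo = "UNIV :: ('a::complex_banach \<Rightarrow>\<^sub>B 'a) set"
  morphisms op_of Endo ..

setup_lifting type_definition_endo

lemma ccompose_assoc: "R o\<^sub>C (S o\<^sub>C T) = R o\<^sub>C S o\<^sub>C T"
  by (rule capply_eqI) (simp add: capply_ccompose)

lemma ccompose_algebra:
  "cid o\<^sub>C T = T" "T o\<^sub>C cid = T"
  "(F + F') o\<^sub>C G = (F o\<^sub>C G) + (F' o\<^sub>C G)" "F o\<^sub>C (G + G') = (F o\<^sub>C G) + (F o\<^sub>C G')"
  "(c *\<^sub>C F) o\<^sub>C G = c *\<^sub>C (F o\<^sub>C G)" "F o\<^sub>C (c *\<^sub>C G) = c *\<^sub>C (F o\<^sub>C G)"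
  by (rule capply_eqI; simp add: capply_ccompose capply_cid capply_plus capply_scaleC
      clinear_add[OF clinear_capply] clinear_scaleC[OF clinear_capply])+

instantiation endo :: (complex_banach) complex_normed_vector
begin

lift_definition zero_endo :: "'a endo" is 0 .
lift_definition plus_endo :: "'a endo \<Rightarrow> 'a endo \<Rightarrow> 'a endo" is "(+)" .
lift_definition minus_endo :: "'a endo \<Rightarrow> 'a endo \<Rightarrow> 'a endo" is "(-)" .
lift_definition uminus_endo :: "'a endo \<Rightarrow> 'a endo" is uminus .

lift_definition scaleR_endo :: "real \<Rightarrow> 'a endo \<Rightarrow> 'a endo" is "(*\<^sub>R)" .
lift_definition scaleC_endo :: "complex \<Rightarrow> 'a endo \<Rightarrow> 'a endo" is "(*\<^sub>C)" .
lift_definition norm_endo :: "'a endo \<Rightarrow> real" is norm .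
definition "sgn_endo (a :: 'a endo) = inverse (norm a) *\<^sub>R a"
definition "dist_endo (a :: 'a endo) b = norm (a - b)"
definition "uniformity_endo = (INF e\<in>{0<..}. principal {(a :: 'a endo, b). dist a b < e})"
definition "open_endo (U :: 'a endo set) =
  (\<forall>a\<in>U. \<forall>\<^sub>F (a', b) in uniformity. a' = a \<longrightarrow> b \<in> U)"

instance
proof
  fix a b c :: "'a endo" and z w :: complex and r s :: real and U :: "'a endo set"
  show "a + b + c = a + (b + c)" "a + b = b + a" "0 + a = a" "- a + a = 0" "a - b = a + - b"
    by (transfer; simp add: ac_simps)+
  show "r *\<^sub>R (a + b) = r *\<^sub>R a + r *\<^sub>R b" "(r + s) *\<^sub>R a = r *\<^sub>R a + s *\<^sub>R a"
    "r *\<^sub>R s *\<^sub>R a = (r * s) *\<^sub>R a" "1 *\<^sub>R a = a"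
    by (transfer; simp add: algebra_simps)+
  show "z *\<^sub>C (a + b) = z *\<^sub>C a + z *\<^sub>C b" "(z + w) *\<^sub>C a = z *\<^sub>C a + w *\<^sub>C a"
    "z *\<^sub>C w *\<^sub>C a = (z * w) *\<^sub>C a" "1 *\<^sub>C a = a"
    by (transfer; simp add: scaleC_add_right scaleC_add_left)+
  show "r *\<^sub>R a = complex_of_real r *\<^sub>C a" by transfer (rule scaleR_scaleC)
  show "norm (z *\<^sub>C a) = cmod z * norm a" by transfer (rule norm_scaleC)
  show "norm a = 0 \<longleftrightarrow> a = 0" by transfer simp
  show "norm (a + b) \<le> norm a + norm b" by transfer (rule norm_triangle_ineq)
  show "norm (r *\<^sub>R a) = \<bar>r\<bar> * norm a" by transfer simp
  show "dist a b = norm (a - b)" by (rule dist_endo_def)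
  show "sgn a = inverse (norm a) *\<^sub>R a" by (rule sgn_endo_def)
  show "uniformity = (INF e\<in>{0<..}. principal {(a :: 'a endo, b). dist a b < e})"
    by (rule uniformity_endo_def)
  show "open U \<longleftrightarrow> (\<forall>a\<in>U. \<forall>\<^sub>F (a', b) in uniformity. a' = a \<longrightarrow> b \<in> U)"
    by (rule open_endo_def)
qed

end

instance endo :: (complex_banach) complex_banach
proof
  fix X :: "nat \<Rightarrow> 'a endo"
  have dist: "dist a b = dist (op_of a) (op_of b)" for a b :: "'a endo"
    by (simp add: dist_endo_def dist_norm norm_endo.rep_eq minus_endo.rep_eq)
  assume "Cauchy X"
  then have "Cauchy (\<lambda>n. op_of (X n))" by (simp add: Cauchy_def dist)
  then obtain L where "(\<lambda>n. op_of (X n)) \<longlonglongrightarrow> L"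
    using Cauchy_convergent_iff convergent_def by blast
  then have "X \<longlonglongrightarrow> Endo L"
    unfolding tendsto_iff by (simp add: dist Endo_inverse)
  then show "convergent X" by (rule convergentI)
qed

instantiation endo :: (complex_banach) complex_banach_algebra
begin

lift_definition one_endo :: "'a endo" is cid .
lift_definition times_endo :: "'a endo \<Rightarrow> 'a endo \<Rightarrow> 'a endo" is "(o\<^sub>C)" .

instance
proof
  fix a b c :: "'a endo" and z :: complex and r :: real
  show "a * b * c = a * (b * c)" "1 * a = a" "a * 1 = a"
    "(a + b) * c = a * c + b * c" "a * (b + c) = a * b + a * c"
    "(z *\<^sub>C a) * b = z *\<^sub>C (a * b)" "a * (z *\<^sub>C b) = z *\<^sub>C (a * b)"
    by (transfer; simp add: ccompose_assoc ccompose_algebra)+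
  show "(r *\<^sub>R a) * b = r *\<^sub>R (a * b)" "a * (r *\<^sub>R b) = r *\<^sub>R (a * b)"
    by (transfer; simp add: ccompose_algebra scaleR_scaleC)+
  show "norm (a * b) \<le> norm a * norm b" by transfer (rule norm_ccompose)
qed

end

lemma op_of_Endo: "op_of (Endo T) = T"
  by (simp add: Endo_inverse)

lemma op_of_eq_iff: "a = b \<longleftrightarrow> op_of a = op_of b"
  by (simp add: op_of_inject)

lemmas op_of_simps = op_of_Endo zero_endo.rep_eq one_endo.rep_eq plus_endo.rep_eq minus_endo.rep_eq
  times_endo.rep_eq scaleC_endo.rep_eq

lemma invertible_op_iff: "invertible_op T \<longleftrightarrow> unit_elt (Endo T)"
proof
  assume "invertible_op T"
  then obtain S where "S o\<^sub>C T = cid" "T o\<^sub>C S = cid" by (auto simp: invertible_op_def)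
  then show "unit_elt (Endo T)"
    by (intro unit_eltI[of _ "Endo S" "Endo S"]) (simp_all add: op_of_eq_iff op_of_simps)
next
  assume "unit_elt (Endo T)"
  then obtain b where "Endo T * b = 1" "b * Endo T = 1" by (auto simp: unit_elt_def)
  then show "invertible_op T"
    unfolding invertible_op_def by (intro exI[of _ "op_of b"]) (simp add: op_of_eq_iff op_of_simps)
qed

lemma spectrum_iff: "z \<in> spectrum T \<longleftrightarrow> \<not> unit_elt (Endo T - z *\<^sub>C 1)"
proof -
  have "Endo (T - z *\<^sub>C cid) = Endo T - z *\<^sub>C 1" by (simp add: op_of_eq_iff op_of_simps)
  then show ?thesis by (simp add: spectrum_def invertible_op_iff)
qed

lemma zero_in_spectrum_iff: "0 \<in> spectrum T \<longleftrightarrow> \<not> unit_elt (Endo T)"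
  by (simp add: spectrum_iff)

lemma iso_spectrum_iff: "0 \<in> iso_spectrum T \<longleftrightarrow> \<not> unit_elt (Endo T) \<and> (\<exists>d. gdrazin (Endo T) d)"
proof -
  have "(\<forall>y\<in>spectrum T. dist 0 y < e \<longrightarrow> y = 0) \<longleftrightarrow> (\<forall>z. z \<noteq> 0 \<longrightarrow> cmod z < e \<longrightarrow> unit_elt (Endo T - z *\<^sub>C 1))" for e
    unfolding Ball_def spectrum_iff dist_0_norm by blast
  then show ?thesis
    unfolding iso_spectrum_def mem_Collect_eq isolated_in_dist_Ex_iff zero_in_spectrum_iff gdrazin_iff_isolated
    by simp
qed

lemma spectrum_eq_zero_iff: "spectrum T = {0} \<longleftrightarrow> \<not> unit_elt (Endo T) \<and> gdrazin (Endo T) 0"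
proof
  assume *: "spectrum T = {0}"
  then have "unit_elt (Endo T - z *\<^sub>C 1)" if "z \<noteq> 0" for z
    using that spectrum_iff[of z T] by auto
  then show "\<not> unit_elt (Endo T) \<and> gdrazin (Endo T) 0"
    using * zero_in_spectrum_iff[of T] gdrazin_zero by blast
next
  assume *: "\<not> unit_elt (Endo T) \<and> gdrazin (Endo T) 0"
  then have "z \<in> spectrum T \<longleftrightarrow> z = 0" for z
    using unit_elt_shift_of_gdrazin_zero[of "Endo T" z] spectrum_iff[of z T] zero_in_spectrum_iff[of T] by blast
  then show "spectrum T = {0}" by blast
qed

subsection \<open>Poles and Drazin inverses\<close>

lemma capply_op_of_power: "capply (op_of (a ^ n)) x = (capply (op_of a) ^^ n) x"
  by (induction n arbitrary: x) (simp_all add: op_of_simps capply_cid capply_ccompose)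

lemma nilpotent_op_iff: "nilpotent_op T \<longleftrightarrow> (\<exists>k. Endo T ^ k = 0)"
proof -
  have "(\<forall>x. (capply T ^^ k) x = 0) \<longleftrightarrow> Endo T ^ k = 0" for k
  proof -
    have "(capply T ^^ k) x = capply (op_of (Endo T ^ k)) x" for x
      by (simp add: capply_op_of_power op_of_Endo)
    then show ?thesis by (auto simp: op_of_eq_iff op_of_simps capply_zero intro!: capply_eqI)
  qed
  then show ?thesis by (simp add: nilpotent_op_def)
qed

lemma ascent_finite_iff:
  "ascent T < \<infinity> \<longleftrightarrow> (\<exists>n. null_space (capply T ^^ n) = null_space (capply T ^^ Suc n))"
  unfolding ascent_def Inf_less_iff by auto

lemma descent_finite_iff: "descent T < \<infinity> \<longleftrightarrow> (\<exists>n. range (capply T ^^ n) = range (capply T ^^ Suc n))"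
  unfolding descent_def Inf_less_iff by auto

text \<open>\<open>T ^ k\<close> factors as \<open>T ^ (k + 1) d\<close> and as
  \<open>d T ^ (k + 1)\<close>: the first stabilises the ranges, the second the null spaces.\<close>

lemma drazin_imp_finite_chains:
  assumes "drazin (Endo T) d"
  shows "ascent T < \<infinity>" "descent T < \<infinity>"
proof -
  obtain k where k: "Endo T ^ k * (1 - Endo T * d) = 0" and comm: "Endo T * d = d * Endo T"
    using assms by (auto simp: drazin_def)
  have right: "Endo T ^ k = Endo T ^ Suc k * d"
    using k by (simp add: right_diff_distrib power_commutes flip: mult.assoc)
  moreover have "d * Endo T ^ Suc k = Endo T ^ Suc k * d"
    using comm by (metis power_commuting_commutes)
  ultimately have left: "Endo T ^ k = d * Endo T ^ Suc k" by simp
  let ?f = "capply T"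
  have pow: "(?f ^^ n) x = capply (op_of (Endo T ^ n)) x" for n x
    by (simp add: capply_op_of_power op_of_Endo)
  have 1: "(?f ^^ k) x = (?f ^^ Suc k) (capply (op_of d) x)" for x
    unfolding pow by (subst right) (simp add: op_of_simps capply_ccompose)
  have 2: "(?f ^^ k) x = capply (op_of d) ((?f ^^ Suc k) x)" for x
    unfolding pow by (subst left) (simp add: op_of_simps capply_ccompose)
  have "null_space (?f ^^ k) = null_space (?f ^^ Suc k)"
    unfolding null_space_def
  proof (rule Collect_cong, rule iffI)
    fix x
    show "(?f ^^ Suc k) x = 0" if "(?f ^^ k) x = 0" using that capply_diff[of T 0 0] by simp
    show "(?f ^^ k) x = 0" if "(?f ^^ Suc k) x = 0" using 2[of x] that capply_diff[of "op_of d" 0 0] by simp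
  qed
  then show "ascent T < \<infinity>" unfolding ascent_finite_iff by blast
  have "range (?f ^^ k) = range (?f ^^ Suc k)"
  proof
    show "range (?f ^^ k) \<subseteq> range (?f ^^ Suc k)" using 1 by (metis image_subsetI rangeI)
    show "range (?f ^^ Suc k) \<subseteq> range (?f ^^ k)" by (auto simp: funpow_swap1)
  qed
  then show "descent T < \<infinity>" unfolding descent_finite_iff by blast
qed

lemma funpow_null_stable:
  fixes f :: "'a::zero \<Rightarrow> 'a"
  assumes "null_space (f ^^ m) = null_space (f ^^ Suc m)" "(f ^^ (m + j)) x = 0"
  shows "(f ^^ m) x = 0"
  using assms(2)
proof (induction j arbitrary: x)
  case (Suc j)
  have "(f ^^ (m + j)) (f x) = 0" using Suc.prems by (simp add: funpow_swap1)
  then have "(f ^^ m) (f x) = 0" by (rule Suc.IH)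
  then have "x \<in> null_space (f ^^ Suc m)" by (simp add: null_space_def funpow_swap1)
  then show ?case using assms(1) by (auto simp: null_space_def)
qed simp

lemma funpow_range_stable:
  fixes f :: "'a \<Rightarrow> 'a"
  assumes "range (f ^^ n) = range (f ^^ Suc n)"
  shows "\<exists>y. (f ^^ n) x = (f ^^ (n + j)) y"
proof (induction j)
  case (Suc j)
  then obtain y where y: "(f ^^ n) x = (f ^^ (n + j)) y" by blast
  have "(f ^^ n) y \<in> range (f ^^ Suc n)" using assms by blast
  then obtain y' where y': "(f ^^ n) y = (f ^^ Suc n) y'" by blast
  have "(f ^^ (n + j)) y = (f ^^ j) ((f ^^ n) y)" by (simp only: add.commute[of n j] funpow_add o_apply)
  also have "\<dots> = (f ^^ (j + Suc n)) y'" by (simp only: y' funpow_add o_apply)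
  also have "j + Suc n = n + Suc j" by simp
  finally show ?case using y by auto
qed auto

text \<open>If \<open>S = T ^ p\<close> has the same null space and range as \<open>S ^ 2\<close>, then the space is the direct sum
  of both; the Drazin inverse inverts \<open>T\<close> on the range and kills the null space. Its boundedness is
  the open mapping theorem for \<open>(u, v) \<mapsto> u + S v\<close>.\<close>

lemma finite_chains_imp_drazin:
  fixes T :: "'a::complex_banach \<Rightarrow>\<^sub>B 'a"
  assumes "ascent T < \<infinity>" "descent T < \<infinity>"
  obtains d where "drazin (Endo T) d"
proof -
  define t where "t = Endo T"
  let ?f = "capply T"
  obtain m where m: "null_space (?f ^^ m) = null_space (?f ^^ Suc m)"
    using assms(1) ascent_finite_iff by blast
  obtain n where n: "range (?f ^^ n) = range (?f ^^ Suc n)"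
    using assms(2) descent_finite_iff by blast
  define q where "q = max m n"
  \<comment> \<open>One more than needed for both chains to be stable, so that a factor
    \<open>T\<close> can be split off from \<open>S = T ^ p\<close>.\<close>
  define p where "p = Suc q"
  have pow: "capply (op_of (t ^ k)) = ?f ^^ k" for k
    by (rule ext) (simp add: capply_op_of_power t_def op_of_Endo)
  define S where "S = capply (op_of (t ^ p))"
  have S_pow: "S = ?f ^^ p" unfolding S_def by (rule pow)
  have S_bl: "bounded_linear S" unfolding S_def by (rule bounded_linear_capply)
  have S_lin: "clinear S" unfolding S_def by (rule clinear_capply)
  note S_simps = clinear_add[OF S_lin] clinear_scaleC[OF S_lin] capply_diff[of "op_of (t ^ p)", folded S_def]
  have f_simps: "?f (x + y) = ?f x + ?f y" "?f (c *\<^sub>C x) = c *\<^sub>C ?f x" "?f (x - y) = ?f x - ?f y" "?f 0 = 0" for x y c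
    using capply_diff[of T 0 0] by (simp_all add: clinear_add[OF clinear_capply] clinear_scaleC[OF clinear_capply] capply_diff)
  have S0: "S 0 = 0" using S_simps(3)[of 0 0] by simp
  have fS: "?f (S x) = S (?f x)" for x by (simp add: S_pow funpow_swap1)
  have SS: "S (S x) = (?f ^^ (p + p)) x" for x by (simp add: S_pow funpow_add)
  have f0: "(?f ^^ j) 0 = 0" for j by (induction j) (simp_all add: f_simps)
  have null: "S x = 0" if "S (S x) = 0" for x
  proof -
    have "(?f ^^ (m + (p + p - m))) x = 0" using that by (simp add: SS p_def q_def)
    then have "(?f ^^ m) x = 0" by (rule funpow_null_stable[OF m])
    then have "(?f ^^ (p - m + m)) x = 0" by (simp only: funpow_add o_apply f0)
    then show ?thesis by (simp add: S_pow p_def q_def)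
  qed
  have range: "\<exists>y. S x = S (S y)" for x
  proof -
    obtain y where y: "(?f ^^ n) x = (?f ^^ (n + p)) y" using funpow_range_stable[OF n] by blast
    have p: "p - n + n = p" "p - n + (n + p) = p + p" by (simp_all add: p_def q_def)
    have "S x = (?f ^^ (p - n + n)) x" by (simp only: S_pow p)
    also have "\<dots> = (?f ^^ (p - n + (n + p))) y" by (simp only: funpow_add o_apply y)
    also have "\<dots> = S (S y)" by (simp only: SS p)
    finally show ?thesis by blast
  qed
  define E where "E = {x. S x = 0} \<times> (UNIV :: 'a set)"
  obtain C where C: "0 \<le> C" "\<And>z. \<exists>e\<in>E. fst e + S (snd e) = z \<and> norm e \<le> C * norm z"
  proof (rule open_mapping)
    show "bounded_linear (\<lambda>e. fst e + S (snd e))"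
      by (intro bounded_linear_add bounded_linear_fst bounded_linear_compose[OF S_bl bounded_linear_snd])
    show "subspace E"
      unfolding E_def subspace_def by (auto simp: zero_prod_def S_simps(1) S0 scaleR_scaleC S_simps(2))
    show "closed E"
      unfolding E_def
      by (intro closed_Times closed_Collect_eq linear_continuous_on[OF S_bl] continuous_on_const closed_UNIV)
    have "\<exists>e\<in>E. z = fst e + S (snd e)" for z
    proof -
      obtain y where "S z = S (S y)" using range by blast
      then show ?thesis by (intro bexI[of _ "(z - S y, y)"]) (auto simp: E_def S_simps(3))
    qed
    then show "(\<lambda>e. fst e + S (snd e)) ` E = UNIV" by (auto simp: image_iff)
  qed blast
  have split: "\<exists>v. S (z - S v) = 0 \<and> norm v \<le> C * norm z" for z
  proof -
    obtain e where e: "e \<in> E" "fst e + S (snd e) = z" "norm e \<le> C * norm z" using C(2) by blast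
    have "norm (snd e) \<le> norm e" using norm_snd_le[of "snd e" "fst e"] by simp
    moreover have "z - S (snd e) = fst e" using e(2) by (simp add: algebra_simps)
    ultimately show ?thesis using e by (intro exI[of _ "snd e"]) (auto simp: E_def)
  qed
  \<comment> \<open>Describes the value at \<open>z\<close> of the sought inverse: \<open>w\<close>
    lies in the range of \<open>S\<close>, and \<open>T w\<close> agrees with \<open>z\<close> up to
    the null space of \<open>S\<close>. Linearity and all algebraic identities then follow from
    uniqueness.\<close>
  define inverse_at where "inverse_at z w \<longleftrightarrow> w \<in> range S \<and> S (z - ?f w) = 0" for z w
  \<comment> \<open>\<open>T\<close> is injective on the range of \<open>S\<close>: applying
    \<open>T ^ q\<close> to \<open>T (S (S y)) = 0\<close> gives \<open>S (S (S y)) = 0\<close>, and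
    \<open>null\<close> removes the surplus factors.\<close>
  have unique: "w = w'" if w: "inverse_at z w" "inverse_at z w'" for z w w'
  proof -
    obtain v v' where v: "w = S v" "w' = S v'" using w unfolding inverse_at_def by blast
    have "S (?f w - ?f w') = 0"
      using w by (simp add: inverse_at_def S_simps(3))
    then have "?f (S (S (v - v'))) = 0" by (simp add: v f_simps S_simps(3) fS)
    then have "(?f ^^ q) (?f (S (S (v - v')))) = 0" by (simp only: f0)
    then have "S (S (S (v - v'))) = 0" by (simp add: S_pow p_def funpow_swap1)
    then have "S (v - v') = 0" using null by blast
    then show ?thesis by (simp add: v S_simps(3))
  qed
  define M where "M = norm (op_of (t ^ q * t ^ p))"
  have exists: "\<exists>w. inverse_at z w \<and> norm w \<le> (M * C * C) * norm z" for z
  proof -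
    obtain v where v: "S (z - S v) = 0" "norm v \<le> C * norm z" using split by blast
    obtain v' where v': "S (v - S v') = 0" "norm v' \<le> C * norm v" using split by blast
    \<comment> \<open>Splitting twice gives \<open>S v = S (S v')\<close>; dropping one factor
      \<open>T\<close> leaves \<open>T ^ q (S v')\<close>, which still lies in the range of
      \<open>S\<close>. Each splitting contributes a factor \<open>C\<close>.\<close>
    define w where "w = capply (op_of (t ^ q * t ^ p)) v'"
    have w: "w = (?f ^^ q) (S v')" by (simp add: w_def op_of_simps capply_ccompose pow S_pow)
    have "?f w = S (S v')" by (simp add: w S_pow p_def)
    moreover have "S v = S (S v')" using v'(1) by (simp add: S_simps(3))
    ultimately have "S (z - ?f w) = 0" using v(1) by simp
    moreover have "w = S ((?f ^^ q) v')"
      unfolding w S_pow by (metis add.commute funpow_add o_apply)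
    ultimately have inv: "inverse_at z w" by (auto simp: inverse_at_def)
    have "norm w \<le> M * norm v'" unfolding w_def M_def by (rule norm_capply)
    also have "norm v' \<le> C * (C * norm z)"
      by (rule order_trans[OF v'(2) mult_left_mono[OF v(2) C(1)]])
    finally have "norm w \<le> M * (C * (C * norm z))" by (simp add: M_def mult_left_mono)
    with inv show ?thesis by (auto simp: mult.assoc)
  qed
  then obtain D where D: "\<And>z. inverse_at z (D z)" "\<And>z. norm (D z) \<le> (M * C * C) * norm z" by metis
  have "clinear D"
  proof (rule clinearI)
    fix x y c
    have "inverse_at (x + y) (D x + D y)"
      using D(1)[of x] D(1)[of y] S_simps(1)[of "x - ?f (D x)" "y - ?f (D y)"]
      by (auto simp: inverse_at_def f_simps algebra_simps simp flip: S_simps(1))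
    then show "D (x + y) = D x + D y" using unique D(1) by blast
    have "inverse_at (c *\<^sub>C x) (c *\<^sub>C D x)"
      using D(1)[of x] S_simps(2)[of c "x - ?f (D x)"]
      by (auto simp: inverse_at_def f_simps cvs.scale_right_diff_distrib simp flip: S_simps(2))
    then show "D (c *\<^sub>C x) = c *\<^sub>C D x" using unique D(1) by blast
  qed
  then have D_apply: "capply (CBlinfun (Blinfun D)) = D" using D(2) by (rule capply_CBlinfun_Blinfun)
  define d where "d = Endo (CBlinfun (Blinfun D))"
  have d: "capply (op_of d) = D" by (simp add: d_def op_of_Endo D_apply)
  have t: "capply (op_of t) = ?f" by (simp add: t_def op_of_Endo)
  have eqI: "a = b" if "\<And>z. capply (op_of a) z = capply (op_of b) z" for a b :: "'a endo"
    using that by (simp add: op_of_eq_iff capply_eqI)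
  have "drazin t d"
    unfolding drazin_def
  proof (intro conjI exI)
    have "?f (D z) = D (?f z)" for z
    proof (rule unique)
      show "inverse_at (?f z) (?f (D z))"
        using D(1)[of z] by (auto simp: inverse_at_def fS f_simps simp flip: f_simps(3)) (metis fS f_simps(3,4))
    qed (rule D(1))
    then show "t * d = d * t" by (intro eqI) (simp add: op_of_simps capply_ccompose d t)
    have "D (?f (D z)) = D z" for z
    proof (rule unique)
      show "inverse_at (?f (D z)) (D z)" using D(1)[of z] by (auto simp: inverse_at_def S0)
    qed (rule D(1))
    then show "d * t * d = d" by (intro eqI) (simp add: op_of_simps capply_ccompose d t)
    show "t ^ p * (1 - t * d) = 0"
      by (intro eqI) (use D(1) in \<open>simp add: op_of_simps capply_ccompose capply_minus capply_cid capply_zero d t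
          inverse_at_def flip: S_def\<close>)
  qed
  then show thesis using that by (simp add: t_def)
qed

lemma poles_iff: "0 \<in> poles T \<longleftrightarrow> \<not> unit_elt (Endo T) \<and> (\<exists>d. drazin (Endo T) d)"
  unfolding poles_def mem_Collect_eq zero_in_spectrum_iff
  by (simp only: cvs.scale_zero_left diff_zero) (metis drazin_imp_finite_chains finite_chains_imp_drazin)

section \<open>Tensor products and multiplication operators\<close>

definition rapid :: "(nat \<Rightarrow> real) \<Rightarrow> bool"
  where "rapid u \<longleftrightarrow> (\<forall>\<epsilon>>0. \<exists>C. \<forall>n. u n \<le> C * \<epsilon> ^ n)"

lemma gdrazin_rapid: "gdrazin x d \<longleftrightarrow> x * d = d * x \<and> d * x * d = d \<and> rapid (\<lambda>n. norm (x ^ n * (1 - x * d)))"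
  by (simp add: gdrazin_def rapid_def)

lemma rapid_mono: "rapid u \<Longrightarrow> (\<And>n. v n \<le> u n) \<Longrightarrow> rapid v"
  unfolding rapid_def by (meson order_trans)

lemma rapid_add:
  assumes "rapid u" "rapid v"
  shows "rapid (\<lambda>n. u n + v n)"
  unfolding rapid_def
proof (intro allI impI)
  fix \<epsilon> :: real assume "0 < \<epsilon>"
  then obtain C D where "\<And>n. u n \<le> C * \<epsilon> ^ n" "\<And>n. v n \<le> D * \<epsilon> ^ n"
    using assms unfolding rapid_def by meson
  then have "u n + v n \<le> (C + D) * \<epsilon> ^ n" for n
    by (simp add: distrib_right add_mono)
  then show "\<exists>C. \<forall>n. u n + v n \<le> C * \<epsilon> ^ n" by blast
qed

lemma rapid_mult:
  assumes u: "rapid u" and v: "\<And>n. v n \<le> K * L ^ n" and nonneg: "\<And>n. 0 \<le> u n" "\<And>n. 0 \<le> v n" "0 \<le> L"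
  shows "rapid (\<lambda>n. u n * v n)"
  unfolding rapid_def
proof (intro allI impI)
  fix \<epsilon> :: real assume "0 < \<epsilon>"
  \<comment> \<open>The rate is lowered to absorb the growth \<open>L\<close>; the
    \<open>+ 1\<close> covers \<open>L = 0\<close>.\<close>
  then have \<epsilon>: "0 < \<epsilon> / (L + 1)" using nonneg(3) by simp
  then obtain C where C: "\<And>n. u n \<le> C * (\<epsilon> / (L + 1)) ^ n"
    using u unfolding rapid_def by meson
  have CK: "0 \<le> C" "0 \<le> K"
    using order_trans[OF nonneg(1) C, of 0] order_trans[OF nonneg(2) v, of 0] by simp_all
  have "\<epsilon> / (L + 1) * L \<le> \<epsilon>" using \<open>0 < \<epsilon>\<close> nonneg(3) by (simp add: field_simps)
  have "u n * v n \<le> (C * K) * \<epsilon> ^ n" for n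
  proof -
    have "u n * v n \<le> (C * (\<epsilon> / (L + 1)) ^ n) * (K * L ^ n)"
      using C v nonneg CK \<epsilon> by (intro mult_mono) auto
    also have "\<dots> = (C * K) * (\<epsilon> / (L + 1) * L) ^ n" by (simp only: power_mult_distrib mult_ac)
    also have "\<dots> \<le> (C * K) * \<epsilon> ^ n"
      using \<open>\<epsilon> / (L + 1) * L \<le> \<epsilon>\<close> mult_nonneg_nonneg[OF less_imp_le[OF \<epsilon>] nonneg(3)] CK
      by (intro mult_left_mono power_mono) auto
    finally show ?thesis .
  qed
  then show "\<exists>C. \<forall>n. u n * v n \<le> C * \<epsilon> ^ n" by blast
qed

section \<open>Inverses under a nondegenerate bilinear representation\<close>

text \<open>As \<open>U \<mapsto> A U B\<close> reverses products in \<open>B\<close>, multiplicativity is only required for commuting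
  elements.\<close>

locale cross_rep =
  fixes \<Theta> :: "'a::complex_banach_algebra \<Rightarrow> 'b::complex_banach_algebra \<Rightarrow> 'c::complex_banach_algebra"
  assumes add_left: "\<Theta> (a + a') b = \<Theta> a b + \<Theta> a' b"
    and add_right: "\<Theta> a (b + b') = \<Theta> a b + \<Theta> a b'"
    and norm_le: "norm (\<Theta> a b) \<le> norm a * norm b"
    and one: "\<Theta> 1 1 = 1"
    and mult: "a * a' = a' * a \<Longrightarrow> b * b' = b' * b \<Longrightarrow> \<Theta> a b * \<Theta> a' b' = \<Theta> (a * a') (b * b')"
    and nondegenerate: "\<Theta> a b = 0 \<Longrightarrow> a = 0 \<or> b = 0"
    and nontrivial: "(1::'a) \<noteq> 0" "(1::'b) \<noteq> 0"
begin

text \<open>Requiring commutation in both arguments keeps the locale symmetric, so each alternative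
  with the roles of \<open>A\<close> and \<open>B\<close> exchanged is the same statement for the
  swapped map.\<close>

lemma swap: "cross_rep (\<lambda>b a. \<Theta> a b)"
proof
  fix a a' b b'
  show "norm (\<Theta> b a) \<le> norm a * norm b" using norm_le[of b a] by (simp add: mult.commute)
  show "\<Theta> b a * \<Theta> b' a' = \<Theta> (b * b') (a * a')" if "a * a' = a' * a" "b * b' = b' * b"
    by (rule mult[OF that(2,1)])
  show "a = 0 \<or> b = 0" if "\<Theta> b a = 0" using nondegenerate[OF that] by blast
qed (rule add_left add_right one nontrivial)+

lemma diff_left: "\<Theta> (a - a') b = \<Theta> a b - \<Theta> a' b"
  using add_left[of "a - a'" a' b] by simp

lemma diff_right: "\<Theta> a (b - b') = \<Theta> a b - \<Theta> a b'"
  using add_right[of a "b - b'" b'] by simp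

lemma zero_left: "\<Theta> 0 b = 0"
  using diff_left[of 0 0 b] by simp

lemma zero_right: "\<Theta> a 0 = 0"
  using diff_right[of a 0 0] by simp

lemma power: "\<Theta> a b ^ n = \<Theta> (a ^ n) (b ^ n)"
  by (induction n) (simp_all add: one mult power_commutes)

lemma complement:
  assumes "a * d = d * a" "b * f = f * b"
  shows "\<Theta> a b ^ n * (1 - \<Theta> a b * \<Theta> d f)
    = \<Theta> (a ^ n * (1 - a * d)) (b ^ n) + \<Theta> (a ^ n * (a * d)) (b ^ n * (1 - b * f))"
proof -
  have comm: "a ^ n * (a * d) = (a * d) * a ^ n" "b ^ n * (b * f) = (b * f) * b ^ n"
    using assms by (metis mult.assoc power_commuting_commutes power_commutes)+
  have "1 - \<Theta> a b * \<Theta> d f = \<Theta> (1 - a * d) 1 + \<Theta> (a * d) (1 - b * f)"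
    by (simp add: mult[OF assms] diff_left diff_right one)
  then show ?thesis
    using comm by (simp add: power distrib_left mult right_diff_distrib left_diff_distrib)
qed

lemma gdrazin_rep:
  assumes a: "gdrazin a d" and b: "gdrazin b f"
  shows "gdrazin (\<Theta> a b) (\<Theta> d f)"
  unfolding gdrazin_rapid
proof (intro conjI)
  have ad: "a * d = d * a" "d * a * d = d" and bf: "b * f = f * b" "f * b * f = f"
    using a b by (auto simp: gdrazin_def)
  show "\<Theta> a b * \<Theta> d f = \<Theta> d f * \<Theta> a b"
    by (simp add: mult ad(1) bf(1))
  have "(d * a) * d = d * (d * a)" "(f * b) * f = f * (f * b)"
    using ad bf by (simp_all add: mult.assoc)
  then show "\<Theta> d f * \<Theta> a b * \<Theta> d f = \<Theta> d f"
    using ad bf by (simp add: mult)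
  \<comment> \<open>In each summand of \<open>complement\<close> one factor decays rapidly and the
    other grows at most geometrically.\<close>
  have "rapid (\<lambda>n. norm (a ^ n * (1 - a * d)) * norm (b ^ n))"
    by (rule rapid_mult[OF _ norm_power_le]) (use a in \<open>auto simp: gdrazin_rapid\<close>)
  moreover have "rapid (\<lambda>n. norm (b ^ n * (1 - b * f)) * norm (a ^ n * (a * d)))"
  proof (rule rapid_mult)
    show "norm (a ^ n * (a * d)) \<le> (norm (1::'a) * norm (a * d)) * norm a ^ n" for n
      using order_trans[OF norm_mult_ineq[of "a ^ n" "a * d"] mult_right_mono[OF norm_power_le norm_ge_zero]]
      by (simp add: mult_ac)
  qed (use b in \<open>auto simp: gdrazin_rapid\<close>)
  ultimately have "rapid (\<lambda>n. norm (a ^ n * (1 - a * d)) * norm (b ^ n)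
      + norm (b ^ n * (1 - b * f)) * norm (a ^ n * (a * d)))"
    by (rule rapid_add)
  then show "rapid (\<lambda>n. norm (\<Theta> a b ^ n * (1 - \<Theta> a b * \<Theta> d f)))"
  proof (rule rapid_mono)
    fix n
    have "norm (\<Theta> a b ^ n * (1 - \<Theta> a b * \<Theta> d f))
        \<le> norm (\<Theta> (a ^ n * (1 - a * d)) (b ^ n)) + norm (\<Theta> (a ^ n * (a * d)) (b ^ n * (1 - b * f)))"
      unfolding complement[OF ad(1) bf(1)] by (rule norm_triangle_ineq)
    also have "\<dots> \<le> norm (a ^ n * (1 - a * d)) * norm (b ^ n) + norm (a ^ n * (a * d)) * norm (b ^ n * (1 - b * f))"
      by (intro add_mono norm_le)
    finally show "norm (\<Theta> a b ^ n * (1 - \<Theta> a b * \<Theta> d f))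
        \<le> norm (a ^ n * (1 - a * d)) * norm (b ^ n) + norm (b ^ n * (1 - b * f)) * norm (a ^ n * (a * d))"
      by (simp add: mult.commute)
  qed
qed

lemma drazin_rep:
  assumes a: "drazin a d" and b: "drazin b f"
  shows "drazin (\<Theta> a b) (\<Theta> d f)"
proof -
  obtain k l where k: "a ^ k * (1 - a * d) = 0" and l: "b ^ l * (1 - b * f) = 0"
    using a b by (auto simp: drazin_def)
  have "a ^ max k l * (1 - a * d) = 0" "b ^ max k l * (1 - b * f) = 0"
    by (rule power_mult_mono_zero[OF k] power_mult_mono_zero[OF l]; simp)+
  then have "\<Theta> a b ^ max k l * (1 - \<Theta> a b * \<Theta> d f) = 0"
    using a b complement[of a d b f "max k l"] by (simp add: drazin_def zero_left zero_right)
  then show ?thesis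
    using gdrazin_rep[OF drazin_imp_gdrazin[OF a] drazin_imp_gdrazin[OF b]]
    by (auto simp: gdrazin_def drazin_def)
qed

text \<open>Here \<open>b\<close> is arbitrary: its powers grow at most geometrically, which the
  decay of \<open>a ^ n\<close> absorbs.\<close>

lemma gdrazin_rep_zero:
  assumes "gdrazin a 0"
  shows "gdrazin (\<Theta> a b) 0"
proof -
  have "rapid (\<lambda>n. norm (a ^ n) * norm (b ^ n))"
    by (rule rapid_mult[OF _ norm_power_le]) (use assms in \<open>auto simp: gdrazin_rapid\<close>)
  then have "rapid (\<lambda>n. norm (\<Theta> a b ^ n))"
    by (rule rapid_mono) (simp add: power norm_le)
  then show ?thesis by (simp add: gdrazin_rapid)
qed

lemma not_unit_rep_zero:
  assumes "gdrazin a 0"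
  shows "\<not> unit_elt (\<Theta> a b)"
  using gdrazin_unit[OF gdrazin_rep_zero[OF assms, of b]] nondegenerate[of 1 1] nontrivial one by auto

lemma rep_mult_complement:
  assumes ad: "a * d = d * a" "d * a * d = d" and bf: "b * f = f * b"
  shows "\<Theta> a b ^ n * (1 - \<Theta> a b * \<Theta> d f) * \<Theta> (1 - a * d) 1 = \<Theta> (a ^ n * (1 - a * d)) (b ^ n)"
proof -
  have "(a * d) * (a * d) = a * d" using ad by (metis mult.assoc)
  \<comment> \<open>Since \<open>a * d\<close> is idempotent, \<open>\<Theta> (1 - a * d) 1\<close>
    annihilates \<open>\<Theta> a b * \<Theta> d f\<close>.\<close>
  then have orth: "(a * d) * (1 - a * d) = 0" by (simp add: right_diff_distrib)
  have "(a * d) * (1 - a * d) = (1 - a * d) * (a * d)"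
    by (simp add: left_diff_distrib right_diff_distrib)
  then have "\<Theta> (a * d) (b * f) * \<Theta> (1 - a * d) 1 = 0"
    by (simp add: mult orth zero_left)
  then have "(1 - \<Theta> a b * \<Theta> d f) * \<Theta> (1 - a * d) 1 = \<Theta> (1 - a * d) 1"
    by (simp add: mult[OF ad(1) bf] left_diff_distrib)
  moreover have "a ^ n * (1 - a * d) = (1 - a * d) * a ^ n"
  proof -
    have "a * (a * d) = (a * d) * a" using ad(1) by (metis mult.assoc)
    then have "(a * d) * a ^ n = a ^ n * (a * d)" by (metis power_commuting_commutes)
    then show ?thesis by (simp add: left_diff_distrib right_diff_distrib)
  qed
  ultimately show ?thesis by (simp add: mult.assoc power mult)
qed

text \<open>The case \<open>n = 0\<close> of \<open>rep_mult_complement\<close>. Its contrapositive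
  places \<open>0\<close> in the spectrum of the product.\<close>

lemma unit_left_of_unit_rep:
  assumes a: "gdrazin a d" and b: "gdrazin b f" and unit: "unit_elt (\<Theta> a b)"
  shows "unit_elt a"
proof -
  have "\<Theta> a b * \<Theta> d f = 1" by (rule gdrazin_unit[OF gdrazin_rep[OF a b] unit])
  then have "\<Theta> (1 - a * d) 1 = 0"
    using rep_mult_complement[of a d b f 0] a b by (simp add: gdrazin_def)
  then have "a * d = 1" using nondegenerate nontrivial(2) by fastforce
  then show ?thesis using a by (auto simp: gdrazin_def intro: unit_eltI)
qed

lemma drazin_left_of_drazin_rep:
  assumes a: "gdrazin a d" and b: "gdrazin b f" and rep: "drazin (\<Theta> a b) y"
    and not_nil: "\<nexists>k. b ^ k = 0"
  shows "drazin a d"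
proof -
  obtain k where "\<Theta> a b ^ k * (1 - \<Theta> a b * \<Theta> d f) = 0"
    using gdrazin_drazin[OF gdrazin_rep[OF a b] rep] by (auto simp: drazin_def)
  then have "\<Theta> (a ^ k * (1 - a * d)) (b ^ k) = 0"
    using rep_mult_complement[of a d b f k] a b by (simp add: gdrazin_def)
  then have "a ^ k * (1 - a * d) = 0" using nondegenerate not_nil by blast
  then show ?thesis using a by (auto simp: gdrazin_def drazin_def)
qed

text \<open>Counterpart of \<open>drazin_left_of_drazin_rep\<close> for quasinilpotent
  \<open>a\<close> and arbitrary \<open>b\<close>: with inverse \<open>0\<close> the complement is
  1, so a whole power of \<open>\<Theta> a b\<close> vanishes.\<close>

lemma nilpotent_left_of_drazin_rep:
  assumes a: "gdrazin a 0" and rep: "drazin (\<Theta> a b) y" and not_nil: "\<nexists>k. b ^ k = 0"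
  shows "drazin a 0"
proof -
  obtain k where "\<Theta> a b ^ k = 0"
    using gdrazin_drazin[OF gdrazin_rep_zero[OF a] rep] by (auto simp: drazin_def)
  then have "a ^ k = 0" using nondegenerate not_nil unfolding power by blast
  then show ?thesis by (auto simp: drazin_zero_iff)
qed

end

text \<open>\<open>T\<close> stands for either of the two operators, so the six implications are
  proved once.\<close>

locale operator_cross_rep = cross_rep \<Theta>
  for \<Theta> :: "'x::complex_banach endo \<Rightarrow> 'y::complex_banach endo \<Rightarrow> 'z::complex_banach endo" +
  fixes A :: "'x \<Rightarrow>\<^sub>B 'x" and B :: "'y \<Rightarrow>\<^sub>B 'y" and T :: "'z \<Rightarrow>\<^sub>B 'z"
  assumes rep: "Endo T = \<Theta> (Endo A) (Endo B)"
begin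

lemma swap_operator: "operator_cross_rep (\<lambda>b a. \<Theta> a b) B A T"
  by (rule operator_cross_rep.intro[OF swap]) (unfold_locales, rule rep)

lemma poles_subset: "poles S \<subseteq> spectrum S" and iso_subset: "iso_spectrum S \<subseteq> spectrum S"
  by (auto simp: poles_def iso_spectrum_def isolated_in_def)

text \<open>By \<open>gdrazin_drazin\<close> the inverse \<open>0\<close> of \<open>A\<close> is a
  Drazin inverse, so \<open>A\<close> is nilpotent, and therefore \<open>T\<close> is.\<close>

lemma quasinilpotent_pole:
  assumes "spectrum A = {0}" "poles A = {0}"
  shows "spectrum T = {0} \<and> poles T = {0}"
proof -
  obtain d where a: "gdrazin (Endo A) 0" "drazin (Endo A) d"
    using assms spectrum_eq_zero_iff[of A] poles_iff[of A] by auto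
  obtain k where "Endo A ^ k = 0" using gdrazin_drazin[OF a] by (auto simp: drazin_zero_iff)
  then have "Endo T ^ k = 0" by (simp add: rep power zero_left)
  then have "drazin (Endo T) 0" by (auto simp: drazin_zero_iff)
  moreover from this have "gdrazin (Endo T) 0" by (rule drazin_imp_gdrazin)
  moreover have "\<not> unit_elt (Endo T)" unfolding rep by (rule not_unit_rep_zero[OF a(1)])
  ultimately have "spectrum T = {0}" "0 \<in> poles T"
    using spectrum_eq_zero_iff poles_iff by blast+
  then show ?thesis using poles_subset[of T] by auto
qed

lemma quasinilpotent_nonpole:
  assumes "spectrum A = {0}" "iso_nonpoles A = {0}" "\<not> nilpotent_op B"
  shows "spectrum T = {0} \<and> iso_nonpoles T = {0}"
proof -
  have a: "gdrazin (Endo A) 0" "\<not> unit_elt (Endo A)" using assms(1) spectrum_eq_zero_iff by auto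
  have "0 \<notin> poles A" using assms(2) unfolding iso_nonpoles_def by blast
  then have "\<not> drazin (Endo A) 0" using a(2) poles_iff by blast
  then have "\<not> drazin (Endo T) y" for y
    using nilpotent_left_of_drazin_rep[OF a(1)] assms(3) nilpotent_op_iff[of B] rep by auto
  then have "0 \<notin> poles T" by (simp add: poles_iff)
  moreover have T: "\<not> unit_elt (Endo T)" "gdrazin (Endo T) 0"
    unfolding rep by (rule not_unit_rep_zero[OF a(1)], rule gdrazin_rep_zero[OF a(1)])
  then have "spectrum T = {0}" "0 \<in> iso_spectrum T"
    using spectrum_eq_zero_iff iso_spectrum_iff by blast+
  ultimately show ?thesis using iso_subset[of T] by (auto simp: iso_nonpoles_def)
qed

text \<open>Invertibility and a pole at \<open>0\<close> both provide a Drazin inverse of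
  \<open>B\<close>, so the third and fifth claims need no separate treatment.\<close>

lemma pole_rep:
  assumes "0 \<in> poles A" "0 \<notin> spectrum B \<or> 0 \<in> poles B"
  shows "0 \<in> poles T"
proof -
  obtain d where a: "drazin (Endo A) d" "\<not> unit_elt (Endo A)" using assms(1) poles_iff by blast
  obtain f where b: "drazin (Endo B) f"
    using assms(2) poles_iff zero_in_spectrum_iff by (metis unit_elt_drazin)
  have "\<not> unit_elt (Endo T)"
    using unit_left_of_unit_rep[OF drazin_imp_gdrazin[OF a(1)] drazin_imp_gdrazin[OF b]] a(2) rep by auto
  then show ?thesis using drazin_rep[OF a(1) b] poles_iff rep by metis
qed

text \<open>Serves the fourth and sixth claims: every alternative for \<open>B\<close> provides a
  generalised Drazin inverse. Where non-nilpotence is not given, the next two lemmas supply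
  it.\<close>

lemma nonpole_rep:
  assumes "0 \<in> iso_nonpoles A" "0 \<notin> spectrum B \<or> 0 \<in> iso_spectrum B \<or> 0 \<in> poles B"
    "\<not> nilpotent_op B"
  shows "0 \<in> iso_nonpoles T"
proof -
  have "0 \<in> iso_spectrum A" "0 \<notin> poles A" using assms(1) by (auto simp: iso_nonpoles_def)
  then obtain d where a: "gdrazin (Endo A) d" "\<not> unit_elt (Endo A)" "\<not> drazin (Endo A) d"
    using iso_spectrum_iff poles_iff by metis
  obtain f where b: "gdrazin (Endo B) f"
    using assms(2) iso_spectrum_iff poles_iff zero_in_spectrum_iff
    by (metis unit_elt_drazin drazin_imp_gdrazin)
  have "\<not> unit_elt (Endo T)"
    using unit_left_of_unit_rep[OF a(1) b] a(2) rep by auto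
  moreover have "\<not> drazin (Endo T) y" for y
    using drazin_left_of_drazin_rep[OF a(1) b] assms(3) nilpotent_op_iff[of B] a(3) rep by auto
  moreover have "gdrazin (Endo T) (\<Theta> d f)" unfolding rep by (rule gdrazin_rep[OF a(1) b])
  ultimately show ?thesis unfolding iso_nonpoles_def using iso_spectrum_iff poles_iff by blast
qed

text \<open>On the zero space the zero operator is both invertible and nilpotent;
  \<open>nontrivial\<close> excludes this.\<close>

lemma not_nilpotent_of_invertible:
  assumes "0 \<notin> spectrum B"
  shows "\<not> nilpotent_op B"
proof
  assume "nilpotent_op B"
  then have "drazin (Endo B) 0" using nilpotent_op_iff drazin_zero_iff by blast
  then have "Endo B * 0 = 1"
    using gdrazin_unit drazin_imp_gdrazin assms zero_in_spectrum_iff by blast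
  then show False using nontrivial by simp
qed

lemma not_nilpotent_of_nonpole:
  assumes "0 \<in> iso_nonpoles B"
  shows "\<not> nilpotent_op B"
proof
  assume "nilpotent_op B"
  then have "drazin (Endo B) 0" using nilpotent_op_iff drazin_zero_iff by blast
  moreover have "\<not> unit_elt (Endo B)" using assms iso_spectrum_iff by (auto simp: iso_nonpoles_def)
  ultimately have "0 \<in> poles B" using poles_iff by blast
  then show False using assms by (simp add: iso_nonpoles_def)
qed

interpretation swapped: operator_cross_rep "\<lambda>b a. \<Theta> a b" B A T
  by (rule swap_operator)

lemma transfer_of_poles:
    "(spectrum A = {0} \<and> poles A = {0} \<or> spectrum B = {0} \<and> poles B = {0} \<longrightarrow>
       spectrum T = {0} \<and> poles T = {0})"
    "(spectrum A = {0} \<and> iso_nonpoles A = {0} \<and> \<not> nilpotent_op B \<or>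
      spectrum B = {0} \<and> iso_nonpoles B = {0} \<and> \<not> nilpotent_op A \<longrightarrow>
       spectrum T = {0} \<and> iso_nonpoles T = {0})"
    "(0 \<in> poles A \<and> 0 \<notin> spectrum B \<or> 0 \<notin> spectrum A \<and> 0 \<in> poles B \<longrightarrow> 0 \<in> poles T)"
    "(0 \<in> iso_nonpoles A \<and> spectrum A \<noteq> {0} \<and> 0 \<notin> spectrum B \<or>
      0 \<notin> spectrum A \<and> 0 \<in> iso_nonpoles B \<and> spectrum B \<noteq> {0} \<longrightarrow> 0 \<in> iso_nonpoles T)"
    "(0 \<in> poles A \<inter> poles B \<longrightarrow> 0 \<in> poles T)"
    "(0 \<in> iso_nonpoles A \<inter> poles B \<and> \<not> nilpotent_op B \<or>
      0 \<in> poles A \<inter> iso_nonpoles B \<and> \<not> nilpotent_op A \<or>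
      0 \<in> iso_nonpoles A \<inter> iso_nonpoles B \<longrightarrow> 0 \<in> iso_nonpoles T)"
proof -
  have iso: "0 \<in> iso_spectrum B" if "0 \<in> iso_nonpoles B" using that by (simp add: iso_nonpoles_def)
  show "(spectrum A = {0} \<and> poles A = {0} \<or> spectrum B = {0} \<and> poles B = {0} \<longrightarrow>
       spectrum T = {0} \<and> poles T = {0})"
    using quasinilpotent_pole swapped.quasinilpotent_pole by blast
  show "(spectrum A = {0} \<and> iso_nonpoles A = {0} \<and> \<not> nilpotent_op B \<or>
      spectrum B = {0} \<and> iso_nonpoles B = {0} \<and> \<not> nilpotent_op A \<longrightarrow>
       spectrum T = {0} \<and> iso_nonpoles T = {0})"
    using quasinilpotent_nonpole swapped.quasinilpotent_nonpole by blast
  show "(0 \<in> poles A \<and> 0 \<notin> spectrum B \<or> 0 \<notin> spectrum A \<and> 0 \<in> poles B \<longrightarrow> 0 \<in> poles T)"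
    using pole_rep swapped.pole_rep by blast
  show "(0 \<in> iso_nonpoles A \<and> spectrum A \<noteq> {0} \<and> 0 \<notin> spectrum B \<or>
      0 \<notin> spectrum A \<and> 0 \<in> iso_nonpoles B \<and> spectrum B \<noteq> {0} \<longrightarrow> 0 \<in> iso_nonpoles T)"
    using nonpole_rep swapped.nonpole_rep not_nilpotent_of_invertible swapped.not_nilpotent_of_invertible
    by blast
  show "(0 \<in> poles A \<inter> poles B \<longrightarrow> 0 \<in> poles T)"
    using pole_rep by blast
  show "(0 \<in> iso_nonpoles A \<inter> poles B \<and> \<not> nilpotent_op B \<or>
      0 \<in> poles A \<inter> iso_nonpoles B \<and> \<not> nilpotent_op A \<or>
      0 \<in> iso_nonpoles A \<inter> iso_nonpoles B \<longrightarrow> 0 \<in> iso_nonpoles T)"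
    using nonpole_rep swapped.nonpole_rep not_nilpotent_of_nonpole iso by blast
qed

end

section \<open>The two instances: multiplication operators and tensor products\<close>

lemma norm_cblinfun_le:
  assumes "0 \<le> K" "\<And>x. norm (capply T x) \<le> K * norm x"
  shows "norm T \<le> K"
  unfolding norm_cblinfun_onorm by (rule onorm_bound[OF assms])

text \<open>The form in which infinite dimension enters: the zero space is spanned by the empty
  set.\<close>

lemma one_endo_nonzero:
  assumes "\<nexists>S :: 'x::complex_banach set. finite S \<and> cvs.span S = UNIV"
  shows "(1 :: 'x endo) \<noteq> 0"
proof
  assume eq: "(1 :: 'x endo) = 0"
  have "x = 0" for x :: 'x
  proof -
    have "x = capply (op_of (1 :: 'x endo)) x" by (simp add: op_of_simps capply_cid)
    also have "\<dots> = 0" unfolding eq by (simp add: op_of_simps capply_zero)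
    finally show ?thesis .
  qed
  then have "cvs.span {} = (UNIV :: 'x set)" by auto
  with assms show False by blast
qed

lemma cross_rep_mult_operator:
  assumes "\<nexists>S :: 'x::complex_banach set. finite S \<and> cvs.span S = UNIV"
    and "\<nexists>S :: 'y::complex_banach set. finite S \<and> cvs.span S = UNIV"
  shows "cross_rep (\<lambda>(a :: 'x endo) (b :: 'y endo). Endo (mult_operator (op_of a) (op_of b)))"
proof
  fix a a' :: "'x endo" and b b' :: "'y endo"
  let ?M = "\<lambda>(a :: 'x endo) (b :: 'y endo). Endo (mult_operator (op_of a) (op_of b))"
  show "?M (a + a') b = ?M a b + ?M a' b"
    by (auto simp: op_of_eq_iff op_of_simps capply_mult_operator capply_plus ccompose_algebra intro!: capply_eqI)
  show "?M a (b + b') = ?M a b + ?M a b'"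
    by (auto simp: op_of_eq_iff op_of_simps capply_mult_operator capply_plus ccompose_algebra intro!: capply_eqI)
  show "?M 1 1 = 1"
    by (auto simp: op_of_eq_iff op_of_simps capply_mult_operator capply_cid ccompose_algebra intro!: capply_eqI)
  show "?M a b * ?M a' b' = ?M (a * a') (b * b')" if "b * b' = b' * b"
  proof -
    have "op_of b o\<^sub>C op_of b' = op_of b' o\<^sub>C op_of b" using that by (simp add: op_of_eq_iff op_of_simps)
    then have "op_of a o\<^sub>C (op_of a' o\<^sub>C U o\<^sub>C op_of b') o\<^sub>C op_of b
        = op_of a o\<^sub>C op_of a' o\<^sub>C U o\<^sub>C (op_of b o\<^sub>C op_of b')" for U
      by (metis ccompose_assoc)
    then show ?thesis
      unfolding op_of_eq_iff op_of_simps
      by (intro capply_eqI) (simp only: capply_mult_operator capply_ccompose)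
  qed
  show "norm (?M a b) \<le> norm a * norm b"
    unfolding norm_endo.rep_eq op_of_Endo
  proof (rule norm_cblinfun_le)
    fix U
    have "norm (op_of a o\<^sub>C U o\<^sub>C op_of b) \<le> norm (op_of a o\<^sub>C U) * norm (op_of b)" by (rule norm_ccompose)
    also have "\<dots> \<le> (norm (op_of a) * norm U) * norm (op_of b)" by (intro mult_right_mono norm_ccompose) simp
    finally show "norm (capply (mult_operator (op_of a) (op_of b)) U) \<le> norm (op_of a) * norm (op_of b) * norm U"
      by (simp add: capply_mult_operator mult_ac)
  qed simp
  show "a = 0 \<or> b = 0" if zero: "?M a b = 0"
  proof (rule ccontr)
    assume "\<not> (a = 0 \<or> b = 0)"
    then obtain x y where x: "capply (op_of a) x \<noteq> 0" and y: "capply (op_of b) y \<noteq> 0"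
      by (metis capply_eqI capply_zero op_of_eq_iff zero_endo.rep_eq)
    obtain f :: "'y \<Rightarrow>\<^sub>B complex" where f: "capply f (capply (op_of b) y) \<noteq> 0" using hahn_banach[OF y] .
    \<comment> \<open>A rank-one operator: \<open>A U B\<close> sends \<open>y\<close> to
      \<open>f (B y)\<close> times \<open>A x\<close>, which is nonzero.\<close>
    define u where "u v = capply f v *\<^sub>C x" for v
    have "clinear u"
      by (rule clinearI)
        (simp_all add: u_def clinear_add[OF clinear_capply] clinear_scaleC[OF clinear_capply]
          scaleC_add_left scaleC_complex_def scaleC_scaleC)
    moreover have "norm (u v) \<le> (norm f * norm x) * norm v" for v
      using mult_right_mono[OF norm_capply[of f v], of "norm x"] by (simp add: u_def norm_scaleC mult_ac)
    ultimately have u: "capply (CBlinfun (Blinfun u)) = u" by (rule capply_CBlinfun_Blinfun)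
    have "op_of a o\<^sub>C CBlinfun (Blinfun u) o\<^sub>C op_of b = 0"
      using zero by (metis capply_mult_operator capply_zero op_of_Endo zero_endo.rep_eq)
    then have "capply (op_of a) (u (capply (op_of b) y)) = 0"
      by (metis capply_ccompose capply_zero u)
    then show False using x f by (simp add: u_def clinear_scaleC[OF clinear_capply])
  qed
qed (rule one_endo_nonzero assms)+

text \<open>Elementary tensors span: induction over a finitely supported representative, adding one
  generator at a time.\<close>

lemma tensor_linear_eqI:
  fixes f g :: "('a::complex_vector, 'b::complex_vector) tensor \<Rightarrow> 'c::complex_vector"
  assumes "clinear f" "clinear g" "\<And>x y. f (x \<otimes> y) = g (x \<otimes> y)"
  shows "f u = g u"
proof -
  have "f (abs_tensor p) = g (abs_tensor p)" for p
  proof (induction p rule: update_induct)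
    case const
    have "f 0 = 0" "g 0 = 0"
      using clinear_scaleC[OF assms(1), of 0 0] clinear_scaleC[OF assms(2), of 0 0] by simp_all
    then show ?case by (simp flip: zero_tensor.abs_eq)
  next
    case (update p k c)
    \<comment> \<open>The key \<open>k\<close> is new, so updating amounts to adding.\<close>
    have "Poly_Mapping.update k c p = c *\<^sub>C Poly_Mapping.single k 1 + p"
      using update(1)
      by (intro poly_mapping_eqI)
        (auto simp: lookup_update lookup_add lookup_scaleC lookup_single scaleC_complex_def when_def in_keys_iff)
    then have "abs_tensor (Poly_Mapping.update k c p) = c *\<^sub>C (fst k \<otimes> snd k) + abs_tensor p"
      by (simp add: scaleC_tensor.abs_eq plus_tensor.abs_eq tensor_prod.abs_eq)
    then show ?case
      using update(3)
      by (simp add: assms(3) clinear_add[OF assms(1)] clinear_add[OF assms(2)]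
          clinear_scaleC[OF assms(1)] clinear_scaleC[OF assms(2)])
  qed
  from this[of "rep_tensor u"] show ?thesis by (simp only: Quotient_abs_rep[OF Quotient_tensor])
qed

locale tensor_completion =
  fixes \<nu> :: "('x::complex_banach, 'y::complex_banach) tensor \<Rightarrow> real"
    and J :: "('x, 'y) tensor \<Rightarrow> 'z::complex_banach"
  assumes cross: "reasonable_uniform_cross_norm \<nu>" and completion: "is_completion \<nu> J"
begin

lemma J_linear: "clinear J" and J_norm: "norm (J u) = \<nu> u" and J_dense: "closure (range J) = UNIV"
  using completion by (auto simp: is_completion_def)

text \<open>Linearity extends agreement to the algebraic tensor product, density to its
  completion.\<close>

lemma operator_eqI:
  assumes "\<And>x y. capply S (J (x \<otimes> y)) = capply T (J (x \<otimes> y))"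
  shows "S = T"
proof (rule capply_eqI)
  fix z
  have lin: "clinear (\<lambda>u. capply R (J u))" for R :: "'z \<Rightarrow>\<^sub>B 'w::complex_normed_vector"
    by (rule clinearI)
      (simp_all add: clinear_add[OF J_linear] clinear_scaleC[OF J_linear]
        clinear_add[OF clinear_capply] clinear_scaleC[OF clinear_capply])
  have cont: "continuous_on UNIV (capply R)" for R :: "'z \<Rightarrow>\<^sub>B 'w::complex_normed_vector"
    by (simp add: bounded_linear_capply linear_continuous_on)
  show "capply S z = capply T z"
    by (rule dense_agree[OF cont cont J_dense])
      (use tensor_linear_eqI[OF lin lin, of S T] assms in auto)
qed

lemma tensor_op_norm: "norm (tensor_op J A B) \<le> norm A * norm B"
proof (rule norm_cblinfun_le)
  fix z
  let ?T = "capply (tensor_op J A B)"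
  have "\<forall>u. ?T (J u) = J (tensor_map (capply A) (capply B) u)"
    unfolding tensor_op_def by (rule theI'[OF tensor_op_unique_exists[OF cross completion]])
  moreover have "\<nu> (tensor_map (capply A) (capply B) u) \<le> norm A * norm B * \<nu> u" for u
    using cross by (auto simp: reasonable_uniform_cross_norm_def)
  ultimately have "norm (?T (J u)) \<le> norm A * norm B * norm (J u)" for u by (simp add: J_norm)
  moreover have "closed {z. norm (?T z) \<le> norm A * norm B * norm z}"
    by (intro closed_Collect_le continuous_intros linear_continuous_on[OF bounded_linear_capply])
  ultimately have "closure (range J) \<subseteq> {z. norm (?T z) \<le> norm A * norm B * norm z}"
    by (intro closure_minimal) auto
  then show "norm (?T z) \<le> norm A * norm B * norm z" by (auto simp: J_dense)
qed simp

lemmas tensor_op_J = tensor_op_apply[OF cross completion]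

lemma J_prod_add:
  "J ((x + x') \<otimes> y) = J (x \<otimes> y) + J (x' \<otimes> y)" "J (x \<otimes> (y + y')) = J (x \<otimes> y) + J (x \<otimes> y')"
  by (simp_all add: clinear_add[OF cbilinear_tensor_prod[unfolded cbilinear_def, THEN conjunct1, rule_format]]
      clinear_add[OF cbilinear_tensor_prod[unfolded cbilinear_def, THEN conjunct2, rule_format]]
      clinear_add[OF J_linear])

lemma cross_rep_tensor_op:
  assumes "\<nexists>S :: 'x set. finite S \<and> cvs.span S = UNIV"
    and "\<nexists>S :: 'y set. finite S \<and> cvs.span S = UNIV"
  shows "cross_rep (\<lambda>a b. Endo (tensor_op J (op_of a) (op_of b)))"
proof
  fix a a' :: "'x endo" and b b' :: "'y endo"
  let ?M = "\<lambda>a b. Endo (tensor_op J (op_of a) (op_of b))"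
  show "?M (a + a') b = ?M a b + ?M a' b" "?M a (b + b') = ?M a b + ?M a b'" "?M 1 1 = 1"
    "?M a b * ?M a' b' = ?M (a * a') (b * b')"
    unfolding op_of_eq_iff op_of_simps
    by (rule operator_eqI; simp add: tensor_op_J capply_plus capply_cid capply_ccompose J_prod_add)+
  show "norm (?M a b) \<le> norm a * norm b"
    by (simp add: norm_endo.rep_eq op_of_Endo tensor_op_norm)
  show "a = 0 \<or> b = 0" if zero: "?M a b = 0"
  proof -
    have "norm (capply (op_of a) x) * norm (capply (op_of b) y) = 0" for x y
    proof -
      have "norm (capply (op_of a) x) * norm (capply (op_of b) y) = norm (J (capply (op_of a) x \<otimes> capply (op_of b) y))"
        using cross by (simp add: J_norm reasonable_uniform_cross_norm_def cross_norm_def)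
      also have "\<dots> = norm (capply (op_of (?M a b)) (J (x \<otimes> y)))" by (simp add: op_of_Endo tensor_op_J)
      also have "\<dots> = 0" unfolding zero by (simp add: op_of_simps capply_zero)
      finally show ?thesis .
    qed
    then have "(\<forall>x. capply (op_of a) x = 0) \<or> (\<forall>y. capply (op_of b) y = 0)" by auto
    then show ?thesis by (auto simp: op_of_eq_iff op_of_simps capply_zero intro: capply_eqI)
  qed
qed (rule one_endo_nonzero assms)+

end

theorem theorem3p2:
  fixes A :: "'x::complex_banach \<Rightarrow>\<^sub>B 'x" and B :: "'y::complex_banach \<Rightarrow>\<^sub>B 'y"
    and \<nu> :: "('x, 'y) tensor \<Rightarrow> real" and J :: "('x, 'y) tensor \<Rightarrow> 'z::complex_banach"
    and AB :: "'z \<Rightarrow>\<^sub>B 'z" and \<tau> :: "('y \<Rightarrow>\<^sub>B 'x) \<Rightarrow>\<^sub>B ('y \<Rightarrow>\<^sub>B 'x)"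
  assumes "\<nexists>S :: 'x set. finite S \<and> cvs.span S = UNIV"
    and "\<nexists>S :: 'y set. finite S \<and> cvs.span S = UNIV"
    and "reasonable_uniform_cross_norm \<nu>" and "is_completion \<nu> J"
  defines "AB \<equiv> tensor_op J A B" and "\<tau> \<equiv> mult_operator A B"
  assumes "0 \<in> iso_spectrum AB"
  shows
    "(spectrum A = {0} \<and> poles A = {0} \<or> spectrum B = {0} \<and> poles B = {0} \<longrightarrow>
       spectrum AB = {0} \<and> poles AB = {0} \<and> poles \<tau> = {0} \<and> spectrum \<tau> = {0}) \<and>
     (spectrum A = {0} \<and> iso_nonpoles A = {0} \<and> \<not> nilpotent_op B \<or>
      spectrum B = {0} \<and> iso_nonpoles B = {0} \<and> \<not> nilpotent_op A \<longrightarrow>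
       spectrum AB = {0} \<and> iso_nonpoles AB = {0} \<and> iso_nonpoles \<tau> = {0} \<and> spectrum \<tau> = {0}) \<and>
     (0 \<in> poles A \<and> 0 \<notin> spectrum B \<or> 0 \<notin> spectrum A \<and> 0 \<in> poles B \<longrightarrow>
       0 \<in> poles AB \<inter> poles \<tau>) \<and>
     (0 \<in> iso_nonpoles A \<and> spectrum A \<noteq> {0} \<and> 0 \<notin> spectrum B \<or>
      0 \<notin> spectrum A \<and> 0 \<in> iso_nonpoles B \<and> spectrum B \<noteq> {0} \<longrightarrow>
       0 \<in> iso_nonpoles AB \<inter> iso_nonpoles \<tau>) \<and>
     (0 \<in> poles A \<inter> poles B \<longrightarrow> 0 \<in> poles AB \<inter> poles \<tau>) \<and>
     (0 \<in> iso_nonpoles A \<inter> poles B \<and> \<not> nilpotent_op B \<or>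
      0 \<in> poles A \<inter> iso_nonpoles B \<and> \<not> nilpotent_op A \<or>
      0 \<in> iso_nonpoles A \<inter> iso_nonpoles B \<longrightarrow>
       0 \<in> iso_nonpoles AB \<inter> iso_nonpoles \<tau>)"
proof -
  interpret tensor_completion \<nu> J
    by unfold_locales (rule assms(3,4))+
  interpret AB: operator_cross_rep "\<lambda>a b. Endo (tensor_op J (op_of a) (op_of b))" A B AB
    by (rule operator_cross_rep.intro[OF cross_rep_tensor_op[OF assms(1,2)]])
      (simp add: operator_cross_rep_axioms_def AB_def op_of_Endo)
  interpret \<tau>: operator_cross_rep "\<lambda>a b. Endo (mult_operator (op_of a) (op_of b))" A B \<tau>
    by (rule operator_cross_rep.intro[OF cross_rep_mult_operator[OF assms(1,2)]])
      (simp add: operator_cross_rep_axioms_def \<tau>_def op_of_Endo)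
  note AB = AB.transfer_of_poles and \<tau> = \<tau>.transfer_of_poles
  show ?thesis
  proof (intro conjI, goal_cases)
    case 1
    show ?case using AB(1) \<tau>(1) by blast
  next
    case 2
    show ?case using AB(2) \<tau>(2) by blast
  next
    case 3
    show ?case using AB(3) \<tau>(3) by blast
  next
    case 4
    show ?case using AB(4) \<tau>(4) by blast
  next
    case 5
    show ?case using AB(5) \<tau>(5) by blast
  next
    case 6
    show ?case using AB(6) \<tau>(6) by blast
  qed
qed

end
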